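(* Let $n\ge2$ and $1\le m<n$ be integers, and let $\Omega\subseteq\mathbb{R}^n$ be a bounded domain with $|\Omega|=1$. Let $\|\cdot\|_{X(0,1)}$ be an r.i. function norm that is sublimiting. Let $\|\cdot\|_{Y(0,1)}$ be an r.i. function norm such that $$Y_X(0,1)\hookrightarrow Y(0,1)\hookrightarrow M_{Y_X}(0,1).$$ Let $B(x_0,R)\subseteq\Omega$ be a ball inside $\Omega$. There are constants $C_1$ and $C_2$ (independent of $a$) such that for every $a\in(0,1)$ there are a function $f\in\mathscr{S}_{a/2,a}$ and a function $u_f\in V_0^mX(\Omega)\cap\mathcal{C}^{m-1}(\Omega\setminus\{x_0\})$ such that $$\|u_f\|_{V_0^mX(\Omega)}\le C_1\|f\|_{X(0,1)}=C_1,$$ $$0<C_2\le\|u_f\|_{Y(\Omega)}<\infty,$$ and the support of $u_f$ is the closed ball $\bar B(x_0,a^{1/n}R)$. Furthermore, these functions (one pair $f$, $u_f$ for each $a\in(0,1)$) are such that if $\sum_{j=1}^M\alpha_ju_{f_j}$ is a linear combination of such functions (with $M\in\mathbb{N}$, $\alpha_j\in\mathbb{R}$, and $f_j$, $u_{f_j}$ corresponding to $a_j\in(0,1)$), then $$\Big\|\sum_{j=1}^M\alpha_ju_{f_j}\Big\|_{V_0^mX(\Omega)}\le C_1\Big\|\sum_{j=1}^M\alpha_jf_j\Big\|_{X(0,1)}.$$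
   Context: $A\approx B$ means that each of $A,B$ is bounded by a positive constant multiple of the other, with constants independent of the variable over which the relation is quantified. Rearrangement: for a measurable function $f$ on a measure space $(R,\mu)$ with $\mu(R)=1$ (here $\Omega$ or $(0,1)$ with Lebesgue measure), $f^*(t)=\inf\{\lambda>0:\mu(\{|f|>\lambda\})\le t\}$ and $f^{**}(t)=\frac1t\int_0^tf^*(s)\,ds$, $t\in(0,\infty)$. Functions $f,g$ are equimeasurable if $f^*=g^*$. R.i. function norm: a functional $\|\cdot\|_{X(0,1)}$ on nonnegative measurable functions on $(0,1)$ with values in $[0,\infty]$ such that: (P1) it is subadditive, positively homogeneous, and vanishes exactly at functions equal to $0$ a.e.; (P2) $f\le g$ a.e. implies $\|f\|\le\|g\|$; (P3) $f_k\nearrow f$ a.e. implies $\|f_k\|\nearrow\|f\|$; (P4) $\|1\|<\infty$; (P5) $\|f\|_{L^1(0,1)}\le C_X\|f\|_{X(0,1)}$ for some constant $C_X$; (P6) $\|f\|=\|g\|$ if $f,g$ are equimeasurable. It is extended to all measurable $f$ by $\|f\|=\|\,|f|\,\|$. The r.i. space $X(R,\mu)$ is the set of measurable $f$ on $R$ with $\|f\|_{X(R,\mu)}=\|f^*\|_{X(0,1)}<\infty$. $A\hookrightarrow B$ means $A\subseteq B$ with bounded inclusion. Fundamental function: $\varphi_X(t)=\|\chi_E\|_{X}$ for any measurable $E$ with measure $t\in[0,1]$. Marcinkiewicz endpoint space: $\|f\|_{M_{Y_X}(0,1)}=\sup_{t\in(0,1)}f^{**}(t)\varphi_{Y_X}(t)$.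 Sobolev space: $V_0^mX(\Omega)$ is the space of $m$-times weakly differentiable functions $u$ on $\Omega$ whose extension by $0$ outside $\Omega$ is $m$-times weakly differentiable and $\|u\|_{V_0^mX(\Omega)}=\|\,|\nabla^mu|\,\|_{X(\Omega)}<\infty$, where $\nabla^mu$ is the vector of all $m$th-order weak derivatives. Optimal target: for every r.i. space $X(\Omega)$ there is (Kerman–Pick) an r.i. space $Y_X(\Omega)$, unique up to equivalent norms, such that $V_0^mX(\Omega)\hookrightarrow Y_X(\Omega)$ and, whenever $Y(\Omega)$ is an r.i. space with $V_0^mX(\Omega)\hookrightarrow Y(\Omega)$, then $Y_X(\Omega)\hookrightarrow Y(\Omega)$. Its associate norm, $\|g\|_{Y_X'(0,1)}=\sup_{\|f\|_{Y_X(0,1)}\le1}\int_0^1|fg|$, is known to be given by $\|g\|_{Y_X'(0,1)}=\|t^{m/n}g^{**}(t)\|_{X'(0,1)}$, where $\|g\|_{X'(0,1)}=\sup_{\|f\|_{X(0,1)}\le1}\int_0^1|fg|$. Sublimiting: $\|\cdot\|_{X(0,1)}$ is sublimiting if $\varphi_{Y_X}(t)\approx t^{-m/n}\varphi_X(t)$ for every $t\in(0,1)$. For $0\le a<b\le1$, $\mathscr{S}_{a,b}=\{\alpha\chi_{(a,b)}:\alpha>0\}$. *)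

theory Defs
  imports "HOL-Analysis.Analysis"
begin

section \<open>Rearrangements and rearrangement-invariant spaces\<close>

text \<open>Function norms act on nonnegative functions that may take the value infinity, hence
  on \<open>ennreal\<close>-valued functions; infimum of the empty set is infinity.\<close>

definition rearr :: "'a measure \<Rightarrow> ('a \<Rightarrow> ennreal) \<Rightarrow> real \<Rightarrow> ennreal" where
  "rearr M f t =
     (INF l\<in>{l::real. 0 < l \<and> emeasure M {x \<in> space M. ennreal l < f x} \<le> ennreal t}. ennreal l)"

definition max_rearr :: "'a measure \<Rightarrow> ('a \<Rightarrow> ennreal) \<Rightarrow> real \<Rightarrow> ennreal" where
  "max_rearr M f t = (\<integral>\<^sup>+s\<in>{0<..<t}. rearr M f s \<partial>lborel) / ennreal t"

abbreviation unit_ivl :: "real measure" where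
  "unit_ivl \<equiv> lebesgue_on {0<..<1}"

definition equimeasurable :: "'a measure \<Rightarrow> ('a \<Rightarrow> ennreal) \<Rightarrow> ('a \<Rightarrow> ennreal) \<Rightarrow> bool" where
  "equimeasurable M f g \<longleftrightarrow> (\<forall>t>0. rearr M f t = rearr M g t)"

definition ri_function_norm :: "((real \<Rightarrow> ennreal) \<Rightarrow> ennreal) \<Rightarrow> bool" where
  "ri_function_norm N \<longleftrightarrow>
     (\<forall>f\<in>borel_measurable unit_ivl. \<forall>g\<in>borel_measurable unit_ivl.
        N (\<lambda>t. f t + g t) \<le> N f + N g) \<and>
     (\<forall>f\<in>borel_measurable unit_ivl. \<forall>c::real. 0 \<le> c \<longrightarrow>
        N (\<lambda>t. ennreal c * f t) = ennreal c * N f) \<and>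
     (\<forall>f\<in>borel_measurable unit_ivl. N f = 0 \<longleftrightarrow> (AE t in unit_ivl. f t = 0)) \<and>
     (\<forall>f\<in>borel_measurable unit_ivl. \<forall>g\<in>borel_measurable unit_ivl.
        (AE t in unit_ivl. f t \<le> g t) \<longrightarrow> N f \<le> N g) \<and>
     (\<forall>F. \<forall>f\<in>borel_measurable unit_ivl. (\<forall>k::nat. F k \<in> borel_measurable unit_ivl) \<longrightarrow>
        (AE t in unit_ivl. incseq (\<lambda>k. F k t) \<and> (\<lambda>k. F k t) \<longlonglongrightarrow> f t) \<longrightarrow>
        incseq (\<lambda>k. N (F k)) \<and> (\<lambda>k. N (F k)) \<longlonglongrightarrow> N f) \<and>
     N (\<lambda>t. 1) < \<infinity> \<and>
     (\<exists>C::real. 0 < C \<and>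
        (\<forall>f\<in>borel_measurable unit_ivl. (\<integral>\<^sup>+t. f t \<partial>unit_ivl) \<le> ennreal C * N f)) \<and>
     (\<forall>f\<in>borel_measurable unit_ivl. \<forall>g\<in>borel_measurable unit_ivl.
        equimeasurable unit_ivl f g \<longrightarrow> N f = N g)"

definition fun_norm :: "((real \<Rightarrow> ennreal) \<Rightarrow> ennreal) \<Rightarrow> (real \<Rightarrow> real) \<Rightarrow> ennreal" where
  "fun_norm N f = N (\<lambda>t. ennreal \<bar>f t\<bar>)"

definition ri_norm :: "((real \<Rightarrow> ennreal) \<Rightarrow> ennreal) \<Rightarrow> 'a measure \<Rightarrow> ('a \<Rightarrow> real) \<Rightarrow> ennreal" where
  "ri_norm N M f = N (rearr M (\<lambda>x. ennreal \<bar>f x\<bar>))"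

definition ri_space :: "((real \<Rightarrow> ennreal) \<Rightarrow> ennreal) \<Rightarrow> 'a measure \<Rightarrow> ('a \<Rightarrow> real) set" where
  "ri_space N M = {f \<in> borel_measurable M. ri_norm N M f < \<infinity>}"

definition embeds :: "'b set \<Rightarrow> ('b \<Rightarrow> ennreal) \<Rightarrow> 'b set \<Rightarrow> ('b \<Rightarrow> ennreal) \<Rightarrow> bool" where
  "embeds A p B q \<longleftrightarrow> A \<subseteq> B \<and> (\<exists>C::real. 0 < C \<and> (\<forall>f\<in>A. q f \<le> ennreal C * p f))"

definition ri_embeds ::
  "'a measure \<Rightarrow> ((real \<Rightarrow> ennreal) \<Rightarrow> ennreal) \<Rightarrow> ((real \<Rightarrow> ennreal) \<Rightarrow> ennreal) \<Rightarrow> bool" where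
  "ri_embeds M N1 N2 \<longleftrightarrow> embeds (ri_space N1 M) (ri_norm N1 M) (ri_space N2 M) (ri_norm N2 M)"

text \<open>By rearrangement invariance the value does not depend on the chosen set of measure t;
  we take the interval from 0 to t.\<close>

definition fundamental :: "((real \<Rightarrow> ennreal) \<Rightarrow> ennreal) \<Rightarrow> real \<Rightarrow> ennreal" where
  "fundamental N t = N (indicator {0<..<t})"

definition marcinkiewicz ::
  "((real \<Rightarrow> ennreal) \<Rightarrow> ennreal) \<Rightarrow> (real \<Rightarrow> ennreal) \<Rightarrow> ennreal" where
  "marcinkiewicz N f = (SUP t\<in>{0<..<1}. max_rearr unit_ivl f t * fundamental N t)"

definition equivalent_on :: "'b set \<Rightarrow> ('b \<Rightarrow> ennreal) \<Rightarrow> ('b \<Rightarrow> ennreal) \<Rightarrow> bool" where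
  "equivalent_on S A B \<longleftrightarrow>
     (\<exists>C::real. 0 < C \<and> (\<forall>t\<in>S. A t \<le> ennreal C * B t \<and> B t \<le> ennreal C * A t))"

section \<open>Classical and weak derivatives\<close>

text \<open>Used for open S only: all directional derivatives of order at most k exist as
  Frechet derivatives of the preceding ones and are continuous.\<close>

primrec Ck_on :: "nat \<Rightarrow> 'a::real_normed_vector set \<Rightarrow> ('a \<Rightarrow> real) \<Rightarrow> bool" where
  "Ck_on 0 S f \<longleftrightarrow> continuous_on S f"
| "Ck_on (Suc k) S f \<longleftrightarrow>
     (\<forall>x\<in>S. f differentiable (at x)) \<and> (\<forall>v. Ck_on k S (\<lambda>x. frechet_derivative f (at x) v))"

definition test_functions :: "'a::real_normed_vector set \<Rightarrow> ('a \<Rightarrow> real) set" where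
  "test_functions U =
     {\<phi>. (\<forall>k. Ck_on k UNIV \<phi>) \<and> compact (closure {x. \<phi> x \<noteq> 0}) \<and> closure {x. \<phi> x \<noteq> 0} \<subseteq> U}"

primrec partials :: "'n list \<Rightarrow> (real^'n \<Rightarrow> real) \<Rightarrow> real^'n \<Rightarrow> real" where
  "partials [] f = f"
| "partials (i # is) f = (\<lambda>x. frechet_derivative (partials is f) (at x) (axis i 1))"

definition locally_integrable :: "(real^'n) set \<Rightarrow> (real^'n \<Rightarrow> real) \<Rightarrow> bool" where
  "locally_integrable U u \<longleftrightarrow> (\<forall>K. compact K \<and> K \<subseteq> U \<longrightarrow> u absolutely_integrable_on K)"

text \<open>The function \<open>\<alpha>\<close> is a multi-index. A classical derivative with multi-index \<open>\<alpha>\<close> of a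
  test function is obtained by differentiating successively along any list of coordinates
  in which each i occurs \<open>\<alpha> i\<close> times; the order is immaterial for smooth functions.\<close>

definition has_weak_deriv ::
  "(real^'n) set \<Rightarrow> ('n \<Rightarrow> nat) \<Rightarrow> (real^'n \<Rightarrow> real) \<Rightarrow> (real^'n \<Rightarrow> real) \<Rightarrow> bool" where
  "has_weak_deriv U \<alpha> u v \<longleftrightarrow>
     locally_integrable U u \<and> locally_integrable U v \<and>
     (\<forall>\<phi>\<in>test_functions U. \<forall>is. (\<forall>i. count_list is i = \<alpha> i) \<longrightarrow>
        (LINT x|lebesgue_on U. u x * partials is \<phi> x) =
        (-1) ^ (\<Sum>i\<in>UNIV. \<alpha> i) * (LINT x|lebesgue_on U. v x * \<phi> x))"

definition weakly_diff :: "nat \<Rightarrow> (real^'n) set \<Rightarrow> (real^'n \<Rightarrow> real) \<Rightarrow> bool" where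
  "weakly_diff m U u \<longleftrightarrow> (\<forall>\<alpha>. (\<Sum>i\<in>UNIV. \<alpha> i) \<le> m \<longrightarrow> (\<exists>v. has_weak_deriv U \<alpha> u v))"

text \<open>Weak derivatives are unique up to null sets, so the choice below does not
  affect rearrangements.\<close>

definition weak_deriv ::
  "(real^'n) set \<Rightarrow> ('n \<Rightarrow> nat) \<Rightarrow> (real^'n \<Rightarrow> real) \<Rightarrow> real^'n \<Rightarrow> real" where
  "weak_deriv U \<alpha> u = (SOME v. has_weak_deriv U \<alpha> u v)"

definition grad_norm :: "nat \<Rightarrow> (real^'n) set \<Rightarrow> (real^'n \<Rightarrow> real) \<Rightarrow> real^'n \<Rightarrow> real" where
  "grad_norm m U u x = L2_set (\<lambda>\<alpha>. weak_deriv U \<alpha> u x) {\<alpha>. (\<Sum>i\<in>UNIV. \<alpha> i) = m}"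

section \<open>Sobolev spaces and optimal targets\<close>

definition sobolev_norm ::
  "nat \<Rightarrow> (real^'n) set \<Rightarrow> ((real \<Rightarrow> ennreal) \<Rightarrow> ennreal) \<Rightarrow> (real^'n \<Rightarrow> real) \<Rightarrow> ennreal" where
  "sobolev_norm m \<Omega> N u = ri_norm N (lebesgue_on \<Omega>) (grad_norm m \<Omega> u)"

text \<open>Functions on \<open>\<Omega>\<close> are represented by functions on the whole space whose values
  outside \<open>\<Omega>\<close> are irrelevant.\<close>

definition sobolev_space ::
  "nat \<Rightarrow> (real^'n) set \<Rightarrow> ((real \<Rightarrow> ennreal) \<Rightarrow> ennreal) \<Rightarrow> (real^'n \<Rightarrow> real) set" where
  "sobolev_space m \<Omega> N =
     {u. weakly_diff m \<Omega> u \<and> weakly_diff m UNIV (\<lambda>x. if x \<in> \<Omega> then u x else 0) \<and>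
         sobolev_norm m \<Omega> N u < \<infinity>}"

definition sobolev_embeds ::
  "nat \<Rightarrow> (real^'n) set \<Rightarrow> ((real \<Rightarrow> ennreal) \<Rightarrow> ennreal) \<Rightarrow> ((real \<Rightarrow> ennreal) \<Rightarrow> ennreal) \<Rightarrow> bool"
where
  "sobolev_embeds m \<Omega> X Y \<longleftrightarrow>
     embeds (sobolev_space m \<Omega> X) (sobolev_norm m \<Omega> X)
            (ri_space Y (lebesgue_on \<Omega>)) (ri_norm Y (lebesgue_on \<Omega>))"

text \<open>Optimal targets are unique only up to equivalence of norms, hence a predicate.\<close>

definition optimal_target ::
  "nat \<Rightarrow> (real^'n) set \<Rightarrow> ((real \<Rightarrow> ennreal) \<Rightarrow> ennreal) \<Rightarrow> ((real \<Rightarrow> ennreal) \<Rightarrow> ennreal) \<Rightarrow> bool"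
where
  "optimal_target m \<Omega> X YX \<longleftrightarrow>
     ri_function_norm YX \<and> sobolev_embeds m \<Omega> X YX \<and>
     (\<forall>Y. ri_function_norm Y \<and> sobolev_embeds m \<Omega> X Y \<longrightarrow> ri_embeds (lebesgue_on \<Omega>) YX Y)"

text \<open>Here YX is meant to be an optimal target for X, and n is the dimension.\<close>

definition sublimiting ::
  "nat \<Rightarrow> nat \<Rightarrow> ((real \<Rightarrow> ennreal) \<Rightarrow> ennreal) \<Rightarrow> ((real \<Rightarrow> ennreal) \<Rightarrow> ennreal) \<Rightarrow> bool" where
  "sublimiting n m X YX \<longleftrightarrow>
     equivalent_on {0<..<1} (fundamental YX)
       (\<lambda>t. ennreal (t powr (- (real m / real n))) * fundamental X t)"

definition step_functions :: "real \<Rightarrow> real \<Rightarrow> (real \<Rightarrow> real) set" where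
  "step_functions a b = {(\<lambda>t. c * indicator {a<..<b} t) | c. 0 < c}"

end

theory Submission
  imports Defs
begin

text \<open>
  For a point \<open>x\<close> let \<open>s = (|x - x\<^sub>0| / R)\<^sup>n\<close>, the fraction of the ball \<open>B(x\<^sub>0,R)\<close> that is nearer to the
  centre than \<open>x\<close>.  All the functions \<open>u\<^sub>a\<close> are images of the normalised steps
  \<open>f\<^sub>a = \<chi>\<^bsub>(a/2,a)\<^esub> / \<phi>\<^sub>X(a/2)\<close> under one linear operator, \<open>f \<mapsto> h\<^sub>m(s\<^sup>2)\<close>, where
  \<open>h\<^sub>0(q) = q\<^bsup>m/(2n)-m\<^esup> f(\<surd>q)\<close> and \<open>h\<^bsub>i+1\<^esub>(q) = \<integral>\<^sub>q\<^sup>1 h\<^sub>i\<close>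
  (\<open>radial_lift\<close>).  If this operator is bounded, then one constant serves single steps and
  linear combinations of steps alike.

  Boundedness: \<open>s\<^sup>2\<close> is a polynomial \<open>Q\<close> in \<open>x\<close>.  Hence the derivatives of order \<open>m\<close> are sums of terms
  \<open>h\<^bsub>m-j\<^esub>(Q) A\<^sub>j\<close>, \<open>1 \<le> j \<le> m\<close>, where \<open>A\<^sub>j\<close> is a polynomial, homogeneous about \<open>x\<^sub>0\<close> of degree
  \<open>2nj - m\<close>.  The term \<open>j = m\<close> is bounded by a multiple of \<open>|f(s)|\<close>; since all the degrees exceed \<open>n\<close>,
  the others are bounded by multiples of \<open>s \<integral>\<^sub>s\<^sup>1 |f(t)| t\<^sup>-\<^sup>2 dt = \<integral>\<^sub>0\<^sup>1 |f(s/r)| dr\<close>.  The choice of \<open>s\<^sup>2\<close>,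
  and not of a smaller power of \<open>|x - x\<^sub>0|\<close>, as the inner function serves this purpose.  The last
  integral is an average of dilations of \<open>|f|\<close>, none of which has larger norm than \<open>f\<close>; its Riemann
  sums and the Fatou property bound its norm in every r.i. space (\<open>ri_norm_weighted_tail_le\<close>).
  Since \<open>x \<mapsto> s\<close> maps Lebesgue measure on the ball to a multiple of Lebesgue measure on
  \<open>(0,1)\<close>, the estimate transfers to the domain (\<open>sobolev_norm_radial_lift_le\<close>).

  Weak derivatives: the lifts are of class \<open>C\<^bsup>m-1\<^esup>\<close>, their derivatives of order \<open>m - 1\<close> are locally
  Lipschitz, and the derivatives of order \<open>m\<close> exist off finitely many spheres.  For such functions
  integration by parts follows from the translation invariance of Lebesgue measure
  (\<open>weak_integration_by_parts\<close>).  The fundamental lemma of the calculus of variations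
  (\<open>AE_eq_0_if_weakly_0\<close>) shows that the chosen weak derivatives agree with these formulas almost
  everywhere.

  Lower bound: \<open>u\<^sub>a\<close> is at least a multiple of \<open>a\<^bsup>m/n\<^esup> / \<phi>\<^sub>X(a/2)\<close> on the set \<open>0 < s < a/2\<close>, whose
  measure is proportional to \<open>a\<close>.  The embedding of \<open>Y\<close> into the Marcinkiewicz space, the sublimiting
  property and \<open>\<phi>\<^sub>X(2t) \<le> 2 \<phi>\<^sub>X(t)\<close> bound the norm of the indicator of this set in \<open>Y\<close> from below by
  a multiple of \<open>a\<^bsup>-m/n\<^esup> \<phi>\<^sub>X(a/2)\<close> (\<open>ri_norm_lifted_step_ge\<close>).
\<close>

section \<open>Distribution functions and rearrangements\<close>

lemma rearr_le_of_dist_le: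
  assumes "\<And>l. 0 < l \<Longrightarrow> emeasure M {x \<in> space M. ennreal l < f x}
                \<le> emeasure N {x \<in> space N. ennreal l < g x}"
  shows "rearr M f t \<le> rearr N g t"
  unfolding rearr_def
  by (rule INF_superset_mono) (use assms order_trans in blast)+

text \<open>The implication from left to right rests on the continuity of distribution functions from
  the right.\<close>

lemma rearr_le_iff:
  assumes f: "f \<in> borel_measurable M" and l: "0 < l"
  shows "rearr M f t \<le> ennreal l \<longleftrightarrow> emeasure M {x \<in> space M. ennreal l < f x} \<le> ennreal t"
proof
  assume "emeasure M {x \<in> space M. ennreal l < f x} \<le> ennreal t"
  then show "rearr M f t \<le> ennreal l"
    unfolding rearr_def using l by (intro INF_lower) auto
next
  assume le: "rearr M f t \<le> ennreal l"
  have above: "emeasure M {x \<in> space M. ennreal k < f x} \<le> ennreal t" if k: "l < k" for k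
  proof -
    have "rearr M f t < ennreal k"
      using le k l by (meson ennreal_lessI le_less_trans less_trans)
    then obtain j where j: "0 < j" "emeasure M {x \<in> space M. ennreal j < f x} \<le> ennreal t"
      "ennreal j < ennreal k"
      unfolding rearr_def INF_less_iff by auto
    have "emeasure M {x \<in> space M. ennreal k < f x} \<le> emeasure M {x \<in> space M. ennreal j < f x}"
      using f j(3) by (intro emeasure_mono) auto
    then show ?thesis using j(2) by simp
  qed
  let ?A = "\<lambda>i::nat. {x \<in> space M. ennreal (l + 1 / real (Suc i)) < f x}"
  \<comment> \<open>the level sets increase to the level set at \<open>l\<close>, so its measure is their supremum\<close>
  have "(\<Union>i. ?A i) = {x \<in> space M. ennreal l < f x}"
  proof (intro equalityI subsetI)
    fix x assume "x \<in> (\<Union>i. ?A i)"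
    then obtain i where i: "x \<in> space M" "ennreal (l + 1 / real (Suc i)) < f x" by blast
    have "ennreal l \<le> ennreal (l + 1 / real (Suc i))" by (intro ennreal_leI) simp
    then show "x \<in> {x \<in> space M. ennreal l < f x}" using i by auto
  next
    fix x assume "x \<in> {x \<in> space M. ennreal l < f x}"
    then have x: "x \<in> space M" "ennreal l < f x" by auto
    then obtain z where z: "ennreal l < z" "z < f x" using dense by blast
    then obtain r where r: "z = ennreal r" "0 \<le> r"
      by (cases z rule: ennreal_cases) auto
    have "l < r" using z(1) r l ennreal_less_iff by fastforce
    then obtain i where "1 / real (Suc i) < r - l"
      using nat_approx_posE[of "r - l"] by auto
    then have "ennreal (l + 1 / real (Suc i)) \<le> z" unfolding r by (intro ennreal_leI) simp
    then have "x \<in> ?A i" using z x by auto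
    then show "x \<in> (\<Union>i. ?A i)" by blast
  qed
  moreover have "(SUP i. emeasure M (?A i)) = emeasure M (\<Union>i. ?A i)"
  proof (rule SUP_emeasure_incseq)
    show "range ?A \<subseteq> sets M" using f by auto
    show "incseq ?A"
    proof (rule incseq_SucI)
      fix i
      have "ennreal (l + 1 / real (Suc (Suc i))) \<le> ennreal (l + 1 / real (Suc i))"
        by (intro ennreal_leI) (simp add: frac_le)
      then show "?A i \<le> ?A (Suc i)" by auto
    qed
  qed
  moreover have "emeasure M (?A i) \<le> ennreal t" for i by (rule above) simp
  ultimately show "emeasure M {x \<in> space M. ennreal l < f x} \<le> ennreal t"
    using SUP_least[of UNIV "\<lambda>i. emeasure M (?A i)" "ennreal t"] by simp
qed

lemma rearr_antimono: "s \<le> t \<Longrightarrow> rearr M f t \<le> rearr M f s"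
  unfolding rearr_def
  by (rule INF_superset_mono) (auto intro: order_trans ennreal_leI)

lemma borel_measurable_rearr [measurable]: "rearr M f \<in> borel_measurable borel"
proof (rule borel_measurableI_greater)
  fix y
  have "is_interval {t. y < rearr M f t}"
    unfolding is_interval_1 by (auto intro: less_le_trans rearr_antimono)
  then show "{x \<in> space borel. y < rearr M f x} \<in> sets borel"
    by (simp add: real_interval_borel_measurable)
qed

lemma space_unit_ivl [simp]: "space unit_ivl = {0<..<1}"
  by (simp add: space_restrict_space)

lemma borel_measurable_unit_ivl: "f \<in> borel_measurable borel \<Longrightarrow> f \<in> borel_measurable unit_ivl"
  by (intro measurable_restrict_space1 measurable_completion) simp

lemma emeasure_unit_ivl:
  "A \<in> sets borel \<Longrightarrow> A \<subseteq> {0<..<1} \<Longrightarrow> emeasure unit_ivl A = emeasure lborel A"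
  by (subst emeasure_restrict_space) (auto simp: emeasure_completion)

text \<open>The level set of the rearrangement is the interval \<open>(0,c)\<close>, where \<open>c\<close> is the measure of the level
  set of \<open>f\<close>; it fits into \<open>(0,1)\<close> because \<open>M\<close> has mass at most 1.\<close>

lemma dist_rearr_unit_ivl:
  assumes f: "f \<in> borel_measurable M" and M: "emeasure M (space M) \<le> 1" and l: "0 < l"
  shows "emeasure unit_ivl {s \<in> space unit_ivl. ennreal l < rearr M f s}
         = emeasure M {x \<in> space M. ennreal l < f x}"
proof -
  let ?m = "emeasure M {x \<in> space M. ennreal l < f x}"
  have m1: "?m \<le> 1"
    by (rule order_trans[OF emeasure_mono[of _ "space M"] M]) (use f in auto)
  then obtain c where c: "?m = ennreal c" "0 \<le> c"
    by (cases ?m rule: ennreal_cases) (auto simp: top_unique)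
  have c1: "c \<le> 1" using m1 c by (metis ennreal_le_1)
  have "ennreal l < rearr M f s \<longleftrightarrow> s < c" if "s > 0" for s
  proof -
    have "ennreal l < rearr M f s \<longleftrightarrow> \<not> ennreal c \<le> ennreal s"
      using rearr_le_iff[OF f l, of s] c by auto
    also have "\<dots> \<longleftrightarrow> s < c" using that by (simp add: ennreal_le_iff not_le)
    finally show ?thesis .
  qed
  then have "{s \<in> space unit_ivl. ennreal l < rearr M f s} = {0<..<c}" using c1 by auto
  moreover have "emeasure unit_ivl {0<..<c} = ennreal c"
    using c c1 by (subst emeasure_unit_ivl) auto
  ultimately show ?thesis using c by simp
qed

lemma rearr_rearr:
  assumes "f \<in> borel_measurable M" "emeasure M (space M) \<le> 1"
  shows "rearr unit_ivl (rearr M f) t = rearr M f t"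
proof (rule antisym)
  show "rearr unit_ivl (rearr M f) t \<le> rearr M f t"
    by (rule rearr_le_of_dist_le, rule eq_refl, rule dist_rearr_unit_ivl[OF assms])
  show "rearr M f t \<le> rearr unit_ivl (rearr M f) t"
    by (rule rearr_le_of_dist_le, rule eq_refl, rule dist_rearr_unit_ivl[OF assms, symmetric])
qed

lemma rearr_mono_AE:
  assumes le: "AE x in M. f x \<le> g x" and g: "g \<in> borel_measurable M"
  shows "rearr M f t \<le> rearr M g t"
proof (rule rearr_le_of_dist_le, rule emeasure_mono_AE)
  show "AE x in M. x \<in> {x \<in> space M. ennreal l < f x} \<longrightarrow> x \<in> {x \<in> space M. ennreal l < g x}" for l
    using le by eventually_elim auto
qed (use g in auto)

section \<open>Rearrangement-invariant function norms\<close>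

context
  fixes N :: "(real \<Rightarrow> ennreal) \<Rightarrow> ennreal"
  assumes N: "ri_function_norm N"
begin

lemmas ri_axioms = N[unfolded ri_function_norm_def]

lemma ri_norm_triangle:
  "f \<in> borel_measurable unit_ivl \<Longrightarrow> g \<in> borel_measurable unit_ivl \<Longrightarrow>
    N (\<lambda>t. f t + g t) \<le> N f + N g"
  using ri_axioms[THEN conjunct1] by simp

lemma ri_norm_scale:
  "f \<in> borel_measurable unit_ivl \<Longrightarrow> 0 \<le> c \<Longrightarrow> N (\<lambda>t. ennreal c * f t) = ennreal c * N f"
  using ri_axioms[THEN conjunct2, THEN conjunct1] by simp

lemma ri_norm_eq_0_iff:
  "f \<in> borel_measurable unit_ivl \<Longrightarrow> N f = 0 \<longleftrightarrow> (AE t in unit_ivl. f t = 0)"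
  using ri_axioms[THEN conjunct2, THEN conjunct2, THEN conjunct1] by simp

lemma ri_norm_mono_AE:
  "f \<in> borel_measurable unit_ivl \<Longrightarrow> g \<in> borel_measurable unit_ivl \<Longrightarrow>
    (AE t in unit_ivl. f t \<le> g t) \<Longrightarrow> N f \<le> N g"
  using ri_axioms[THEN conjunct2, THEN conjunct2, THEN conjunct2, THEN conjunct1] by simp

lemma ri_norm_mono:
  "f \<in> borel_measurable unit_ivl \<Longrightarrow> g \<in> borel_measurable unit_ivl \<Longrightarrow>
    (\<And>t. 0 < t \<Longrightarrow> t < 1 \<Longrightarrow> f t \<le> g t) \<Longrightarrow> N f \<le> N g"
  by (rule ri_norm_mono_AE, assumption, assumption, rule AE_I2) simp

lemma ri_norm_cong:
  "f \<in> borel_measurable unit_ivl \<Longrightarrow> g \<in> borel_measurable unit_ivl \<Longrightarrow>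
    (\<And>t. 0 < t \<Longrightarrow> t < 1 \<Longrightarrow> f t = g t) \<Longrightarrow> N f = N g"
  by (intro antisym ri_norm_mono) auto

lemma ri_norm_monotone_limit:
  assumes "\<And>k. F k \<in> borel_measurable unit_ivl" "f \<in> borel_measurable unit_ivl"
    "\<And>t. 0 < t \<Longrightarrow> t < 1 \<Longrightarrow> incseq (\<lambda>k. F k t)"
    "\<And>t. 0 < t \<Longrightarrow> t < 1 \<Longrightarrow> (\<lambda>k. F k t) \<longlonglongrightarrow> f t"
  shows "(\<lambda>k. N (F k)) \<longlonglongrightarrow> N f"
proof -
  have "AE t in unit_ivl. incseq (\<lambda>k. F k t) \<and> (\<lambda>k. F k t) \<longlonglongrightarrow> f t"
    using assms(3,4) by (intro AE_I2) simp
  then show ?thesis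
    using ri_axioms[THEN conjunct2, THEN conjunct2, THEN conjunct2, THEN conjunct2,
        THEN conjunct1, rule_format, of f F] assms(1,2) by simp
qed

lemma ri_norm_const_finite: "N (\<lambda>t. ennreal c) < \<infinity>"
proof -
  have "N (\<lambda>t. ennreal (max 0 c) * 1) = ennreal (max 0 c) * N (\<lambda>t. 1)"
    by (rule ri_norm_scale) auto
  then have eq: "N (\<lambda>t. ennreal (max 0 c)) = ennreal (max 0 c) * N (\<lambda>t. 1)" by simp
  have "N (\<lambda>t. 1) < \<infinity>"
    using ri_axioms[THEN conjunct2, THEN conjunct2, THEN conjunct2, THEN conjunct2,
        THEN conjunct2, THEN conjunct1] .
  then have "ennreal (max 0 c) * N (\<lambda>t. 1) < \<infinity>" by (simp add: ennreal_mult_less_top)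
  then show ?thesis using eq by (simp add: max_def ennreal_neg split: if_splits)
qed

lemma ri_norm_equimeasurable:
  "f \<in> borel_measurable unit_ivl \<Longrightarrow> g \<in> borel_measurable unit_ivl \<Longrightarrow>
    equimeasurable unit_ivl f g \<Longrightarrow> N f = N g"
  using ri_axioms[THEN conjunct2, THEN conjunct2, THEN conjunct2, THEN conjunct2,
        THEN conjunct2, THEN conjunct2, THEN conjunct2] by blast

lemma ri_norm_rearr: 
  assumes "f \<in> borel_measurable unit_ivl"
  shows "N (rearr unit_ivl f) = N f"
proof (rule ri_norm_equimeasurable)
  show "equimeasurable unit_ivl (rearr unit_ivl f) f"
    unfolding equimeasurable_def using assms
    by (auto intro!: rearr_rearr simp: emeasure_unit_ivl)
qed (use assms in \<open>auto intro: borel_measurable_unit_ivl\<close>)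

text \<open>Only distribution functions are compared, so \<open>f\<close> may live on any measure space.  This is how
  estimates on a domain are reduced to estimates on the unit interval.\<close>

lemma ri_norm_rearr_le_of_dist_le:
  assumes g: "g \<in> borel_measurable unit_ivl"
    and "\<And>l. 0 < l \<Longrightarrow> emeasure M {x \<in> space M. ennreal l < f x}
                \<le> emeasure unit_ivl {x \<in> space unit_ivl. ennreal l < g x}"
  shows "N (rearr M f) \<le> N g"
proof -
  have "N (rearr M f) \<le> N (rearr unit_ivl g)"
    by (intro ri_norm_mono borel_measurable_unit_ivl borel_measurable_rearr rearr_le_of_dist_le
        assms(2))
  then show ?thesis by (simp add: ri_norm_rearr g)
qed

lemma ri_norm_le_of_dist_le:
  assumes "f \<in> borel_measurable unit_ivl" "g \<in> borel_measurable unit_ivl"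
    and "\<And>l. 0 < l \<Longrightarrow> emeasure unit_ivl {x \<in> space unit_ivl. ennreal l < f x}
                \<le> emeasure unit_ivl {x \<in> space unit_ivl. ennreal l < g x}"
  shows "N f \<le> N g"
  using ri_norm_rearr_le_of_dist_le[OF assms(2,3)] ri_norm_rearr[OF assms(1)] by simp

text \<open>The infima of the tails of the sequence increase to its limit.\<close>

lemma ri_norm_Fatou:
  assumes F: "\<And>k. F k \<in> borel_measurable unit_ivl" and f: "f \<in> borel_measurable unit_ivl"
    and lim: "\<And>t. 0 < t \<Longrightarrow> t < 1 \<Longrightarrow> (\<lambda>k. F k t) \<longlonglongrightarrow> f t"
    and le: "\<And>k. N (F k) \<le> C"
  shows "N f \<le> C"
proof -
  define G where "G k t = (INF i\<in>{k..}. F i t)" for k t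
  have G: "G k \<in> borel_measurable unit_ivl" for k
    unfolding G_def using F by (intro borel_measurable_INF) auto
  have "(\<lambda>k. N (G k)) \<longlonglongrightarrow> N f"
  proof (rule ri_norm_monotone_limit[OF G f])
    fix t :: real assume t: "0 < t" "t < 1"
    show inc: "incseq (\<lambda>k. G k t)"
      unfolding G_def by (auto intro!: monoI INF_superset_mono)
    have "liminf (\<lambda>k. F k t) = f t"
      using lim[OF t] by (simp add: lim_imp_Liminf)
    then show "(\<lambda>k. G k t) \<longlonglongrightarrow> f t"
      using LIMSEQ_SUP[OF inc] unfolding G_def liminf_SUP_INF by simp
  qed
  moreover have "N (G k) \<le> C" for k
  proof -
    have "N (G k) \<le> N (F k)"
      by (intro ri_norm_mono G F) (auto simp: G_def intro: INF_lower)
    then show ?thesis using le order_trans by blast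
  qed
  ultimately show ?thesis using LIMSEQ_le_const2 by blast
qed

lemma ri_norm_sum:
  assumes "finite I" "\<And>i. i \<in> I \<Longrightarrow> F i \<in> borel_measurable unit_ivl"
  shows "N (\<lambda>t. \<Sum>i\<in>I. F i t) \<le> (\<Sum>i\<in>I. N (F i))"
  using assms
proof (induction I rule: finite_induct)
  case empty
  have "N (\<lambda>t. 0) = 0" by (subst ri_norm_eq_0_iff) auto
  then show ?case by simp
next
  case (insert i I)
  have "N (\<lambda>t. F i t + (\<Sum>i\<in>I. F i t)) \<le> N (F i) + N (\<lambda>t. \<Sum>i\<in>I. F i t)"
    using insert by (intro ri_norm_triangle borel_measurable_sum) auto
  then show ?case using insert by (auto intro: order_trans add_left_mono)
qed

text \<open>Compression towards the origin multiplies the measure of every level set by \<open>r \<le> 1\<close>.\<close>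

lemma ri_norm_dilation_le:
  fixes f :: "real \<Rightarrow> real"
  assumes f [measurable]: "f \<in> borel_measurable borel" and r: "0 < r" "r \<le> 1"
    and f0: "\<And>t. 1 \<le> t \<Longrightarrow> f t = 0"
  shows "N (\<lambda>s. ennreal \<bar>f (s / r)\<bar>) \<le> N (\<lambda>s. ennreal \<bar>f s\<bar>)"
proof (rule ri_norm_le_of_dist_le)
  fix l :: real assume l: "0 < l"
  let ?A = "{x \<in> {0<..<1}. ennreal l < ennreal \<bar>f x\<bar>}"
  have A: "?A \<in> sets borel" by measurable
  have "{x \<in> {0<..<1}. ennreal l < ennreal \<bar>f (x / r)\<bar>} = (\<lambda>x. r * x) ` ?A"
  proof (intro equalityI subsetI)
    fix x assume x: "x \<in> {x \<in> {0<..<1}. ennreal l < ennreal \<bar>f (x / r)\<bar>}"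
    have "x / r < 1" using f0[of "x / r"] x by (force simp: not_le)
    then have "x / r \<in> ?A" using x r by auto
    moreover have "x = r * (x / r)" using r by simp
    ultimately show "x \<in> (\<lambda>x. r * x) ` ?A" by blast
  next
    fix x assume "x \<in> (\<lambda>x. r * x) ` ?A"
    then obtain z where z: "z \<in> ?A" "x = r * z" by blast
    have "r * z < 1" using mult_le_one[of r z] r z by (smt (verit) greaterThanLessThan_iff mem_Collect_eq mult_left_le_one_le)
    then show "x \<in> {x \<in> {0<..<1}. ennreal l < ennreal \<bar>f (x / r)\<bar>}" using z r by auto
  qed
  moreover have "emeasure lborel ((\<lambda>x. r * x) ` ?A) = ennreal r * emeasure lborel ?A"
  proof -
    have "(\<lambda>x. r * x) ` ?A \<in> sets borel"
      unfolding calculation[symmetric] by measurable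
    then show ?thesis
      using emeasure_lebesgue_affine[of r 0 ?A] A r by simp
  qed
  moreover have "ennreal r * emeasure lborel ?A \<le> 1 * emeasure lborel ?A"
    using r by (intro mult_right_mono) auto
  ultimately have "emeasure lborel {x \<in> {0<..<1}. ennreal l < ennreal \<bar>f (x / r)\<bar>}
      \<le> emeasure lborel ?A" by simp
  then show "emeasure unit_ivl {x \<in> space unit_ivl. ennreal l < ennreal \<bar>f (x / r)\<bar>}
    \<le> emeasure unit_ivl {x \<in> space unit_ivl. ennreal l < ennreal \<bar>f x\<bar>}"
    by (simp, subst (1 2) emeasure_unit_ivl) auto
qed (auto intro!: borel_measurable_unit_ivl)

end

section \<open>Smooth functions and uniqueness of weak derivatives\<close>

lemma Ck_on_SucI:
  assumes "\<And>x. (f has_derivative f' x) (at x)" "\<And>v. Ck_on k UNIV (\<lambda>x. f' x v)"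
  shows "Ck_on (Suc k) UNIV f"
proof -
  have "frechet_derivative f (at x) = f' x" for x
    using frechet_derivative_at[OF assms(1)] by simp
  then show ?thesis using assms by (auto simp: differentiable_def)
qed

lemma Ck_on_Suc_has_derivative:
  "Ck_on (Suc k) UNIV f \<Longrightarrow> (f has_derivative frechet_derivative f (at x)) (at x)"
  by (simp add: frechet_derivative_works[symmetric])

lemma Ck_on_Suc_imp_Ck_on: "Ck_on (Suc k) UNIV f \<Longrightarrow> Ck_on k UNIV f"
proof (induction k arbitrary: f)
  case 0
  then show ?case
    by (auto intro!: differentiable_imp_continuous_on simp: differentiable_on_def
        intro: differentiable_at_withinI)
next
  case (Suc k)
  from Suc.prems have "\<forall>v. Ck_on (Suc k) UNIV (\<lambda>x. frechet_derivative f (at x) v)"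
    by simp
  then have "\<forall>v. Ck_on k UNIV (\<lambda>x. frechet_derivative f (at x) v)" using Suc.IH by blast
  then show ?case using Suc.prems by simp
qed

lemma Ck_on_const: "Ck_on k UNIV (\<lambda>x. c)"
proof (induction k arbitrary: c)
  case (Suc k)
  show ?case by (rule Ck_on_SucI[where f'="\<lambda>_ _. 0"]) (auto intro: Suc)
qed simp

lemma Ck_on_add:
  "Ck_on k UNIV f \<Longrightarrow> Ck_on k UNIV g \<Longrightarrow> Ck_on k UNIV (\<lambda>x. f x + g x)"
proof (induction k arbitrary: f g)
  case 0
  then show ?case by (simp add: continuous_on_add)
next
  case (Suc k)
  show ?case
    by (rule Ck_on_SucI, rule has_derivative_add[OF Ck_on_Suc_has_derivative[OF Suc.prems(1)]
          Ck_on_Suc_has_derivative[OF Suc.prems(2)]])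
      (use Suc in simp)
qed

lemma Ck_on_mult:
  "Ck_on k UNIV f \<Longrightarrow> Ck_on k UNIV g \<Longrightarrow> Ck_on k UNIV (\<lambda>x. f x * g x)"
proof (induction k arbitrary: f g)
  case 0
  then show ?case by (simp add: continuous_on_mult)
next
  case (Suc k)
  note low = Suc.prems[THEN Ck_on_Suc_imp_Ck_on]
  show ?case
    by (rule Ck_on_SucI, rule has_derivative_mult[OF Ck_on_Suc_has_derivative[OF Suc.prems(1)]
          Ck_on_Suc_has_derivative[OF Suc.prems(2)]])
      (use Suc.prems low in \<open>auto intro!: Ck_on_add Suc.IH\<close>)
qed

lemma Ck_on_prod:
  "finite I \<Longrightarrow> (\<And>i. i \<in> I \<Longrightarrow> Ck_on k UNIV (f i)) \<Longrightarrow> Ck_on k UNIV (\<lambda>x. \<Prod>i\<in>I. f i x)"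
  by (induction I rule: finite_induct) (auto intro: Ck_on_const Ck_on_mult)

lemma Ck_on_subset: "Ck_on k S f \<Longrightarrow> T \<subseteq> S \<Longrightarrow> Ck_on k T f"
  by (induction k arbitrary: f) (auto intro: continuous_on_subset)

text \<open>These are the functions \<open>t\<^sup>-\<^sup>k exp (-1/t)\<close>, extended by zero to \<open>t \<le> 0\<close>.  The parameter \<open>k\<close>
  is there because the derivative of such a function is a combination of two others, which
  makes all of them smooth at once.\<close>

definition flat_exp :: "nat \<Rightarrow> real \<Rightarrow> real" where
  "flat_exp k t = (if 0 < t then (1 / t) ^ k * exp (- (1 / t)) else 0)"

lemma flat_exp_bounds: "0 \<le> flat_exp 0 t" "flat_exp 0 t \<le> 1"
  by (auto simp: flat_exp_def)

lemma flat_exp_has_derivative: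
  "(flat_exp k has_field_derivative (flat_exp (k + 2) t - real k * flat_exp (k + 1) t)) (at t)"
proof -
  consider "t < 0" | "t > 0" | "t = 0" by linarith
  then show ?thesis
  proof cases
    case 1
    have "((\<lambda>t. 0) has_field_derivative 0) (at t)" by simp
    then have "(flat_exp k has_field_derivative 0) (at t)"
      by (rule has_field_derivative_transform_within_open[of _ _ _ "{..<0}"])
        (use 1 in \<open>auto simp: flat_exp_def\<close>)
    then show ?thesis using 1 by (simp add: flat_exp_def)
  next
    case 2
    have "((\<lambda>t. (1 / t) ^ k * exp (- (1 / t))) has_field_derivative
        ((1 / t) ^ (k + 2) * exp (- (1 / t)) - real k * ((1 / t) ^ (k + 1) * exp (- (1 / t))))) (at t)"
    proof -
      have "((\<lambda>t. (1 / t) ^ k) has_field_derivative (real k * (1 / t) ^ (k - 1) * (- (1 / t\<^sup>2)))) (at t)"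
        using 2 by (auto intro!: derivative_eq_intros simp: power2_eq_square)
      moreover have "real k * (1 / t) ^ (k - 1) * (- (1 / t\<^sup>2)) = - (real k * (1 / t) ^ (k + 1))"
        by (cases k) (auto simp: field_simps power2_eq_square)
      ultimately have pow: "((\<lambda>t. (1 / t) ^ k) has_field_derivative
          (- (real k * (1 / t) ^ (k + 1)))) (at t)" by simp
      have "((\<lambda>t. exp (- (1 / t))) has_field_derivative (exp (- (1 / t)) * (1 / t)\<^sup>2)) (at t)"
        using 2 by (auto intro!: derivative_eq_intros simp: power2_eq_square)
      from DERIV_mult[OF pow this] show ?thesis
        by (rule DERIV_cong) (simp add: power_add power2_eq_square algebra_simps)
    qed
    then have "(flat_exp k has_field_derivative
        ((1 / t) ^ (k + 2) * exp (- (1 / t)) - real k * ((1 / t) ^ (k + 1) * exp (- (1 / t))))) (at t)"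
      by (rule has_field_derivative_transform_within_open[of _ _ _ "{0<..}"])
        (use 2 in \<open>auto simp: flat_exp_def\<close>)
    then show ?thesis using 2 by (simp add: flat_exp_def)
  next
    case 3
    \<comment> \<open>the difference quotient at 0, which vanishes because \<open>exp\<close> outgrows every power\<close>
    have "((\<lambda>h::real. (1 / h) ^ (k + 1) / exp (1 / h)) \<longlongrightarrow> 0) (at_right 0)"
      by (rule filterlim_compose[OF tendsto_power_div_exp_0])
        (use filterlim_inverse_at_top_right in \<open>simp add: inverse_eq_divide\<close>)
    then have "((\<lambda>h. (flat_exp k h - flat_exp k 0) / (h - 0)) \<longlongrightarrow> 0) (at_right 0)"
      by (rule Lim_transform_eventually)
        (auto simp: flat_exp_def eventually_at_filter exp_minus field_simps)
    moreover have "((\<lambda>h. (flat_exp k h - flat_exp k 0) / (h - 0)) \<longlongrightarrow> 0) (at_left 0)"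
      by (rule Lim_transform_eventually[OF tendsto_const])
        (auto simp: flat_exp_def eventually_at_filter)
    ultimately have "((\<lambda>h. (flat_exp k h - flat_exp k 0) / (h - 0)) \<longlongrightarrow> 0) (at 0)"
      by (rule filterlim_split_at[rotated])
    then show ?thesis using 3 by (simp add: has_field_derivative_iff flat_exp_def)
  qed
qed

lemma Ck_on_flat_exp_coordinate:
  fixes i :: "'n::finite"
  shows "Ck_on k UNIV (\<lambda>x::real^'n. flat_exp j (a * x $ i + b))"
proof (induction k arbitrary: j)
  case 0
  have "continuous_on UNIV (flat_exp j)"
    by (rule DERIV_continuous_on) (rule has_field_derivative_at_within, rule flat_exp_has_derivative)
  then show ?case
    by (auto intro!: continuous_on_compose2[of UNIV "flat_exp j"] continuous_intros)
next
  case (Suc k)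
  let ?d = "\<lambda>t. flat_exp (j + 2) t - real j * flat_exp (j + 1) t"
  show ?case
  proof (rule Ck_on_SucI)
    fix x :: "real^'n"
    have "((\<lambda>x::real^'n. a * x $ i + b) has_derivative (\<lambda>v. a * v $ i)) (at x)"
      by (auto intro!: derivative_eq_intros bounded_linear_imp_has_derivative)
    then show "((\<lambda>x. flat_exp j (a * x $ i + b)) has_derivative
        (\<lambda>v. a * v $ i * ?d (a * x $ i + b))) (at x)"
      using has_derivative_compose[OF _ flat_exp_has_derivative[unfolded has_field_derivative_def]]
      by (auto simp: mult.commute)
  next
    fix v :: "real^'n"
    have "Ck_on k UNIV (\<lambda>x::real^'n. a * v $ i * (flat_exp (j + 2) (a * x $ i + b)
        + (- real j) * flat_exp (j + 1) (a * x $ i + b)))"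
      by (intro Ck_on_mult Ck_on_const Ck_on_add Suc)
    then show "Ck_on k UNIV (\<lambda>x. a * v $ i * ?d (a * x $ i + b))" by simp
  qed
qed

text \<open>For \<open>N \<ge> 1\<close> the bump is positive exactly on the open box, and as \<open>N\<close> grows the bumps increase
  to the indicator of the box.\<close>

definition box_bump :: "real^'n \<Rightarrow> real^'n \<Rightarrow> nat \<Rightarrow> real^'n \<Rightarrow> real" where
  "box_bump c d N x =
     (\<Prod>i\<in>UNIV. flat_exp 0 (real N * (x $ i - c $ i)) * flat_exp 0 (real N * (d $ i - x $ i)))"

lemma box_bump_bounds: "0 \<le> box_bump c d N x" "box_bump c d N x \<le> 1"
  unfolding box_bump_def
  by (auto intro!: prod_nonneg prod_le_1 mult_nonneg_nonneg mult_le_one flat_exp_bounds)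

lemma box_bump_outside: "x \<notin> box c d \<Longrightarrow> box_bump c d N x = 0"
proof -
  assume "x \<notin> box c d"
  then obtain i where "x $ i - c $ i \<le> 0 \<or> d $ i - x $ i \<le> 0"
    by (auto simp: mem_box_cart not_less)
  then have "real N * (x $ i - c $ i) \<le> 0 \<or> real N * (d $ i - x $ i) \<le> 0"
    by (meson mult_nonneg_nonpos of_nat_0_le_iff)
  then have "flat_exp 0 (real N * (x $ i - c $ i)) * flat_exp 0 (real N * (d $ i - x $ i)) = 0"
    by (auto simp: flat_exp_def)
  then show ?thesis unfolding box_bump_def by (intro prod_zero) auto
qed

lemma Ck_on_box_bump: "Ck_on k UNIV (box_bump c d N)"
proof -
  have eq: "real N * (x $ i - c $ i) = real N * x $ i + (- real N * c $ i)"
    "real N * (d $ i - x $ i) = (- real N) * x $ i + real N * d $ i" for x i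
    by (auto simp: algebra_simps)
  show ?thesis
    unfolding box_bump_def[abs_def] eq
    by (intro Ck_on_prod Ck_on_mult Ck_on_flat_exp_coordinate) simp
qed

lemma box_bump_test_function:
  assumes "cbox c d \<subseteq> U"
  shows "box_bump c d N \<in> test_functions U"
proof -
  have "{x. box_bump c d N x \<noteq> 0} \<subseteq> cbox c d"
    using box_bump_outside box_subset_cbox by blast
  then have cl: "closure {x. box_bump c d N x \<noteq> 0} \<subseteq> cbox c d"
    by (simp add: closure_minimal closed_cbox)
  then have "compact (closure {x. box_bump c d N x \<noteq> 0})"
    using compact_Int_closed[OF compact_cbox closed_closure] by (metis inf.absorb_iff2)
  then show ?thesis using Ck_on_box_bump cl assms by (auto simp: test_functions_def)
qed

lemma box_bump_tendsto: "(\<lambda>N. box_bump c d N x) \<longlonglongrightarrow> indicat_real (box c d) x"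
proof (cases "x \<in> box c d")
  case True
  have lim: "(\<lambda>N. flat_exp 0 (real N * t)) \<longlonglongrightarrow> 1" if "0 < t" for t
  proof -
    have "(\<lambda>N. inverse (real N)) \<longlonglongrightarrow> 0" by (rule lim_inverse_n)
    then have "(\<lambda>N. exp (- (inverse (real N) * inverse t))) \<longlonglongrightarrow> exp (- (0 * inverse t))"
      by (intro tendsto_intros)
    then have "(\<lambda>N. exp (- (inverse (real N) * inverse t))) \<longlonglongrightarrow> 1" by simp
    moreover have "eventually (\<lambda>N. exp (- (inverse (real N) * inverse t))
        = flat_exp 0 (real N * t)) sequentially"
      using eventually_gt_at_top[of 0]
      by eventually_elim (use that in \<open>auto simp: flat_exp_def field_simps\<close>)
    ultimately show ?thesis by (rule Lim_transform_eventually)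
  qed
  have "(\<lambda>N. box_bump c d N x) \<longlonglongrightarrow> (\<Prod>i\<in>(UNIV::'a set). 1 * 1)"
    unfolding box_bump_def
    by (intro tendsto_prod tendsto_mult lim) (use True in \<open>auto simp: mem_box_cart\<close>)
  then show ?thesis using True by simp
qed (simp add: box_bump_outside)

text \<open>The bumps are admissible test functions, bounded by 1, and tend to the indicator of the box.\<close>

lemma integral_box_eq_0_if_weakly_0:
  fixes w :: "real^'n \<Rightarrow> real"
  assumes U: "open U" and w: "locally_integrable U w"
    and zero: "\<And>\<phi>. \<phi> \<in> test_functions U \<Longrightarrow> (LINT x|lebesgue_on U. w x * \<phi> x) = 0"
    and box: "cbox c d \<subseteq> U"
  shows "(LINT x|lebesgue. indicat_real (box c d) x * w x) = 0"
proof -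
  have wi: "integrable lebesgue (\<lambda>x. indicat_real (cbox c d) x * w x)"
    using w box unfolding locally_integrable_def set_integrable_def by auto
  have zero': "(LINT x|lebesgue. box_bump c d N x * (indicat_real (cbox c d) x * w x)) = 0" for N
  proof -
    have "(\<lambda>x. box_bump c d N x * (indicat_real (cbox c d) x * w x))
        = (\<lambda>x. if x \<in> U then w x * box_bump c d N x else 0)"
      using box box_bump_outside[of _ c d N] box_subset_cbox[of c d]
      by (fastforce simp: indicator_def fun_eq_iff)
    then show ?thesis
      using zero[OF box_bump_test_function[OF box]] U
      by (simp add: Lebesgue_Measure.integral_restrict_UNIV)
  qed
  have "(\<lambda>N. LINT x|lebesgue. box_bump c d N x * (indicat_real (cbox c d) x * w x))
     \<longlonglongrightarrow> (LINT x|lebesgue. indicat_real (box c d) x * (indicat_real (cbox c d) x * w x))"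
  proof (rule integral_dominated_convergence)
    show "integrable lebesgue (\<lambda>x. \<bar>indicat_real (cbox c d) x * w x\<bar>)" using wi by simp
    have meas: "box_bump c d N \<in> borel_measurable lebesgue" for N
      using Ck_on_box_bump[of 0 c d N]
      by (intro measurable_completion) (simp add: borel_measurable_continuous_onI)
    show "(\<lambda>x. box_bump c d N x * (indicat_real (cbox c d) x * w x)) \<in> borel_measurable lebesgue"
      for N by (rule borel_measurable_times[OF meas borel_measurable_integrable[OF wi]])
    show "(\<lambda>x. indicat_real (box c d) x * (indicat_real (cbox c d) x * w x))
        \<in> borel_measurable lebesgue"
      by (rule borel_measurable_times[OF _ borel_measurable_integrable[OF wi]])
        (simp add: borel_measurable_indicator)
    show "AE x in lebesgue. norm (box_bump c d N x * (indicat_real (cbox c d) x * w x))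
        \<le> \<bar>indicat_real (cbox c d) x * w x\<bar>" for N
      using box_bump_bounds[of c d N] by (auto simp: abs_mult intro!: mult_left_le_one_le)
  qed (auto intro!: tendsto_mult_right box_bump_tendsto)
  then have "(LINT x|lebesgue. indicat_real (box c d) x * (indicat_real (cbox c d) x * w x)) = 0"
    unfolding zero' by (simp add: LIMSEQ_const_iff)
  moreover have "(\<lambda>x. indicat_real (box c d) x * (indicat_real (cbox c d) x * w x))
      = (\<lambda>x. indicat_real (box c d) x * w x)"
    using box_subset_cbox[of c d] by (auto simp: indicator_def fun_eq_iff)
  ultimately show ?thesis by simp
qed

text \<open>Boxes are closed under intersection and generate the Borel sets, so the integral of \<open>v\<close> over
  every Borel set vanishes.\<close>

lemma AE_eq_0_if_box_integrals_0:
  fixes v :: "'a::euclidean_space \<Rightarrow> real"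
  assumes v: "integrable lborel v"
    and zero: "\<And>c d. (LINT x|lborel. indicat_real (box c d) x * v x) = 0"
  shows "AE x in lborel. v x = 0"
proof -
  have int: "integrable lborel (\<lambda>x. indicat_real A x * v x)" if "A \<in> sets borel" for A
    using integrable_mult_indicator[OF _ v, of A] that by simp
  have total: "(LINT x|lborel. v x) = 0"
  proof -
    let ?B = "\<lambda>i::nat. box (- (real i *\<^sub>R One)) (real i *\<^sub>R (One::'a))"
    have "(\<lambda>i. LINT x|lborel. indicat_real (?B i) x * v x) \<longlonglongrightarrow> (LINT x|lborel. v x)"
    proof (rule integral_dominated_convergence[where w="\<lambda>x. \<bar>v x\<bar>"])
      show "AE x in lborel. (\<lambda>i. indicat_real (?B i) x * v x) \<longlonglongrightarrow> v x"
      proof (rule AE_I2)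
        fix x :: 'a
        have "x \<in> (\<Union>k. ?B k)" unfolding UN_box_eq_UNIV by simp
        then obtain k :: nat where k: "x \<in> ?B k" by blast
        have "eventually (\<lambda>i. indicat_real (?B i) x * v x = v x) sequentially"
          using eventually_ge_at_top[of k]
        proof eventually_elim
          case (elim i)
          then have "real k \<le> real i" by simp
          then have "x \<in> ?B i" using k unfolding box_def by (auto dest!: bspec)
          then show ?case by simp
        qed
        then show "(\<lambda>i. indicat_real (?B i) x * v x) \<longlonglongrightarrow> v x"
          by (rule tendsto_eventually)
      qed
    qed (use v in \<open>auto simp: abs_mult indicator_def\<close>)
    then show ?thesis unfolding zero by (simp add: LIMSEQ_const_iff)
  qed
  have all: "(LINT x|lborel. indicat_real A x * v x) = 0" if "A \<in> sets borel" for A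
  proof -
    let ?G = "range (\<lambda>(a, b). box a b :: 'a set)"
    have Pow: "?G \<subseteq> Pow UNIV" by simp
    have st: "Int_stable ?G"
      by (auto simp: Int_stable_def box_Int_box)
    have "A \<in> sigma_sets UNIV ?G"
      using that by (simp add: borel_eq_box)
    from st Pow this show ?thesis
    proof (induction A rule: sigma_sets_induct_disjoint)
      case (basic A)
      then show ?case using zero by auto
    next
      case empty
      then show ?case by simp
    next
      case (compl A)
      then have A: "A \<in> sets borel" by (simp add: borel_eq_box)
      have "(\<lambda>x. indicat_real (UNIV - A) x * v x) = (\<lambda>x. v x - indicat_real A x * v x)"
        by (auto simp: indicator_def)
      then show ?case using int[OF A] v total compl by simp
    next
      case (union A)
      have A: "A i \<in> sets borel" for i using union(2) by (auto simp: borel_eq_box)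
      have "(LINT x:(\<Union>i. A i)|lborel. v x) = (\<Sum>i. LINT x:(A i)|lborel. v x)"
        by (rule lebesgue_integral_countable_add)
          (use A union(1) int[of "\<Union>i. A i"] in
            \<open>auto simp: disjoint_family_on_def set_integrable_def\<close>)
      then show ?case using union by (simp add: set_lebesgue_integral_def)
    qed
  qed
  show ?thesis
  proof (rule density_unique_real[OF v])
    show "(LINT x:A|lborel. v x) = (LINT x:A|lborel. 0)" if "A \<in> sets lborel" for A
      using all that by (simp add: set_lebesgue_integral_def)
  qed simp
qed

text \<open>This is the fundamental lemma of the calculus of variations.  Countably many closed boxes
  contained in \<open>U\<close> cover \<open>U\<close>; on each of them all integrals of \<open>w\<close> over smaller boxes vanish.\<close>

lemma AE_eq_0_if_weakly_0:
  fixes w :: "real^'n \<Rightarrow> real"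
  assumes U: "open U" and w: "locally_integrable U w"
    and zero: "\<And>\<phi>. \<phi> \<in> test_functions U \<Longrightarrow> (LINT x|lebesgue_on U. w x * \<phi> x) = 0"
  shows "AE x in lebesgue. x \<in> U \<longrightarrow> w x = 0"
proof -
  have local: "AE x in lebesgue. x \<in> cbox a b \<longrightarrow> w x = 0" if ab: "cbox a b \<subseteq> U" for a b
  proof -
    let ?w = "\<lambda>x. indicat_real (box a b) x * w x"
    have "integrable lebesgue (\<lambda>x. indicat_real (cbox a b) x * w x)"
      using w ab unfolding locally_integrable_def set_integrable_def by auto
    then have "integrable lebesgue (\<lambda>x. indicat_real (box a b) x *\<^sub>R (indicat_real (cbox a b) x * w x))"
      by (intro integrable_mult_indicator) auto
    moreover have "(\<lambda>x. indicat_real (box a b) x *\<^sub>R (indicat_real (cbox a b) x * w x)) = ?w"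
      using box_subset_cbox[of a b] by (auto simp: indicator_def fun_eq_iff)
    ultimately have wi: "integrable lebesgue ?w" by simp
    then obtain v where v: "v \<in> borel_measurable lborel" "AE x in lborel. ?w x = v x"
      using completion_ex_borel_measurable_real[of ?w lborel] by auto
    have v': "AE x in lebesgue. ?w x = v x" using v(2) by (rule AE_completion)
    have vl: "v \<in> borel_measurable lebesgue" using v(1) by (rule measurable_completion)
    have "integrable lebesgue v"
      using integrable_cong_AE_imp[OF wi vl] v' by (auto simp: eq_commute)
    then have vi: "integrable lborel v" using v(1) by (simp add: integrable_completion)
    have "AE x in lborel. v x = 0"
    proof (rule AE_eq_0_if_box_integrals_0[OF vi])
      fix c d :: "real^'n"
      obtain e f where ef: "box c d \<inter> box a b = box e f" unfolding box_Int_box by blast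
      have sub: "cbox e f \<subseteq> U \<or> box e f = {}"
      proof (cases "box e f = {}")
        case False
        have "box e f \<subseteq> cbox a b" using ef box_subset_cbox[of a b] by blast
        then have "closure (box e f) \<subseteq> cbox a b" by (simp add: closure_minimal closed_cbox)
        then show ?thesis using ab False by (simp add: closure_box)
      qed simp
      have "(LINT x|lborel. indicat_real (box c d) x * v x)
          = (LINT x|lebesgue. indicat_real (box c d) x * v x)"
        using v(1) by (intro integral_completion[symmetric]) auto
      also have "\<dots> = (LINT x|lebesgue. indicat_real (box c d) x * ?w x)"
      proof (rule integral_cong_AE)
        have ind: "indicat_real (box c d) \<in> borel_measurable lebesgue"
          by (simp add: borel_measurable_indicator)
        show "(\<lambda>x. indicat_real (box c d) x * v x) \<in> borel_measurable lebesgue"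
          by (rule borel_measurable_times[OF ind vl])
        show "(\<lambda>x. indicat_real (box c d) x * ?w x) \<in> borel_measurable lebesgue"
          by (rule borel_measurable_times[OF ind borel_measurable_integrable[OF wi]])
        show "AE x in lebesgue. indicat_real (box c d) x * v x = indicat_real (box c d) x * ?w x"
          using v' by eventually_elim simp
      qed
      also have "(\<lambda>x. indicat_real (box c d) x * ?w x) = (\<lambda>x. indicat_real (box e f) x * w x)"
        unfolding ef[symmetric] by (auto simp: indicator_def)
      also have "(LINT x|lebesgue. indicat_real (box e f) x * w x) = 0"
        using sub integral_box_eq_0_if_weakly_0[OF U w zero, of e f] by auto
      finally show "(LINT x|lborel. indicat_real (box c d) x * v x) = 0" .
    qed
    then have "AE x in lebesgue. v x = 0" by (rule AE_completion)
    moreover have "AE x in lebesgue. x \<notin> cbox a b - box a b"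
      using negligible_frontier_interval[of a b] unfolding negligible_iff_null_sets
      by (rule AE_not_in)
    ultimately show ?thesis using v'
      by eventually_elim (auto simp: indicator_def split: if_splits)
  qed
  obtain D where D: "countable D" "\<And>X. X \<in> D \<Longrightarrow> X \<subseteq> U \<and> (\<exists>a b. X = cbox a b)" "\<Union>D = U"
  proof (rule open_countable_Union_open_cbox[OF U])
    fix D assume "countable D" "D \<subseteq> Pow U" "\<And>X. X \<in> D \<Longrightarrow> \<exists>a b. X = cbox a b" "\<Union>D = U"
    then show ?thesis by (intro that[of D]) auto
  qed
  have "AE x in lebesgue. \<forall>X\<in>D. x \<in> X \<longrightarrow> w x = 0"
  proof (subst AE_ball_countable[OF D(1)], intro ballI)
    fix X assume "X \<in> D"
    then obtain a b where "X = cbox a b" "X \<subseteq> U" using D(2) by blast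
    then show "AE x in lebesgue. x \<in> X \<longrightarrow> w x = 0" using local by simp
  qed
  then show ?thesis by eventually_elim (use D(3) in blast)
qed

lemma weak_deriv_unique:
  fixes v w :: "real^'n \<Rightarrow> real"
  assumes U: "open U" and v: "has_weak_deriv U \<alpha> u v" and w: "has_weak_deriv U \<alpha> u w"
    and ex: "\<exists>is. \<forall>i. count_list is i = \<alpha> i"
  shows "AE x in lebesgue. x \<in> U \<longrightarrow> v x = w x"
proof -
  have lv: "locally_integrable U v" and lw: "locally_integrable U w"
    using v w by (auto simp: has_weak_deriv_def)
  have "AE x in lebesgue. x \<in> U \<longrightarrow> v x - w x = 0"
  proof (rule AE_eq_0_if_weakly_0[OF U])
    show "locally_integrable U (\<lambda>x. v x - w x)"
      using lv lw by (auto simp: locally_integrable_def intro: set_integral_diff)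
    fix \<phi> assume \<phi>: "\<phi> \<in> test_functions U"
    have eq: "(LINT x|lebesgue_on U. v x * \<phi> x) = (LINT x|lebesgue_on U. w x * \<phi> x)"
    proof -
      obtain js where "\<forall>i. count_list js i = \<alpha> i" using ex by blast
      then have "(-1) ^ (\<Sum>i\<in>UNIV. \<alpha> i) * (LINT x|lebesgue_on U. v x * \<phi> x)
          = (-1) ^ (\<Sum>i\<in>UNIV. \<alpha> i) * (LINT x|lebesgue_on U. w x * \<phi> x)"
        using v w \<phi> unfolding has_weak_deriv_def by fastforce
      then show ?thesis by simp
    qed
    have cont: "continuous_on UNIV \<phi>" and K: "compact (closure {x. \<phi> x \<noteq> 0})"
      "closure {x. \<phi> x \<noteq> 0} \<subseteq> U"
      using \<phi> unfolding test_functions_def by (auto dest: spec[of _ 0])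
    have int: "integrable (lebesgue_on U) (\<lambda>x. g x * \<phi> x)" if g: "locally_integrable U g" for g
    proof -
      let ?K = "closure {x. \<phi> x \<noteq> 0}"
      have "g absolutely_integrable_on ?K" using g K by (auto simp: locally_integrable_def)
      then have gi: "integrable lebesgue (\<lambda>x. indicat_real ?K x * g x)"
        by (simp add: set_integrable_def)
      obtain B where B: "\<And>x. x \<in> ?K \<Longrightarrow> \<bar>\<phi> x\<bar> \<le> B"
        using compact_imp_bounded[OF compact_continuous_image[OF continuous_on_subset[OF cont] K(1)]]
        unfolding bounded_iff by auto
      have \<phi>_meas: "\<phi> \<in> borel_measurable lebesgue"
        using cont by (intro measurable_completion) (simp add: borel_measurable_continuous_onI)
      have "integrable lebesgue (\<lambda>x. \<phi> x * (indicat_real ?K x * g x))"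
      proof (rule Bochner_Integration.integrable_bound)
        show "integrable lebesgue (\<lambda>x. B * (indicat_real ?K x * g x))" using gi by simp
        show "(\<lambda>x. \<phi> x * (indicat_real ?K x * g x)) \<in> borel_measurable lebesgue"
          by (rule borel_measurable_times[OF \<phi>_meas borel_measurable_integrable[OF gi]])
        show "AE x in lebesgue. norm (\<phi> x * (indicat_real ?K x * g x))
            \<le> norm (B * (indicat_real ?K x * g x))"
        proof (rule AE_I2)
          fix x
          show "norm (\<phi> x * (indicat_real ?K x * g x)) \<le> norm (B * (indicat_real ?K x * g x))"
            using B[of x] by (cases "x \<in> ?K") (auto simp: abs_mult intro!: mult_right_mono)
        qed
      qed
      also have "(\<lambda>x. \<phi> x * (indicat_real ?K x * g x)) = (\<lambda>x. indicat_real U x *\<^sub>R (g x * \<phi> x))"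
        using K(2) closure_subset[of "{x. \<phi> x \<noteq> 0}"] by (auto simp: indicator_def fun_eq_iff)
      finally show ?thesis
        using U by (subst integrable_restrict_space) (auto simp: borel_open)
    qed
    show "(LINT x|lebesgue_on U. (v x - w x) * \<phi> x) = 0"
      using eq int[OF lv] int[OF lw] by (simp add: left_diff_distrib)
  qed
  then show ?thesis by eventually_elim auto
qed

section \<open>Local Lipschitz continuity and integration by parts\<close>

text \<open>A Lipschitz constant on every ball makes the class stable under products and compositions,
  and it dominates difference quotients of functions with bounded support.\<close>

definition loc_lipschitz :: "('a::real_normed_vector \<Rightarrow> real) \<Rightarrow> bool" where
  "loc_lipschitz f \<longleftrightarrow> (\<forall>r. \<exists>L. L-lipschitz_on (cball 0 r) f)"

lemma loc_lipschitz_continuous_on: "loc_lipschitz f \<Longrightarrow> continuous_on UNIV f"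
proof -
  assume f: "loc_lipschitz f"
  have "continuous (at x) f" for x
  proof -
    obtain L where "L-lipschitz_on (cball 0 (norm x + 1)) f"
      using f unfolding loc_lipschitz_def by blast
    then have "continuous_on (ball 0 (norm x + 1)) f"
      by (meson ball_subset_cball continuous_on_subset lipschitz_on_continuous_on)
    then show ?thesis by (simp add: continuous_on_eq_continuous_at)
  qed
  then show ?thesis by (simp add: continuous_on_eq_continuous_within continuous_at_imp_continuous_within)
qed

lemma loc_lipschitz_bounded:
  fixes f :: "'a::euclidean_space \<Rightarrow> real"
  assumes "loc_lipschitz f" shows "\<exists>B\<ge>0. \<forall>x. norm x \<le> r \<longrightarrow> \<bar>f x\<bar> \<le> B"
proof -
  have "bounded (f ` cball 0 r)"
    using loc_lipschitz_continuous_on[OF assms]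
    by (intro compact_imp_bounded compact_continuous_image) (auto intro: continuous_on_subset)
  then obtain B where "\<forall>x\<in>cball 0 r. \<bar>f x\<bar> \<le> B" unfolding bounded_iff by auto
  then show ?thesis by (intro exI[of _ "max B 0"]) (auto simp: le_max_iff_disj)
qed

lemma loc_lipschitz_add:
  "loc_lipschitz f \<Longrightarrow> loc_lipschitz g \<Longrightarrow> loc_lipschitz (\<lambda>x. f x + g x)"
  unfolding loc_lipschitz_def
proof
  fix r
  assume "\<forall>r. \<exists>L. L-lipschitz_on (cball 0 r) f" "\<forall>r. \<exists>L. L-lipschitz_on (cball 0 r) g"
  then obtain L K where "L-lipschitz_on (cball 0 r) f" "K-lipschitz_on (cball 0 r) g" by blast
  from lipschitz_on_add[OF this] show "\<exists>L. L-lipschitz_on (cball 0 r) (\<lambda>x. f x + g x)" by blast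
qed

lemma loc_lipschitz_const: "loc_lipschitz (\<lambda>x. c)"
  unfolding loc_lipschitz_def by (intro allI exI[of _ 0] lipschitz_on_constant)

lemma loc_lipschitz_sum:
  "finite I \<Longrightarrow> (\<And>i. i \<in> I \<Longrightarrow> loc_lipschitz (f i)) \<Longrightarrow> loc_lipschitz (\<lambda>x. \<Sum>i\<in>I. f i x)"
  by (induction I rule: finite_induct) (auto intro: loc_lipschitz_add loc_lipschitz_const)

lemma loc_lipschitz_mult:
  fixes f :: "'a::euclidean_space \<Rightarrow> real"
  assumes f: "loc_lipschitz f" and g: "loc_lipschitz g"
  shows "loc_lipschitz (\<lambda>x. f x * g x)"
  unfolding loc_lipschitz_def
proof
  fix r
  obtain L where L: "L-lipschitz_on (cball 0 r) f" using f unfolding loc_lipschitz_def by blast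
  obtain K where K: "K-lipschitz_on (cball 0 r) g" using g unfolding loc_lipschitz_def by blast
  obtain B where B: "B \<ge> 0" "\<And>x. norm x \<le> r \<Longrightarrow> \<bar>f x\<bar> \<le> B"
    using loc_lipschitz_bounded[OF f] by blast
  obtain C where C: "C \<ge> 0" "\<And>x. norm x \<le> r \<Longrightarrow> \<bar>g x\<bar> \<le> C"
    using loc_lipschitz_bounded[OF g] by blast
  have "(B * K + L * C)-lipschitz_on (cball 0 r) (\<lambda>x. f x * g x)"
  proof (rule lipschitz_onI)
    fix x y :: 'a assume xy: "x \<in> cball 0 r" "y \<in> cball 0 r"
    have "\<bar>f x * g x - f y * g y\<bar> = \<bar>f x * (g x - g y) + (f x - f y) * g y\<bar>"
      by (simp add: algebra_simps)
    also have "\<dots> \<le> \<bar>f x\<bar> * \<bar>g x - g y\<bar> + \<bar>f x - f y\<bar> * \<bar>g y\<bar>"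
      by (metis abs_mult abs_triangle_ineq)
    also have "\<dots> \<le> B * (K * dist x y) + (L * dist x y) * C"
      using xy B C lipschitz_onD[OF L xy] lipschitz_onD[OF K xy] lipschitz_on_nonneg[OF L]
      by (intro add_mono mult_mono) (auto simp: dist_real_def)
    finally show "dist (f x * g x) (f y * g y) \<le> (B * K + L * C) * dist x y"
      by (simp add: dist_real_def algebra_simps)
  qed (use B C lipschitz_on_nonneg[OF L] lipschitz_on_nonneg[OF K] in auto)
  then show "\<exists>L. L-lipschitz_on (cball 0 r) (\<lambda>x. f x * g x)" by blast
qed

lemma loc_lipschitz_compose:
  fixes f :: "'a::euclidean_space \<Rightarrow> real" and g :: "real \<Rightarrow> real"
  assumes f: "loc_lipschitz f" and g: "loc_lipschitz g"
  shows "loc_lipschitz (\<lambda>x. g (f x))"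
  unfolding loc_lipschitz_def
proof
  fix r
  obtain L where L: "L-lipschitz_on (cball 0 r) f" using f unfolding loc_lipschitz_def by blast
  obtain B where B: "\<And>x. norm x \<le> r \<Longrightarrow> \<bar>f x\<bar> \<le> B"
    using loc_lipschitz_bounded[OF f] by blast
  obtain K where K: "K-lipschitz_on (cball 0 B) g" using g unfolding loc_lipschitz_def by blast
  have "K-lipschitz_on (f ` cball 0 r) g" by (rule lipschitz_on_subset[OF K]) (use B in auto)
  from lipschitz_on_compose2[OF L this] show "\<exists>L. L-lipschitz_on (cball 0 r) (\<lambda>x. g (f x))"
    by blast
qed

lemma lipschitz_if_compact_support:
  fixes f :: "'a::euclidean_space \<Rightarrow> real"
  assumes f: "loc_lipschitz f" and supp: "\<And>x. r < norm x \<Longrightarrow> f x = 0"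
  shows "\<exists>L. L-lipschitz_on UNIV f"
proof -
  obtain L where L: "L-lipschitz_on (cball 0 (r + 1)) f"
    using f unfolding loc_lipschitz_def by blast
  obtain B where B: "B \<ge> 0" "\<And>x. norm x \<le> r \<Longrightarrow> \<bar>f x\<bar> \<le> B"
    using loc_lipschitz_bounded[OF f] by blast
  have key: "\<bar>f x - f y\<bar> \<le> (L + B) * dist x y" if x: "norm x \<le> r" for x y
  proof (cases "norm y \<le> r + 1")
    case True
    have "\<bar>f x - f y\<bar> \<le> L * dist x y"
      using lipschitz_onD[OF L, of x y] x True by (auto simp: dist_real_def)
    also have "\<dots> \<le> (L + B) * dist x y" using B by (simp add: mult_right_mono)
    finally show ?thesis .
  next
    case False
    then have "f y = 0" using supp by simp
    have "1 \<le> dist x y" using False x norm_triangle_ineq2[of y x] by (simp add: dist_norm norm_minus_commute)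
    then have "\<bar>f x\<bar> \<le> B * dist x y"
      using B(2)[OF x] mult_left_mono[of 1 "dist x y" B] B(1) by simp
    also have "\<dots> \<le> (L + B) * dist x y"
      using lipschitz_on_nonneg[OF L] by (simp add: mult_right_mono)
    finally show ?thesis using \<open>f y = 0\<close> by simp
  qed
  have "(L + B)-lipschitz_on UNIV f"
  proof (rule lipschitz_onI)
    fix x y :: 'a
    consider "norm x \<le> r" | "norm y \<le> r" | "norm x > r" "norm y > r" by linarith
    then show "dist (f x) (f y) \<le> (L + B) * dist x y"
    proof cases
      case 1
      then show ?thesis using key by (simp add: dist_real_def)
    next
      case 2
      then show ?thesis using key[of y x] by (simp add: dist_real_def dist_commute abs_minus_commute)
    next
      case 3
      then show ?thesis using supp B lipschitz_on_nonneg[OF L] by simp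
    qed
  qed (use B lipschitz_on_nonneg[OF L] in auto)
  then show ?thesis by blast
qed

lemma Ck_on_1_loc_lipschitz:
  fixes f :: "real^'n \<Rightarrow> real"
  assumes "Ck_on (Suc 0) UNIV f"
  shows "loc_lipschitz f"
  unfolding loc_lipschitz_def
proof
  fix r
  let ?D = "\<lambda>x v. frechet_derivative f (at x) v"
  note der = Ck_on_Suc_has_derivative[OF assms]
  have "\<exists>B. \<forall>x\<in>cball 0 r. \<bar>?D x (axis i 1)\<bar> \<le> B" for i
  proof -
    have "continuous_on UNIV (\<lambda>x. ?D x (axis i 1))" using assms by simp
    then have "bounded ((\<lambda>x. ?D x (axis i 1)) ` cball 0 r)"
      by (intro compact_imp_bounded compact_continuous_image) (auto intro: continuous_on_subset)
    then show ?thesis unfolding bounded_iff by auto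
  qed
  then obtain B where B: "\<And>i x. norm x \<le> r \<Longrightarrow> \<bar>?D x (axis i 1)\<bar> \<le> B i"
    by (metis mem_cball_0)
  show "\<exists>L. L-lipschitz_on (cball 0 r) f"
  proof (cases "r < 0")
    case True
    then show ?thesis by (intro exI[of _ 0]) (auto simp: lipschitz_on_def)
  next
    case False
    have B0: "0 \<le> B i" for i using B[of 0 i] False by fastforce
    have "(\<Sum>i\<in>UNIV. B i)-lipschitz_on (cball 0 r) f"
    proof (rule bounded_derivative_imp_lipschitz)
      show "(f has_derivative ?D x) (at x within cball 0 r)" for x
        using der has_derivative_at_withinI by blast
      show "onorm (?D x) \<le> (\<Sum>i\<in>UNIV. B i)" if "x \<in> cball 0 r" for x
      proof (rule onorm_bound)
        fix v :: "real^'n"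
        interpret linear "?D x" using der has_derivative_linear by blast
        have "?D x v = ?D x (\<Sum>i\<in>UNIV. v $ i *\<^sub>R axis i 1)"
          by (simp add: basis_expansion scalar_mult_eq_scaleR[symmetric])
        also have "\<dots> = (\<Sum>i\<in>UNIV. v $ i * ?D x (axis i 1))"
          by (simp add: sum scale)
        also have "norm \<dots> \<le> (\<Sum>i\<in>UNIV. norm v * B i)"
          using that B[of x] by (intro sum_norm_le)
            (auto simp: abs_mult intro!: mult_mono component_le_norm_cart)
        finally show "norm (?D x v) \<le> (\<Sum>i\<in>UNIV. B i) * norm v"
          by (simp add: sum_distrib_left mult.commute)
      qed (use B0 in \<open>auto intro: sum_nonneg\<close>)
    qed (use B0 in \<open>auto intro: sum_nonneg\<close>)
    then show ?thesis by blast
  qed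
qed

text \<open>By translation invariance the difference quotients of \<open>f\<close> have integral zero.  The Lipschitz
  bound and the bounded support dominate them, so the zero survives in the limit.\<close>

lemma integral_directional_derivative_eq_0:
  fixes f :: "'a::euclidean_space \<Rightarrow> real"
  assumes L: "L-lipschitz_on UNIV f" and supp: "\<And>x. r < norm x \<Longrightarrow> f x = 0"
    and d: "d \<in> borel_measurable lebesgue"
    and der: "AE x in lebesgue. ((\<lambda>h. f (x + h *\<^sub>R e)) has_real_derivative d x) (at 0)"
  shows "(LINT x|lebesgue. d x) = 0"
proof -
  define h where "h k = 1 / real (Suc k)" for k
  have h: "0 < h k" "h k \<le> 1" "h k \<noteq> 0" for k by (auto simp: h_def)
  have h0: "h \<longlonglongrightarrow> 0"
    unfolding h_def using LIMSEQ_inverse_real_of_nat by (simp add: inverse_eq_divide)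
  define D where "D k x = (f (x + h k *\<^sub>R e) - f x) / h k" for k x
  have cont: "continuous_on UNIV f" using L by (rule lipschitz_on_continuous_on)
  then have meas: "f \<in> borel_measurable borel" by (simp add: borel_measurable_continuous_onI)
  have meas': "(\<lambda>x. f (x + c)) \<in> borel_measurable borel" for c
    by (intro measurable_compose[OF _ meas]) simp
  have "integrable lborel (\<lambda>x. indicator (cball 0 r) x *\<^sub>R f x)"
    using continuous_on_subset[OF cont]
    by (intro borel_integrable_compact) auto
  moreover have "(\<lambda>x. indicator (cball 0 r) x *\<^sub>R f x) = f"
    using supp by (auto simp: indicator_def fun_eq_iff not_le)
  ultimately have fi: "integrable lborel f" by simp
  have shift: "integrable lborel (\<lambda>x. f (x + c))" "(LINT x|lborel. f (x + c)) = (LINT x|lborel. f x)"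
    for c
  proof -
    have eq: "distr lborel borel ((+) c) = (lborel :: 'a measure)" by (simp add: lborel_distr_plus)
    have "integrable (distr lborel borel ((+) c)) f" using fi eq by simp
    then show "integrable lborel (\<lambda>x. f (x + c))"
      proof (subst (asm) integrable_distr_eq)
      assume "integrable lborel (\<lambda>x. f (c + x))"
      then show ?thesis by (simp add: add.commute)
    qed (use meas in auto)
    have "(LINT x|lborel. f x) = (LINT x|distr lborel borel ((+) c). f x)" using eq by simp
    also have "\<dots> = (LINT x|lborel. f (c + x))" by (rule integral_distr) (use meas in auto)
    finally show "(LINT x|lborel. f (x + c)) = (LINT x|lborel. f x)" by (simp add: add.commute)
  qed
  have Dmeas: "D k \<in> borel_measurable borel" for k
    unfolding D_def[abs_def] using meas meas' by (intro borel_measurable_divide borel_measurable_diff) auto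
  have D0: "(LINT x|lebesgue. D k x) = 0" for k
  proof -
    have "(LINT x|lebesgue. D k x) = (LINT x|lborel. D k x)"
      using Dmeas by (intro integral_completion) simp
    also have "\<dots> = 0" unfolding D_def using shift[of "h k *\<^sub>R e"] fi by simp
    finally show ?thesis .
  qed
  have "(\<lambda>k. LINT x|lebesgue. D k x) \<longlonglongrightarrow> (LINT x|lebesgue. d x)"
  proof (rule integral_dominated_convergence)
    show "D k \<in> borel_measurable lebesgue" for k using Dmeas by (intro measurable_completion) simp
    show "AE x in lebesgue. (\<lambda>k. D k x) \<longlonglongrightarrow> d x"
      using der
    proof eventually_elim
      case (elim x)
      then have "((\<lambda>t. (f (x + t *\<^sub>R e) - f x) / t) \<longlongrightarrow> d x) (at 0)"
        by (simp add: has_field_derivative_iff)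
      moreover have "filterlim h (at 0) sequentially"
        unfolding filterlim_at using h0 h(3) by simp
      ultimately show ?case unfolding D_def by (rule filterlim_compose)
    qed
    show "integrable lebesgue (\<lambda>x. indicator (cball 0 (r + norm e)) x *\<^sub>R (L * norm e))"
      using lmeasurable_cball[of 0 "r + norm e"]
      unfolding lmeasurable_iff_integrable by (intro integrable_scaleR_left) simp
    show "AE x in lebesgue. norm (D k x) \<le> indicator (cball 0 (r + norm e)) x *\<^sub>R (L * norm e)" for k
    proof (rule AE_I2)
      fix x
      have "\<bar>f (x + h k *\<^sub>R e) - f x\<bar> \<le> L * dist (x + h k *\<^sub>R e) x"
        using lipschitz_onD[OF L, of "x + h k *\<^sub>R e" x] by (simp add: dist_real_def)
      then have le: "\<bar>D k x\<bar> \<le> L * norm e"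
        using h[of k] unfolding D_def abs_divide
        by (subst pos_divide_le_eq) (simp_all add: dist_norm mult_ac)
      show "norm (D k x) \<le> indicator (cball 0 (r + norm e)) x *\<^sub>R (L * norm e)"
      proof (cases "norm x \<le> r + norm e")
        case False
        have "norm (h k *\<^sub>R e) \<le> norm e" using h[of k] by (simp add: mult_left_le_one_le)
        then have "norm (x + h k *\<^sub>R e) > r"
          using False norm_triangle_ineq4[of "x + h k *\<^sub>R e" "h k *\<^sub>R e"] by simp
        moreover have "norm x > r" using False norm_ge_zero[of e] by linarith
        ultimately have "D k x = 0" using supp by (simp add: D_def)
        then show ?thesis using False by simp
      qed (use le in simp)
    qed
  qed (rule d)
  then show ?thesis unfolding D0 by (simp add: LIMSEQ_const_iff)
qed

text \<open>The product \<open>v g\<close> is Lipschitz with bounded support, so its derivative has integral zero.\<close>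

lemma weak_integration_by_parts:
  fixes v g :: "real^'n \<Rightarrow> real"
  assumes v: "loc_lipschitz v" and g: "Ck_on (Suc 0) UNIV g"
    and supp: "\<And>x. r < norm x \<Longrightarrow> g x = 0"
    and dv: "AE x in lebesgue. ((\<lambda>h. v (x + h *\<^sub>R e)) has_real_derivative dv x) (at 0)"
    and int: "integrable lebesgue (\<lambda>x. dv x * g x)"
  shows "(LINT x|lebesgue. v x * frechet_derivative g (at x) e) = - (LINT x|lebesgue. dv x * g x)"
proof -
  let ?dg = "\<lambda>x. frechet_derivative g (at x) e"
  have "loc_lipschitz (\<lambda>x. v x * g x)" by (intro loc_lipschitz_mult v Ck_on_1_loc_lipschitz g)
  then obtain L where L: "L-lipschitz_on UNIV (\<lambda>x. v x * g x)"
    using lipschitz_if_compact_support[of "\<lambda>x. v x * g x" r] supp by auto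
  have gder: "((\<lambda>h. g (x + h *\<^sub>R e)) has_real_derivative ?dg x) (at 0)" for x
  proof -
    have "((\<lambda>h. x + h *\<^sub>R e) has_derivative (\<lambda>h. h *\<^sub>R e)) (at 0)"
      by (auto intro!: derivative_eq_intros)
    moreover have "(g has_derivative frechet_derivative g (at x)) (at (x + 0 *\<^sub>R e))"
      using Ck_on_Suc_has_derivative[OF g] by simp
    ultimately have "((\<lambda>h. g (x + h *\<^sub>R e)) has_derivative
        (\<lambda>h. frechet_derivative g (at x) (h *\<^sub>R e))) (at 0)"
      by (rule has_derivative_compose)
    moreover have "frechet_derivative g (at x) (h *\<^sub>R e) = ?dg x * h" for h
      using linear_cmul[OF has_derivative_linear[OF Ck_on_Suc_has_derivative[OF g]]]
      by (simp add: mult.commute)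
    ultimately show ?thesis by (simp add: has_field_derivative_def)
  qed
  have dg_supp: "?dg x = 0" if "r < norm x" for x
  proof -
    have "(g has_derivative (\<lambda>_. 0)) (at x)"
    proof (rule has_derivative_transform_within_open[of "\<lambda>_. 0" _ _ _ "- cball 0 r"])
      show "open (- cball (0::real^'n) r)" by (simp add: open_Compl)
    qed (use that supp in auto)
    from frechet_derivative_at[OF this, symmetric] show ?thesis by simp
  qed
  have cont: "continuous_on UNIV (\<lambda>x. v x * ?dg x)"
    using loc_lipschitz_continuous_on[OF v] g by (intro continuous_on_mult) auto
  have "integrable lborel (\<lambda>x. indicator (cball 0 r) x *\<^sub>R (v x * ?dg x))"
    using continuous_on_subset[OF cont] by (intro borel_integrable_compact) auto
  moreover have "(\<lambda>x. indicator (cball 0 r) x *\<^sub>R (v x * ?dg x)) = (\<lambda>x. v x * ?dg x)"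
    using dg_supp by (auto simp: indicator_def fun_eq_iff not_le)
  ultimately have "integrable lborel (\<lambda>x. v x * ?dg x)" by simp
  then have int': "integrable lebesgue (\<lambda>x. v x * ?dg x)"
    by (simp add: integrable_completion)
  have "(LINT x|lebesgue. dv x * g x + v x * ?dg x) = 0"
  proof (rule integral_directional_derivative_eq_0[OF L, of r _ e])
    show "(\<lambda>x. dv x * g x + v x * ?dg x) \<in> borel_measurable lebesgue"
      using int int' by (intro borel_measurable_add borel_measurable_integrable)
    show "AE x in lebesgue. ((\<lambda>h. v (x + h *\<^sub>R e) * g (x + h *\<^sub>R e)) has_real_derivative
        dv x * g x + v x * ?dg x) (at 0)"
      using dv
    proof eventually_elim
      case (elim x)
      from DERIV_mult[OF elim gder] show ?case by (simp add: add.commute mult.commute)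
    qed
  qed (use supp in auto)
  then show ?thesis using int int' by simp
qed

section \<open>Polynomials\<close>

text \<open>Symmetry of the second derivative is part of the induction, since mixed derivatives must not
  depend on the order of differentiation.\<close>

lemma polynomial_derivatives:
  assumes "real_polynomial_function p"
  shows "\<exists>p' p''. (\<forall>x. (p has_derivative p' x) (at x)) \<and>
    (\<forall>v. real_polynomial_function (\<lambda>x. p' x v)) \<and>
    (\<forall>v x. ((\<lambda>x. p' x v) has_derivative p'' v x) (at x)) \<and> (\<forall>v w x. p'' v x w = p'' w x v)"
proof -
  let ?P = "\<lambda>p p' p''. (\<forall>x. (p has_derivative p' x) (at x)) \<and>
    (\<forall>v. real_polynomial_function (\<lambda>x. p' x v)) \<and>
    (\<forall>v x. ((\<lambda>x. p' x v) has_derivative p'' v x) (at x)) \<and> (\<forall>v w x. p'' v x w = p'' w x v)"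
  have "\<exists>p' p''. ?P p p' p''"
    using assms
  proof (induction p rule: real_polynomial_function.induct)
    case (linear f)
    have "?P f (\<lambda>_. f) (\<lambda>_ _ _. 0)" 
      by (auto intro: bounded_linear_imp_has_derivative linear)
    then show ?case
      by (intro exI[of _ "(\<lambda>_. f)"] exI[of _ "(\<lambda>_ _ _. 0)"])
  next
    case (const c)
    have "?P (\<lambda>x. c) (\<lambda>_ _. 0) (\<lambda>_ _ _. 0)" by auto
    then show ?case
      by (intro exI[of _ "(\<lambda>_ _. 0)"] exI[of _ "(\<lambda>_ _ _. 0)"])
  next
    case (add f g)
    then obtain f' f'' g' g'' where f: "?P f f' f''" and g: "?P g g' g''" by blast
    have "?P (\<lambda>x. f x + g x) (\<lambda>x v. f' x v + g' x v) (\<lambda>v x w. f'' v x w + g'' v x w)"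
      using f g by (auto intro!: has_derivative_add)
    then show ?case
      by (intro exI[of _ "(\<lambda>x v. f' x v + g' x v)"] exI[of _ "(\<lambda>v x w. f'' v x w + g'' v x w)"])
  next
    case (mult f g)
    then obtain f' f'' g' g'' where f: "?P f f' f''" and g: "?P g g' g''" by blast
    have "?P (\<lambda>x. f x * g x) (\<lambda>x v. f x * g' x v + f' x v * g x)
      (\<lambda>v x w. (f x * g'' v x w + f' x w * g' x v) + (f' x v * g' x w + f'' v x w * g x))"
    proof (intro conjI allI)
      fix v w x
      show "((\<lambda>x. f x * g x) has_derivative (\<lambda>v. f x * g' x v + f' x v * g x)) (at x)"
        using f g by (intro has_derivative_mult) blast+
      show "real_polynomial_function (\<lambda>x. f x * g' x v + f' x v * g x)"
        using f g mult.hyps by (intro real_polynomial_function.intros(3,4)) blast+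
      show "((\<lambda>x. f x * g' x v + f' x v * g x) has_derivative
        (\<lambda>w. (f x * g'' v x w + f' x w * g' x v) + (f' x v * g' x w + f'' v x w * g x))) (at x)"
        using f g by (intro has_derivative_add has_derivative_mult) blast+
      show "(f x * g'' v x w + f' x w * g' x v) + (f' x v * g' x w + f'' v x w * g x)
        = (f x * g'' w x v + f' x v * g' x w) + (f' x w * g' x v + f'' w x v * g x)"
        using f g by (simp add: add_ac)
    qed
    then show ?case
      by (intro exI[of _ "(\<lambda>x v. f x * g' x v + f' x v * g x)"] exI[of _ "(\<lambda>v x w. (f x * g'' v x w + f' x w * g' x v) + (f' x v * g' x w + f'' v x w * g x))"])
  qed
  then show ?thesis .
qed

abbreviation pderiv_dir :: "'a::real_normed_vector \<Rightarrow> ('a \<Rightarrow> real) \<Rightarrow> 'a \<Rightarrow> real" where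
  "pderiv_dir v p \<equiv> (\<lambda>x. frechet_derivative p (at x) v)"

lemma polynomial_has_derivative:
  assumes "real_polynomial_function p"
  shows "(p has_derivative frechet_derivative p (at x)) (at x)"
proof -
  obtain p' where "\<forall>x. (p has_derivative p' x) (at x)"
    using polynomial_derivatives[OF assms] by blast
  then have "p differentiable (at x)" unfolding differentiable_def by blast
  then show ?thesis by (simp add: frechet_derivative_works)
qed

lemma polynomial_pderiv_dir:
  assumes "real_polynomial_function p" shows "real_polynomial_function (pderiv_dir v p)"
proof -
  obtain p' where p': "\<forall>x. (p has_derivative p' x) (at x)"
      "\<forall>v. real_polynomial_function (\<lambda>x. p' x v)"
    using polynomial_derivatives[OF assms] by blast
  have "frechet_derivative p (at x) = p' x" for x
    using frechet_derivative_at[OF p'(1)[rule_format]] by simp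
  then show ?thesis using p' by simp
qed

lemma pderiv_dir_commute:
  assumes "real_polynomial_function p"
  shows "pderiv_dir v (pderiv_dir w p) = pderiv_dir w (pderiv_dir v p)"
proof -
  obtain p' p'' where p: "\<forall>x. (p has_derivative p' x) (at x)"
      "\<forall>v x. ((\<lambda>x. p' x v) has_derivative p'' v x) (at x)" "\<forall>v w x. p'' v x w = p'' w x v"
    using polynomial_derivatives[OF assms] by blast
  have 1: "frechet_derivative p (at x) = p' x" for x
    using frechet_derivative_at[OF p(1)[rule_format]] by simp
  have 2: "frechet_derivative (\<lambda>x. p' x v) (at x) = p'' v x" for v x
    using frechet_derivative_at[OF p(2)[rule_format]] by simp
  show ?thesis unfolding 1 2 using p(3) by auto
qed

lemma pderiv_dir_add:
  "real_polynomial_function p \<Longrightarrow> real_polynomial_function q \<Longrightarrow>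
    pderiv_dir v (\<lambda>x. p x + q x) = (\<lambda>x. pderiv_dir v p x + pderiv_dir v q x)"
  using frechet_derivative_at[OF has_derivative_add[OF polynomial_has_derivative
        polynomial_has_derivative], of p q] by (auto simp: fun_eq_iff)

lemma pderiv_dir_mult:
  "real_polynomial_function p \<Longrightarrow> real_polynomial_function q \<Longrightarrow>
    pderiv_dir v (\<lambda>x. p x * q x) = (\<lambda>x. p x * pderiv_dir v q x + pderiv_dir v p x * q x)"
  using frechet_derivative_at[OF has_derivative_mult[OF polynomial_has_derivative
        polynomial_has_derivative], of p q] by (auto simp: fun_eq_iff)

lemma Ck_on_polynomial: "real_polynomial_function p \<Longrightarrow> Ck_on k UNIV p"
proof (induction k arbitrary: p)
  case 0
  then show ?case by (simp add: continuous_on_polymonial_function real_polynomial_function_eq)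
next
  case (Suc k)
  show ?case
    by (rule Ck_on_SucI[OF polynomial_has_derivative])
      (use Suc in \<open>auto intro: polynomial_pderiv_dir\<close>)
qed

lemma loc_lipschitz_polynomial:
  fixes p :: "real^'n \<Rightarrow> real"
  shows "real_polynomial_function p \<Longrightarrow> loc_lipschitz p"
  by (intro Ck_on_1_loc_lipschitz Ck_on_polynomial)

section \<open>Weak derivatives of composite functions\<close>

lemma frechet_derivative_eq_0_outside:
  fixes f :: "'a::real_normed_vector \<Rightarrow> real"
  assumes "closed K" "\<And>x. x \<notin> K \<Longrightarrow> f x = 0" "x \<notin> K"
  shows "frechet_derivative f (at x) v = 0"
proof -
  have "(f has_derivative (\<lambda>_. 0)) (at x)"
  proof (rule has_derivative_transform_within_open[of "\<lambda>_. 0" _ _ _ "- K"])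
    show "open (- K)" using assms(1) by (simp add: open_Compl)
  qed (use assms in auto)
  from frechet_derivative_at[OF this, symmetric] show ?thesis by simp
qed

lemma partials_smooth:
  assumes "\<And>k. Ck_on k UNIV \<phi>" shows "Ck_on k UNIV (partials js \<phi>)"
proof (induction js arbitrary: k)
  case (Cons i js)
  have "Ck_on (Suc k) UNIV (partials js \<phi>)" by (rule Cons)
  then show ?case by simp
qed (simp add: assms)

lemma partials_eq_0_outside:
  assumes "closed K" "\<And>x. x \<notin> K \<Longrightarrow> \<phi> x = 0" "x \<notin> K"
  shows "partials js \<phi> x = 0"
  using assms(3)
proof (induction js arbitrary: x)
  case Nil
  then show ?case using assms by simp
next
  case (Cons i js)
  then show ?case
    by (simp add: frechet_derivative_eq_0_outside[OF assms(1)])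
qed

lemma integrable_if_bounded_support:
  fixes f :: "'a::euclidean_space \<Rightarrow> real"
  assumes f: "f \<in> borel_measurable lebesgue" and B: "\<And>x. norm x \<le> r \<Longrightarrow> \<bar>f x\<bar> \<le> B"
    and supp: "\<And>x. r < norm x \<Longrightarrow> f x = 0"
  shows "integrable lebesgue f"
proof (rule Bochner_Integration.integrable_bound)
  show "integrable lebesgue (\<lambda>x. indicator (cball 0 r) x *\<^sub>R B)"
    using lmeasurable_cball[of 0 r]
    unfolding lmeasurable_iff_integrable by (intro integrable_scaleR_left) simp
  show "AE x in lebesgue. norm (f x) \<le> norm (indicator (cball 0 r) x *\<^sub>R B)"
  proof (rule AE_I2)
    fix x :: 'a
    show "norm (f x) \<le> norm (indicator (cball 0 r) x *\<^sub>R B)"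
      using B[of x] supp[of x] by (cases "norm x \<le> r") auto
  qed
qed (rule f)

lemma ex_list_count_list:
  fixes \<alpha> :: "'n::finite \<Rightarrow> nat"
  shows "\<exists>js. \<forall>i. count_list js i = \<alpha> i"
proof -
  obtain js where js: "mset js = (\<Sum>i\<in>UNIV. replicate_mset (\<alpha> i) i)" using ex_mset by blast
  have "count_list js i = \<alpha> i" for i
  proof -
    have "count_list js i = count (\<Sum>i\<in>UNIV. replicate_mset (\<alpha> i) i) i"
      by (simp add: js[symmetric] count_mset)
    also have "\<dots> = (\<Sum>k\<in>UNIV. if k = i then \<alpha> k else 0)"
      unfolding count_sum by (intro sum.cong) auto
    finally show ?thesis by simp
  qed
  then show ?thesis by blast
qed

lemma sum_count_list_eq_length:
  fixes js :: "'n::finite list"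
  assumes "\<And>i. count_list js i = \<alpha> i" shows "(\<Sum>i\<in>UNIV. \<alpha> i) = length js"
  using sum_count_set[of js UNIV] assms by simp

text \<open>Iterated derivatives of \<open>h m \<circ> Q\<close>, for a polynomial \<open>Q\<close> and functions with \<open>(h (j+1))' = - h j\<close>,
  are combinations of the \<open>h (m-j) \<circ> Q\<close> with polynomial coefficients \<open>A j\<close>; the sign in the
  definition collects the minus signs of the chain.\<close>

definition chain_comb ::
  "(nat \<Rightarrow> real \<Rightarrow> real) \<Rightarrow> (real^'n \<Rightarrow> real) \<Rightarrow> nat \<Rightarrow> (nat \<Rightarrow> real^'n \<Rightarrow> real) \<Rightarrow> real^'n \<Rightarrow> real"
where
  "chain_comb h Q m A x = (\<Sum>j\<le>m. (-1) ^ j * h (m - j) (Q x) * A j x)"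

text \<open>The action of the \<open>i\<close>-th partial derivative on the sequence of coefficients, read off from
  the product rule and the chain rule.\<close>

definition chain_coeff ::
  "(real^'n \<Rightarrow> real) \<Rightarrow> 'n \<Rightarrow> (nat \<Rightarrow> real^'n \<Rightarrow> real) \<Rightarrow> nat \<Rightarrow> real^'n \<Rightarrow> real" where
  "chain_coeff Q i A j = (case j of 0 \<Rightarrow> pderiv_dir (axis i 1) (A 0)
     | Suc k \<Rightarrow> (\<lambda>x. pderiv_dir (axis i 1) (A (Suc k)) x + A k x * pderiv_dir (axis i 1) Q x))"

definition unit_coeffs :: "nat \<Rightarrow> real^'n \<Rightarrow> real" where
  "unit_coeffs j x = (if j = 0 then 1 else 0)"

text \<open>The bound \<open>l\<close> is the number of differentiations made so far: while \<open>l < m\<close>, the combination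
  contains only members \<open>h j\<close> with \<open>j \<ge> 1\<close>, which are locally Lipschitz.\<close>

definition poly_coeffs :: "nat \<Rightarrow> (nat \<Rightarrow> real^'n \<Rightarrow> real) \<Rightarrow> bool" where
  "poly_coeffs l A \<longleftrightarrow> (\<forall>j. real_polynomial_function (A j)) \<and> (\<forall>j>l. A j = (\<lambda>x. 0))"

lemma pderiv_dir_zero [simp]: "pderiv_dir v (\<lambda>x. 0) = (\<lambda>x. 0)"
  by (simp add: fun_eq_iff)

lemma poly_coeffs_unit: "poly_coeffs 0 unit_coeffs"
  unfolding poly_coeffs_def unit_coeffs_def
  by (auto simp: fun_eq_iff real_polynomial_function.intros)

lemma poly_coeffs_chain_coeff:
  assumes Q: "real_polynomial_function Q" and A: "poly_coeffs l A"
  shows "poly_coeffs (Suc l) (chain_coeff Q i A)"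
  unfolding poly_coeffs_def
proof (intro conjI allI impI)
  fix j
  show "real_polynomial_function (chain_coeff Q i A j)"
    using A Q unfolding poly_coeffs_def chain_coeff_def
    by (cases j) (auto intro!: polynomial_pderiv_dir real_polynomial_function.intros(3,4))
  assume j: "Suc l < j"
  then obtain k where "j = Suc k" "l < k" by (cases j) auto
  then show "chain_coeff Q i A j = (\<lambda>x. 0)"
    using A unfolding poly_coeffs_def chain_coeff_def by simp
qed

lemma poly_coeffs_fold:
  "real_polynomial_function Q \<Longrightarrow> poly_coeffs l A \<Longrightarrow>
    poly_coeffs (l + length js) (fold (chain_coeff Q) js A)"
proof (induction js arbitrary: l A)
  case (Cons i js)
  have "poly_coeffs (Suc l + length js) (fold (chain_coeff Q) js (chain_coeff Q i A))"
    by (intro Cons.IH Cons.prems poly_coeffs_chain_coeff)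
  then show ?case by simp
qed simp

lemma chain_coeff_commute:
  assumes Q: "real_polynomial_function Q" and A: "\<forall>j. real_polynomial_function (A j)"
  shows "chain_coeff Q i (chain_coeff Q k A) = chain_coeff Q k (chain_coeff Q i A)"
proof
  fix j
  let ?i = "axis i 1 :: real^'a" and ?k = "axis k 1 :: real^'a"
  note [simp] = pderiv_dir_add[unfolded fun_eq_iff, rule_format]
    pderiv_dir_mult[unfolded fun_eq_iff, rule_format]
  have P [simp]: "real_polynomial_function (A j)" "real_polynomial_function (pderiv_dir v (A j))"
    "real_polynomial_function (pderiv_dir v Q)" for j v
    using A Q polynomial_pderiv_dir by auto
  have M [simp]: "real_polynomial_function (\<lambda>x. A j x * pderiv_dir v Q x)" for j v
    by (intro real_polynomial_function.intros(4)) auto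
  have C: "pderiv_dir ?i (pderiv_dir ?k (A j)) x = pderiv_dir ?k (pderiv_dir ?i (A j)) x"
    "pderiv_dir ?i (pderiv_dir ?k Q) x = pderiv_dir ?k (pderiv_dir ?i Q) x" for j x
    using pderiv_dir_commute[of "A j" ?i ?k] pderiv_dir_commute[OF Q, of ?i ?k]
    by (simp_all add: fun_eq_iff)
  consider "j = 0" | "j = Suc 0" | l where "j = Suc (Suc l)" by (metis not0_implies_Suc)
  then show "chain_coeff Q i (chain_coeff Q k A) j = chain_coeff Q k (chain_coeff Q i A) j"
    by cases (auto simp: chain_coeff_def fun_eq_iff C algebra_simps)
qed

text \<open>A multi-index does not fix an order of differentiation, so one function has to serve as the
  weak derivative for all orders.\<close>

lemma fold_chain_coeff_permute:
  assumes Q: "real_polynomial_function Q" and A: "poly_coeffs l A" and eq: "mset js = mset ks"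
  shows "fold (chain_coeff Q) js A = fold (chain_coeff Q) ks A"
proof (rule fold_permuted_eq[where P = "\<lambda>A. \<exists>l. poly_coeffs l A"])
  show "mset js = mset ks" by (rule eq)
  show "\<exists>l. poly_coeffs l A" using A by blast
  show "\<exists>l. poly_coeffs l (chain_coeff Q i B)" if "\<exists>l. poly_coeffs l B" for i B
    using that poly_coeffs_chain_coeff[OF Q] by blast
  show "chain_coeff Q i (chain_coeff Q k B) = chain_coeff Q k (chain_coeff Q i B)"
    if "\<exists>l. poly_coeffs l B" for i k B
    using that by (intro chain_coeff_commute[OF Q]) (auto simp: poly_coeffs_def)
qed

text \<open>The lowest member \<open>h 0\<close> may jump on \<open>E\<close>, so \<open>h 1\<close> has corners there and the last derivative
  exists almost everywhere only.\<close>

locale primitive_chain =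
  fixes h :: "nat \<Rightarrow> real \<Rightarrow> real" and E :: "real set" and Q :: "real^'n \<Rightarrow> real"
  assumes h_deriv: "\<And>j t. 1 \<le> j \<Longrightarrow> (h (Suc j) has_real_derivative - h j t) (at t)"
    and h1_deriv: "\<And>t. t \<notin> E \<Longrightarrow> (h 1 has_real_derivative - h 0 t) (at t)"
    and h1_lipschitz: "loc_lipschitz (h 1)"
    and h0_measurable: "h 0 \<in> borel_measurable borel"
    and h0_bounded: "\<And>s. \<exists>B. \<forall>t. \<bar>t\<bar> \<le> s \<longrightarrow> \<bar>h 0 t\<bar> \<le> B"
    and Q: "real_polynomial_function Q"
    and Q_avoids: "AE x in lebesgue. Q x \<notin> E"
begin

lemma h_lipschitz: "loc_lipschitz (h (Suc j))"
proof (induction j)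
  case 0
  then show ?case using h1_lipschitz by simp
next
  case (Suc j)
  show ?case
    unfolding loc_lipschitz_def
  proof
    fix r
    obtain B where B: "B \<ge> 0" "\<And>t. norm t \<le> r \<Longrightarrow> \<bar>h (Suc j) t\<bar> \<le> B"
      using loc_lipschitz_bounded[OF Suc] by blast
    have "B-lipschitz_on (cball 0 r) (h (Suc (Suc j)))"
    proof (rule lipschitz_onI)
      fix x y :: real assume xy: "x \<in> cball 0 r" "y \<in> cball 0 r"
      have "norm (h (Suc (Suc j)) x - h (Suc (Suc j)) y) \<le> B * norm (x - y)"
        using xy B h_deriv[of "Suc j"]
        by (intro field_differentiable_bound[where S="cball 0 r" and f'="\<lambda>t. - h (Suc j) t"])
          (auto intro: has_field_derivative_at_within)
      then show "dist (h (Suc (Suc j)) x) (h (Suc (Suc j)) y) \<le> B * dist x y"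
        by (simp add: dist_norm)
    qed (rule B)
    then show "\<exists>L. L-lipschitz_on (cball 0 r) (h (Suc (Suc j)))" by blast
  qed
qed

text \<open>Each derivative descends at most one step in the chain, and the members from \<open>h 1\<close> on are
  continuous.\<close>

lemma Ck_on_chain:
  "k < j \<Longrightarrow> real_polynomial_function p \<Longrightarrow> Ck_on k UNIV (\<lambda>x. h j (Q x) * p x)"
proof (induction k arbitrary: j p)
  case 0
  then obtain l where j: "j = Suc l" by (cases j) auto
  have "loc_lipschitz (\<lambda>x. h j (Q x) * p x)"
    unfolding j using 0 Q
    by (intro loc_lipschitz_mult loc_lipschitz_polynomial loc_lipschitz_compose[OF _ h_lipschitz])
  then show ?case using loc_lipschitz_continuous_on by simp
next
  case (Suc k)
  then obtain l where j: "j = Suc l" "k < l" "1 \<le> l" by (cases j) auto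
  show ?case
  proof (rule Ck_on_SucI)
    fix x
    have "((\<lambda>x. h j (Q x)) has_derivative
        (\<lambda>v. frechet_derivative Q (at x) v * (- h l (Q x)))) (at x)"
      unfolding j using has_derivative_compose[OF polynomial_has_derivative[OF Q]
          h_deriv[OF \<open>1 \<le> l\<close>, unfolded has_field_derivative_def]]
      by (simp add: mult.commute)
    from has_derivative_mult[OF this polynomial_has_derivative[OF Suc.prems(2)]]
    show "((\<lambda>x. h j (Q x) * p x) has_derivative (\<lambda>v. h j (Q x) * frechet_derivative p (at x) v
        + frechet_derivative Q (at x) v * (- h l (Q x)) * p x)) (at x)" .
  next
    fix v
    have "Ck_on k UNIV (\<lambda>x. h j (Q x) * pderiv_dir v p x
        + h l (Q x) * (- 1 * (pderiv_dir v Q x * p x)))"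
      using j Suc.prems Q
      by (intro Ck_on_add Suc.IH polynomial_pderiv_dir real_polynomial_function.intros(2,4)) auto
    then show "Ck_on k UNIV (\<lambda>x. h j (Q x) * frechet_derivative p (at x) v
        + frechet_derivative Q (at x) v * (- h l (Q x)) * p x)"
      by (simp add: algebra_simps)
  qed
qed

lemma chain_comb_lipschitz:
  assumes A: "poly_coeffs l A" and l: "l < m"
  shows "loc_lipschitz (chain_comb h Q m A)"
  unfolding chain_comb_def[abs_def]
proof (rule loc_lipschitz_sum)
  fix j assume "j \<in> {..m}"
  show "loc_lipschitz (\<lambda>x. (-1) ^ j * h (m - j) (Q x) * A j x)"
  proof (cases "j \<le> l")
    case True
    then obtain k where k: "m - j = Suc k" using l by (cases "m - j") auto
    show ?thesis
      unfolding k using A Q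
      by (intro loc_lipschitz_mult loc_lipschitz_polynomial loc_lipschitz_const
          loc_lipschitz_compose[OF _ h_lipschitz]) (auto simp: poly_coeffs_def)
  next
    case False
    then show ?thesis using A by (simp add: poly_coeffs_def loc_lipschitz_const)
  qed
qed simp

lemma chain_comb_measurable:
  assumes A: "poly_coeffs l A"
  shows "chain_comb h Q m A \<in> borel_measurable borel"
proof -
  have [measurable]: "Q \<in> borel_measurable borel"
    using Q by (intro borel_measurable_continuous_onI)
      (simp add: continuous_on_polymonial_function real_polynomial_function_eq)
  have [measurable]: "A j \<in> borel_measurable borel" for j
    using A by (intro borel_measurable_continuous_onI)
      (simp add: poly_coeffs_def continuous_on_polymonial_function real_polynomial_function_eq)
  have [measurable]: "h j \<in> borel_measurable borel" for j
    using h0_measurable loc_lipschitz_continuous_on[OF h_lipschitz]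
    by (cases j) (auto intro: borel_measurable_continuous_onI)
  show ?thesis unfolding chain_comb_def[abs_def] by measurable
qed

lemma h_bounded: "\<exists>B. \<forall>t. \<bar>t\<bar> \<le> s \<longrightarrow> \<bar>h j t\<bar> \<le> B"
proof (cases j)
  case 0
  then show ?thesis using h0_bounded by simp
next
  case (Suc k)
  from loc_lipschitz_bounded[OF h_lipschitz, of s k] show ?thesis
    unfolding Suc by auto
qed

lemma chain_comb_bounded:
  assumes A: "poly_coeffs l A"
  shows "\<exists>B. \<forall>x. norm x \<le> r \<longrightarrow> \<bar>chain_comb h Q m A x\<bar> \<le> B"
proof -
  have "\<exists>B. \<forall>x. norm x \<le> r \<longrightarrow> \<bar>(-1) ^ j * h (m - j) (Q x) * A j x\<bar> \<le> B" for j
  proof -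
    obtain q where q: "\<And>x. norm x \<le> r \<Longrightarrow> \<bar>Q x\<bar> \<le> q"
      using loc_lipschitz_bounded[OF loc_lipschitz_polynomial[OF Q]] by blast
    obtain b where b: "\<And>t. \<bar>t\<bar> \<le> q \<Longrightarrow> \<bar>h (m - j) t\<bar> \<le> b" using h_bounded by blast
    obtain c where c: "c \<ge> 0" "\<And>x. norm x \<le> r \<Longrightarrow> \<bar>A j x\<bar> \<le> c"
      using loc_lipschitz_bounded[OF loc_lipschitz_polynomial, of "A j" r] A
      unfolding poly_coeffs_def by blast
    have "\<bar>(-1) ^ j * h (m - j) (Q x) * A j x\<bar> \<le> b * c" if "norm x \<le> r" for x
    proof -
      have "\<bar>h (m - j) (Q x)\<bar> \<le> b" "\<bar>A j x\<bar> \<le> c" using that q b c by auto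
      then show ?thesis
        by (simp add: abs_mult power_abs mult_mono')
    qed
    then show ?thesis by blast
  qed
  then have "\<forall>j. \<exists>B. \<forall>x. norm x \<le> r \<longrightarrow> \<bar>(-1) ^ j * h (m - j) (Q x) * A j x\<bar> \<le> B" by blast
  from choice[OF this] obtain B where
    B: "\<And>j x. norm x \<le> r \<Longrightarrow> \<bar>(-1) ^ j * h (m - j) (Q x) * A j x\<bar> \<le> B j" by blast
  have "\<bar>chain_comb h Q m A x\<bar> \<le> (\<Sum>j\<le>m. B j)" if "norm x \<le> r" for x
    unfolding chain_comb_def using B[OF that] by (rule order_trans[OF sum_abs sum_mono])
  then show ?thesis by blast
qed

text \<open>Where \<open>Q x\<close> avoids \<open>E\<close>, all members from \<open>h 1\<close> on are differentiable at \<open>Q x\<close>, and the derivative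
  of the sum is resummed by a shift of the index.\<close>

lemma chain_comb_derivative:
  assumes A: "poly_coeffs l A" and l: "l < m"
  shows "AE x in lebesgue. ((\<lambda>t. chain_comb h Q m A (x + t *\<^sub>R axis i 1)) has_real_derivative
      chain_comb h Q m (chain_coeff Q i A) x) (at 0)"
  using Q_avoids
proof eventually_elim
  case (elim x)
  let ?e = "axis i 1 :: real^'n"
  have line: "((\<lambda>t. p (x + t *\<^sub>R ?e)) has_real_derivative pderiv_dir ?e p x) (at 0)"
    if p: "real_polynomial_function p" for p
  proof -
    have "((\<lambda>t. x + t *\<^sub>R ?e) has_derivative (\<lambda>t. t *\<^sub>R ?e)) (at 0)"
      by (auto intro!: derivative_eq_intros)
    moreover have "(p has_derivative frechet_derivative p (at x)) (at (x + 0 *\<^sub>R ?e))"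
      using polynomial_has_derivative[OF p] by simp
    ultimately have "((\<lambda>t. p (x + t *\<^sub>R ?e)) has_derivative
        (\<lambda>t. frechet_derivative p (at x) (t *\<^sub>R ?e))) (at 0)"
      by (rule has_derivative_compose)
    moreover have "frechet_derivative p (at x) (t *\<^sub>R ?e) = pderiv_dir ?e p x * t" for t
      using linear_cmul[OF has_derivative_linear[OF polynomial_has_derivative[OF p]]]
      by (simp add: mult.commute)
    ultimately show ?thesis by (simp add: has_field_derivative_def)
  qed
  have hder: "(h (m - j) has_real_derivative - h (m - Suc j) (Q x)) (at (Q x))" if "j < m" for j
  proof (cases "m - j = 1")
    case True
    then have "m - Suc j = 0" by simp
    then show ?thesis using h1_deriv[OF elim] True by simp
  next
    case False
    then have "1 \<le> m - Suc j" "m - j = Suc (m - Suc j)" using that by auto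
    then show ?thesis using h_deriv[of "m - Suc j" "Q x"] by simp
  qed
  obtain M where M: "m = Suc M" using l by (cases m) auto
  have Am: "A m = (\<lambda>x. 0)" using A l by (simp add: poly_coeffs_def)
  have pA: "real_polynomial_function (A j)" for j using A by (simp add: poly_coeffs_def)
  let ?a = "\<lambda>j. (-1) ^ j * h (m - j) (Q x)" and ?D = "\<lambda>p. pderiv_dir ?e p x"
  have "((\<lambda>t. \<Sum>j\<le>M. (-1) ^ j * (h (m - j) (Q (x + t *\<^sub>R ?e)) * A j (x + t *\<^sub>R ?e)))
      has_real_derivative (\<Sum>j\<le>M. (-1) ^ j *
        (- h (m - Suc j) (Q x) * ?D Q * A j x + ?D (A j) * h (m - j) (Q x)))) (at 0)"
  proof (intro DERIV_sum DERIV_cmult)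
    fix j assume "j \<in> {..M}"
    then have j: "j < m" using M by simp
    have "((\<lambda>t. h (m - j) (Q (x + t *\<^sub>R ?e))) has_real_derivative - h (m - Suc j) (Q x) * ?D Q) (at 0)"
    proof (rule DERIV_chain2[OF _ line[OF Q]])
      show "(h (m - j) has_real_derivative - h (m - Suc j) (Q x)) (at (Q (x + 0 *\<^sub>R ?e)))"
        using hder[OF j] by simp
    qed
    from DERIV_mult[OF this line[OF pA]]
    show "((\<lambda>t. h (m - j) (Q (x + t *\<^sub>R ?e)) * A j (x + t *\<^sub>R ?e)) has_real_derivative
        - h (m - Suc j) (Q x) * ?D Q * A j x + ?D (A j) * h (m - j) (Q x)) (at 0)" by simp
  qed
  moreover have "(\<Sum>j\<le>M. (-1) ^ j *
        (- h (m - Suc j) (Q x) * ?D Q * A j x + ?D (A j) * h (m - j) (Q x)))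
      = chain_comb h Q m (chain_coeff Q i A) x"
  proof -
    have "chain_comb h Q m (chain_coeff Q i A) x
        = ?a 0 * ?D (A 0) + (\<Sum>j\<le>M. ?a (Suc j) * (?D (A (Suc j)) + A j x * ?D Q))"
      unfolding chain_comb_def M sum.atMost_Suc_shift by (simp add: chain_coeff_def)
    also have "\<dots> = (?a 0 * ?D (A 0) + (\<Sum>j\<le>M. ?a (Suc j) * ?D (A (Suc j))))
        + (\<Sum>j\<le>M. ?a (Suc j) * (A j x * ?D Q))"
      by (simp only: distrib_left sum.distrib add.assoc)
    also have "?a 0 * ?D (A 0) + (\<Sum>j\<le>M. ?a (Suc j) * ?D (A (Suc j)))
        = (\<Sum>j\<le>Suc M. ?a j * ?D (A j))"
      by (simp only: sum.atMost_Suc_shift)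
    also have "\<dots> = (\<Sum>j\<le>M. ?a j * ?D (A j))" using Am M by simp
    finally show ?thesis by (simp add: sum.distrib[symmetric] algebra_simps)
  qed
  moreover have "chain_comb h Q m A = (\<lambda>y. \<Sum>j\<le>M. (-1) ^ j * (h (m - j) (Q y) * A j y))"
    unfolding chain_comb_def[abs_def] using Am M by (simp add: mult.assoc)
  ultimately show ?case by simp
qed

lemma integrable_chain_comb_mult:
  assumes A: "poly_coeffs l A" and g: "continuous_on UNIV g"
    and supp: "\<And>x. r < norm x \<Longrightarrow> g x = 0"
  shows "integrable lebesgue (\<lambda>x. chain_comb h Q m A x * g x)"
proof -
  obtain B where B: "\<And>x. norm x \<le> r \<Longrightarrow> \<bar>chain_comb h Q m A x\<bar> \<le> B"
    using chain_comb_bounded[OF A] by blast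
  have "bounded (g ` cball 0 r)"
    by (intro compact_imp_bounded compact_continuous_image)
      (auto intro: continuous_on_subset[OF g])
  then obtain C where "\<forall>y\<in>g ` cball 0 r. norm y \<le> C" unfolding bounded_iff by blast
  then have C: "\<And>x. norm x \<le> r \<Longrightarrow> \<bar>g x\<bar> \<le> C" by simp
  show ?thesis
  proof (rule integrable_if_bounded_support)
    show "(\<lambda>x. chain_comb h Q m A x * g x) \<in> borel_measurable lebesgue"
      using chain_comb_measurable[OF A] g
      by (intro measurable_completion) (simp add: borel_measurable_continuous_onI borel_measurable_times)
    show "\<bar>chain_comb h Q m A x * g x\<bar> \<le> B * C" if "norm x \<le> r" for x
      using B[OF that] C[OF that] by (simp add: abs_mult mult_mono')
  qed (use supp in auto)
qed

text \<open>The partial derivatives are moved from the test function one by one.  The budget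
  \<open>l + length js \<le> m\<close> guarantees that the function to be differentiated is locally Lipschitz
  each time.\<close>

lemma integral_partials:
  assumes "\<And>k. Ck_on k UNIV \<phi>" and supp: "\<And>x. r < norm x \<Longrightarrow> \<phi> x = 0"
    and "poly_coeffs l A" "l + length js \<le> m"
  shows "(LINT x|lebesgue. chain_comb h Q m A x * partials js \<phi> x)
    = (-1) ^ length js * (LINT x|lebesgue. chain_comb h Q m (fold (chain_coeff Q) js A) x * \<phi> x)"
  using assms(3,4)
proof (induction js arbitrary: l A)
  case (Cons i js)
  let ?g = "partials js \<phi>"
  have sm: "Ck_on k UNIV ?g" for k by (rule partials_smooth) (rule assms(1))
  have supp': "?g x = 0" if "r < norm x" for x
  proof (rule partials_eq_0_outside)
    show "closed (cball (0::real^'n) r)" by simp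
    show "\<phi> y = 0" if "y \<notin> cball 0 r" for y using supp[of y] that by simp
    show "x \<notin> cball 0 r" using that by simp
  qed
  have cont: "continuous_on UNIV ?g" using sm[of 0] by simp
  have A': "poly_coeffs (Suc l) (chain_coeff Q i A)"
    by (rule poly_coeffs_chain_coeff[OF Q Cons.prems(1)])
  have "(LINT x|lebesgue. chain_comb h Q m A x * frechet_derivative ?g (at x) (axis i 1))
      = - (LINT x|lebesgue. chain_comb h Q m (chain_coeff Q i A) x * ?g x)"
  proof (rule weak_integration_by_parts[OF _ sm supp'])
    have l: "l < m" using Cons.prems by simp
    show "loc_lipschitz (chain_comb h Q m A)" by (rule chain_comb_lipschitz[OF Cons.prems(1) l])
    show "AE x in lebesgue. ((\<lambda>t. chain_comb h Q m A (x + t *\<^sub>R axis i 1)) has_real_derivative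
      chain_comb h Q m (chain_coeff Q i A) x) (at 0)"
      by (rule chain_comb_derivative[OF Cons.prems(1) l])
    show "integrable lebesgue (\<lambda>x. chain_comb h Q m (chain_coeff Q i A) x * ?g x)"
      by (rule integrable_chain_comb_mult[OF A' cont supp'])
  qed
  also have "(LINT x|lebesgue. chain_comb h Q m (chain_coeff Q i A) x * ?g x)
    = (-1) ^ length js
      * (LINT x|lebesgue. chain_comb h Q m (fold (chain_coeff Q) js (chain_coeff Q i A)) x * \<phi> x)"
    using Cons.prems by (intro Cons.IH[OF A']) simp
  finally show ?case by simp
qed simp

lemma chain_comb_locally_integrable:
  assumes A: "poly_coeffs l A"
  shows "locally_integrable U (chain_comb h Q m A)"
  unfolding locally_integrable_def
proof (intro allI impI)
  fix K :: "(real^'n) set" assume K: "compact K \<and> K \<subseteq> U"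
  then have "bounded K" by (simp add: compact_imp_bounded)
  then obtain r where r: "\<And>x. x \<in> K \<Longrightarrow> norm x \<le> r" unfolding bounded_iff by blast
  obtain B where B: "\<And>x. norm x \<le> r \<Longrightarrow> \<bar>chain_comb h Q m A x\<bar> \<le> B"
    using chain_comb_bounded[OF A] by blast
  have Km: "K \<in> sets borel" using K by (simp add: borel_compact)
  have "integrable lebesgue (\<lambda>x. indicat_real K x * chain_comb h Q m A x)"
  proof (rule integrable_if_bounded_support)
    show "(\<lambda>x. indicat_real K x * chain_comb h Q m A x) \<in> borel_measurable lebesgue"
      using chain_comb_measurable[OF A] Km
      by (intro measurable_completion) (simp add: borel_measurable_times)
    show "\<bar>indicat_real K x * chain_comb h Q m A x\<bar> \<le> B" if "norm x \<le> r" for x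
      using B[OF that] by (auto simp: indicator_def)
    show "indicat_real K x * chain_comb h Q m A x = 0" if "r < norm x" for x
      using r[of x] that by (auto simp: indicator_def)
  qed
  then show "chain_comb h Q m A absolutely_integrable_on K"
    by (simp add: set_integrable_def)
qed

lemma has_weak_deriv_chain_comb:
  assumes U: "open U" and js: "\<And>i. count_list js i = \<alpha> i" and le: "length js \<le> m"
  shows "has_weak_deriv U \<alpha> (\<lambda>x. h m (Q x))
    (chain_comb h Q m (fold (chain_coeff Q) js unit_coeffs))"
proof -
  let ?v = "chain_comb h Q m (fold (chain_coeff Q) js unit_coeffs)"
  have u: "(\<lambda>x. h m (Q x)) = chain_comb h Q m unit_coeffs"
  proof
    fix x
    have "chain_comb h Q m unit_coeffs x = (\<Sum>j\<in>{0}. (-1) ^ j * h (m - j) (Q x) * unit_coeffs j x)"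
      unfolding chain_comb_def by (rule sum.mono_neutral_right) (auto simp: unit_coeffs_def)
    then show "h m (Q x) = chain_comb h Q m unit_coeffs x" by (simp add: unit_coeffs_def)
  qed
  have A: "poly_coeffs (0 + length js) (fold (chain_coeff Q) js unit_coeffs)"
    by (rule poly_coeffs_fold[OF Q poly_coeffs_unit])
  show ?thesis
    unfolding has_weak_deriv_def u
  proof (intro conjI ballI allI impI)
    show "locally_integrable U (chain_comb h Q m unit_coeffs)"
      by (rule chain_comb_locally_integrable[OF poly_coeffs_unit])
    show "locally_integrable U ?v" by (rule chain_comb_locally_integrable[OF A])
    fix \<phi> ks assume \<phi>: "\<phi> \<in> test_functions U" and ks: "\<forall>i. count_list ks i = \<alpha> i"
    let ?K = "closure {x. \<phi> x \<noteq> 0}"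
    have sm: "\<And>k. Ck_on k UNIV \<phi>" and K: "compact ?K" "?K \<subseteq> U"
      using \<phi> unfolding test_functions_def by simp_all
    have out: "\<phi> x = 0" if "x \<notin> ?K" for x using subsetD[OF closure_subset, of x "{x. \<phi> x \<noteq> 0}"] that by (cases "\<phi> x = 0") simp_all
    obtain r where r: "\<And>x. x \<in> ?K \<Longrightarrow> norm x \<le> r"
      using compact_imp_bounded[OF K(1)] unfolding bounded_iff by (elim exE) (rule that, erule bspec)
    have supp: "\<phi> x = 0" if "r < norm x" for x
    proof (rule out)
      show "x \<notin> ?K" using r[of x] that by linarith
    qed
    have mset: "mset js = mset ks"
      by (rule multiset_eqI) (simp add: count_mset js ks[rule_format])
    have len: "length ks = length js" using mset by (rule mset_eq_length[symmetric])
    have restrict: "(LINT x|lebesgue_on U. g x * \<psi> x) = (LINT x|lebesgue. g x * \<psi> x)"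
      if "\<And>x. x \<notin> ?K \<Longrightarrow> \<psi> x = 0" for g \<psi> :: "real^'n \<Rightarrow> real"
    proof -
      have "(\<lambda>x. g x * \<psi> x) = (\<lambda>x. if x \<in> U then g x * \<psi> x else 0)"
      proof
        fix x show "g x * \<psi> x = (if x \<in> U then g x * \<psi> x else 0)"
        proof (cases "x \<in> U")
          case False
          then have "\<psi> x = 0" using that[of x] subsetD[OF K(2), of x] by blast
          then show ?thesis by simp
        qed simp
      qed
      then show ?thesis
        using Lebesgue_Measure.integral_restrict_UNIV[of U "\<lambda>x. g x * \<psi> x"] U
        by (simp add: borel_open)
    qed
    have "(LINT x|lebesgue_on U. chain_comb h Q m unit_coeffs x * partials ks \<phi> x)
        = (LINT x|lebesgue. chain_comb h Q m unit_coeffs x * partials ks \<phi> x)"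
      by (rule restrict) (rule partials_eq_0_outside[OF closed_closure out])
    also have "\<dots> = (-1) ^ length ks
        * (LINT x|lebesgue. chain_comb h Q m (fold (chain_coeff Q) ks unit_coeffs) x * \<phi> x)"
      by (rule integral_partials[OF sm supp poly_coeffs_unit]) (use len le in auto)
    also have "fold (chain_coeff Q) ks unit_coeffs = fold (chain_coeff Q) js unit_coeffs"
      by (rule fold_chain_coeff_permute[OF Q poly_coeffs_unit mset[symmetric]])
    also have "(LINT x|lebesgue. ?v x * \<phi> x) = (LINT x|lebesgue_on U. ?v x * \<phi> x)"
      by (rule restrict[symmetric]) (rule out)
    finally show "(LINT x|lebesgue_on U. chain_comb h Q m unit_coeffs x * partials ks \<phi> x)
        = (-1) ^ (\<Sum>i\<in>UNIV. \<alpha> i) * (LINT x|lebesgue_on U. ?v x * \<phi> x)"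
      using sum_count_list_eq_length[OF js] len by simp
  qed
qed

end

section \<open>Piecewise continuous functions and iterated primitives\<close>

text \<open>Boundedness is asked on half lines \<open>[L,\<infinity>)\<close> only, because iterated primitives taken from the
  right grow polynomially to the left.  Vanishing from some \<open>d < 1\<close> on, rather than from 1 on,
  makes the primitives differentiable at 1.\<close>

definition pw_cont :: "(real \<Rightarrow> real) \<Rightarrow> bool" where
  "pw_cont f \<longleftrightarrow> (\<exists>E. finite E \<and> (\<forall>t. t \<notin> E \<longrightarrow> isCont f t)) \<and> (\<exists>d<1. \<forall>t\<ge>d. f t = 0) \<and>
     (\<forall>L. \<exists>B. \<forall>t\<ge>L. \<bar>f t\<bar> \<le> B)"

definition tail_integral :: "(real \<Rightarrow> real) \<Rightarrow> real \<Rightarrow> real" where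
  "tail_integral f q = integral {q..1} f"

lemma pw_cont_measurable:
  assumes "pw_cont f" shows "f \<in> borel_measurable borel"
proof -
  obtain E where E: "finite E" "\<And>t. t \<notin> E \<Longrightarrow> isCont f t"
    using assms unfolding pw_cont_def by blast
  show ?thesis
  proof (rule borel_measurable_continuous_countable_exceptions)
    show "countable E" using E(1) by (rule countable_finite)
    show "continuous_on (- E) f"
      using E(2) by (intro continuous_at_imp_continuous_on) simp
  qed
qed

lemma pw_cont_set_integrable:
  assumes "pw_cont f" shows "set_integrable lborel {a..b} f"
proof -
  obtain B where B: "\<And>t. a \<le> t \<Longrightarrow> \<bar>f t\<bar> \<le> B" using assms unfolding pw_cont_def by blast
  have [measurable]: "f \<in> borel_measurable borel" by (rule pw_cont_measurable[OF assms])
  show ?thesis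
    unfolding set_integrable_def
  proof (rule Bochner_Integration.integrable_bound)
    show "integrable lborel (\<lambda>x. indicator {a..b} x *\<^sub>R B)"
      by (intro integrable_scaleR_left integrable_real_indicator)
        (auto simp: emeasure_lborel_Icc_eq)
    show "AE x in lborel. norm (indicat_real {a..b} x *\<^sub>R f x) \<le> norm (indicat_real {a..b} x *\<^sub>R B)"
    proof (rule AE_I2)
      fix x
      show "norm (indicat_real {a..b} x *\<^sub>R f x) \<le> norm (indicat_real {a..b} x *\<^sub>R B)"
        using B[of x] by (cases "x \<in> {a..b}") auto
    qed
  qed measurable
qed

lemma pw_cont_integrable_on: "pw_cont f \<Longrightarrow> f integrable_on {a..b}"
  using set_borel_integral_eq_integral(1)[OF pw_cont_set_integrable] .

lemma tail_integral_eq: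
  assumes f: "pw_cont f" and b: "1 \<le> b"
  shows "integral {q..b} f = tail_integral f q"
proof (cases "q \<le> 1")
  case True
  obtain d where d: "d < 1" "\<And>t. d \<le> t \<Longrightarrow> f t = 0" using f unfolding pw_cont_def by blast
  have "integral {1..b} f = integral {1..b} (\<lambda>_. 0)"
    using d by (intro Henstock_Kurzweil_Integration.integral_cong) simp
  then show ?thesis
    using Henstock_Kurzweil_Integration.integral_combine[OF True b pw_cont_integrable_on[OF f]]
    by (simp add: tail_integral_def)
next
  case False
  obtain d where d: "d < 1" "\<And>t. d \<le> t \<Longrightarrow> f t = 0" using f unfolding pw_cont_def by blast
  have "integral {q..b} f = integral {q..b} (\<lambda>_. 0)"
    using d False by (intro Henstock_Kurzweil_Integration.integral_cong) simp
  then show ?thesis using False by (simp add: tail_integral_def)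
qed

lemma tail_integral_diff:
  assumes f: "pw_cont f" and le: "p \<le> q"
  shows "tail_integral f p - tail_integral f q = integral {p..q} f"
proof -
  have "integral {p..q} f + integral {q..max 1 q} f = integral {p..max 1 q} f"
    by (intro Henstock_Kurzweil_Integration.integral_combine le pw_cont_integrable_on[OF f]) simp
  then show ?thesis using tail_integral_eq[OF f, of "max 1 q"] by simp
qed

lemma tail_integral_has_derivative:
  assumes f: "pw_cont f" and cont: "isCont f q"
  shows "(tail_integral f has_real_derivative - f q) (at q)"
proof -
  let ?a = "q - 1" and ?b = "q + 1"
  have "((\<lambda>u. integral {?a..u} f) has_vector_derivative f q) (at q within {?a..?b} - {})"
    by (rule integral_has_vector_derivative_continuous_at[OF pw_cont_integrable_on[OF f]])
      (use cont in \<open>auto intro: continuous_at_imp_continuous_within\<close>)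
  then have "((\<lambda>u. integral {?a..u} f) has_real_derivative f q) (at q)"
    by (simp add: has_real_derivative_iff_has_vector_derivative at_within_Icc_at)
  then have "((\<lambda>u. tail_integral f ?a - integral {?a..u} f) has_real_derivative 0 - f q) (at q)"
    by (intro DERIV_diff DERIV_const)
  then have "((\<lambda>u. tail_integral f ?a - integral {?a..u} f) has_real_derivative - f q) (at q)" by simp
  then show ?thesis
  proof (rule has_field_derivative_transform_within_open[where S="{?a<..}"])
    fix u assume "u \<in> {?a<..}"
    then show "tail_integral f ?a - integral {?a..u} f = tail_integral f u"
      using tail_integral_diff[OF f, of ?a u] by simp
  qed auto
qed

lemma tail_integral_lipschitz:
  assumes f: "pw_cont f" shows "loc_lipschitz (tail_integral f)"
  unfolding loc_lipschitz_def
proof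
  fix r
  obtain B where B: "\<And>t. - r \<le> t \<Longrightarrow> \<bar>f t\<bar> \<le> B" using f unfolding pw_cont_def by blast
  have key: "\<bar>tail_integral f x - tail_integral f y\<bar> \<le> B * (y - x)" if "- r \<le> x" "x \<le> y" for x y
  proof -
    have "norm (integral {x..y} f) \<le> integral {x..y} (\<lambda>_. B)"
      using that B by (intro integral_norm_bound_integral pw_cont_integrable_on[OF f]) auto
    then have "norm (integral {x..y} f) \<le> B * (y - x)" using that by (simp add: mult.commute)
    then show ?thesis using tail_integral_diff[OF f that(2)] by simp
  qed
  have B0: "0 \<le> B" using B[of "\<bar>r\<bar>"] by force
  have "B-lipschitz_on (cball 0 r) (tail_integral f)"
  proof (rule lipschitz_onI)
    fix x y :: real assume xy: "x \<in> cball 0 r" "y \<in> cball 0 r"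
    show "dist (tail_integral f x) (tail_integral f y) \<le> B * dist x y"
    proof (cases "x \<le> y")
      case True
      then show ?thesis using key[of x y] xy by (auto simp: dist_real_def)
    next
      case False
      then show ?thesis using key[of y x] xy by (auto simp: dist_real_def abs_minus_commute)
    qed
  qed (rule B0)
  then show "\<exists>L. L-lipschitz_on (cball 0 r) (tail_integral f)" by blast
qed

lemma tail_integral_isCont: "pw_cont f \<Longrightarrow> isCont (tail_integral f) t"
  using loc_lipschitz_continuous_on[OF tail_integral_lipschitz]
  by (simp add: continuous_on_eq_continuous_at)

lemma tail_integral_eq_0:
  assumes "\<And>t. d \<le> t \<Longrightarrow> f t = 0" "d \<le> q" shows "tail_integral f q = 0"
proof -
  have "integral {q..1} f = integral {q..1} (\<lambda>_. 0)"
    using assms by (intro Henstock_Kurzweil_Integration.integral_cong) simp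
  then show ?thesis by (simp add: tail_integral_def)
qed

lemma pw_cont_tail_integral:
  assumes f: "pw_cont f" shows "pw_cont (tail_integral f)"
proof -
  obtain d where d: "d < 1" "\<And>t. d \<le> t \<Longrightarrow> f t = 0" using f unfolding pw_cont_def by blast
  have "\<exists>B. \<forall>t\<ge>L. \<bar>tail_integral f t\<bar> \<le> B" for L
  proof -
    have "bounded (tail_integral f ` {L..1})"
      by (intro compact_imp_bounded compact_continuous_image continuous_at_imp_continuous_on)
        (auto intro: tail_integral_isCont[OF f])
    then obtain B where B: "\<forall>y\<in>tail_integral f ` {L..1}. norm y \<le> B" unfolding bounded_iff by blast
    have "\<bar>tail_integral f t\<bar> \<le> max B 0" if "L \<le> t" for t
    proof (cases "t \<le> 1")
      case True
      then have "norm (tail_integral f t) \<le> B" using B that by simp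
      then show ?thesis by simp
    qed (use tail_integral_eq_0[of d f t] d in auto)
    then show ?thesis by blast
  qed
  moreover have "tail_integral f t = 0" if "d \<le> t" for t
    using tail_integral_eq_0[of d f t] d that by blast
  ultimately show ?thesis
    unfolding pw_cont_def using tail_integral_isCont[OF f] d(1) by blast
qed

lemma tail_integral_le:
  assumes "pw_cont f" "g integrable_on {q..1}" "\<And>t. q \<le> t \<Longrightarrow> t \<le> 1 \<Longrightarrow> \<bar>f t\<bar> \<le> g t"
  shows "\<bar>tail_integral f q\<bar> \<le> integral {q..1} g"
  unfolding tail_integral_def real_norm_def[symmetric]
  by (rule integral_norm_bound_integral[OF pw_cont_integrable_on]) (use assms in auto)

lemma tail_integral_nonneg:
  assumes "pw_cont f" "\<And>t. 0 \<le> f t" shows "0 \<le> tail_integral f q"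
  unfolding tail_integral_def using assms by (intro integral_nonneg pw_cont_integrable_on) auto

lemma tail_integral_antimono:
  assumes f: "pw_cont f" and "\<And>t. 0 \<le> f t" and le: "p \<le> q"
  shows "tail_integral f q \<le> tail_integral f p"
proof -
  have "0 \<le> integral {p..q} f" using assms by (intro integral_nonneg pw_cont_integrable_on) auto
  then show ?thesis using tail_integral_diff[OF f le] by simp
qed

primrec iter_tail :: "(real \<Rightarrow> real) \<Rightarrow> nat \<Rightarrow> real \<Rightarrow> real" where
  "iter_tail f 0 = f"
| "iter_tail f (Suc j) = tail_integral (iter_tail f j)"

lemma pw_cont_iter_tail: "pw_cont f \<Longrightarrow> pw_cont (iter_tail f j)"
  by (induction j) (auto intro: pw_cont_tail_integral)

lemma iter_tail_nonneg: "pw_cont f \<Longrightarrow> (\<And>t. 0 \<le> f t) \<Longrightarrow> 0 \<le> iter_tail f j t"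
  by (induction j arbitrary: t) (auto intro: tail_integral_nonneg pw_cont_iter_tail)

lemma iter_tail_eq_0:
  "(\<And>t. d \<le> t \<Longrightarrow> f t = 0) \<Longrightarrow> d \<le> q \<Longrightarrow> iter_tail f j q = 0"
proof (induction j arbitrary: q)
  case (Suc j)
  show ?case unfolding iter_tail.simps
    by (rule tail_integral_eq_0[OF Suc.IH[OF Suc.prems(1)] Suc.prems(2)])
qed simp

lemma pw_cont_add: "pw_cont f \<Longrightarrow> pw_cont g \<Longrightarrow> pw_cont (\<lambda>t. f t + g t)"
proof -
  assume f: "pw_cont f" and g: "pw_cont g"
  obtain E where E: "finite E" "\<And>t. t \<notin> E \<Longrightarrow> isCont f t" using f unfolding pw_cont_def by blast
  obtain H where H: "finite H" "\<And>t. t \<notin> H \<Longrightarrow> isCont g t" using g unfolding pw_cont_def by blast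
  obtain d where d: "d < 1" "\<And>t. d \<le> t \<Longrightarrow> f t = 0" using f unfolding pw_cont_def by blast
  obtain c where c: "c < 1" "\<And>t. c \<le> t \<Longrightarrow> g t = 0" using g unfolding pw_cont_def by blast
  have "\<exists>B. \<forall>t\<ge>L. \<bar>f t + g t\<bar> \<le> B" for L
  proof -
    obtain B where B: "\<And>t. L \<le> t \<Longrightarrow> \<bar>f t\<bar> \<le> B" using f unfolding pw_cont_def by blast
    obtain C where C: "\<And>t. L \<le> t \<Longrightarrow> \<bar>g t\<bar> \<le> C" using g unfolding pw_cont_def by blast
    have "\<bar>f t + g t\<bar> \<le> B + C" if "L \<le> t" for t
      using B[OF that] C[OF that] by linarith
    then show ?thesis by blast
  qed
  moreover have "finite (E \<union> H)" "\<forall>t. t \<notin> E \<union> H \<longrightarrow> isCont (\<lambda>t. f t + g t) t"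
    using E H by auto
  moreover have "max c d < 1" "\<forall>t\<ge>max c d. f t + g t = 0" using c d by auto
  ultimately show ?thesis unfolding pw_cont_def by blast
qed

lemma pw_cont_cmult: "pw_cont f \<Longrightarrow> pw_cont (\<lambda>t. c * f t)"
proof -
  assume f: "pw_cont f"
  obtain E where E: "finite E" "\<And>t. t \<notin> E \<Longrightarrow> isCont f t" using f unfolding pw_cont_def by blast
  obtain d where d: "d < 1" "\<And>t. d \<le> t \<Longrightarrow> f t = 0" using f unfolding pw_cont_def by blast
  have "\<exists>B. \<forall>t\<ge>L. \<bar>c * f t\<bar> \<le> B" for L
  proof -
    obtain B where B: "\<And>t. L \<le> t \<Longrightarrow> \<bar>f t\<bar> \<le> B" using f unfolding pw_cont_def by blast
    have "\<bar>c * f t\<bar> \<le> \<bar>c\<bar> * B" if "L \<le> t" for t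
      using B[OF that] by (simp add: abs_mult mult_left_mono)
    then show ?thesis by blast
  qed
  moreover have "\<forall>t. t \<notin> E \<longrightarrow> isCont (\<lambda>t. c * f t) t" using E by auto
  ultimately show ?thesis unfolding pw_cont_def using E(1) d by (metis mult_zero_right)
qed

lemma iter_tail_add:
  assumes "pw_cont f" "pw_cont g"
  shows "iter_tail (\<lambda>t. f t + g t) j = (\<lambda>t. iter_tail f j t + iter_tail g j t)"
proof (induction j)
  case (Suc j)
  show ?case
    unfolding iter_tail.simps Suc tail_integral_def
    by (rule ext, rule Henstock_Kurzweil_Integration.integral_add)
      (intro pw_cont_integrable_on pw_cont_iter_tail assms)+
qed simp

lemma iter_tail_cmult:
  "iter_tail (\<lambda>t. c * f t) j = (\<lambda>t. c * iter_tail f j t)"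
  by (induction j) (simp_all add: tail_integral_def)

section \<open>Averages of dilations\<close>

text \<open>The Riemann sum is the integral of the step function \<open>r \<mapsto> g (\<lceil>N r\<rceil> / N)\<close> over \<open>(0,1]\<close>, which
  converges to \<open>g\<close> at every point of continuity.\<close>

lemma Riemann_sum_tendsto:
  fixes g :: "real \<Rightarrow> real"
  assumes E: "finite E" "\<And>t. t \<notin> E \<Longrightarrow> isCont g t" and B: "\<And>t. \<bar>g t\<bar> \<le> B"
  shows "(\<lambda>N. \<Sum>k=1..N. g (real k / real N) / real N) \<longlonglongrightarrow> integral {0..1} g"
proof -
  have g [measurable]: "g \<in> borel_measurable borel"
  proof (rule borel_measurable_continuous_countable_exceptions)
    show "countable E" using E(1) by (rule countable_finite)
    show "continuous_on (- E) g" using E(2) by (intro continuous_at_imp_continuous_on) simp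
  qed
  let ?S = "\<lambda>N k. {(real k - 1) / real N<..real k / real N}"
  define \<phi> where "\<phi> N r = (\<Sum>k=1..N. indicat_real (?S N k) r * g (real k / real N))" for N r
  have int: "(LINT r|lborel. \<phi> N r) = (\<Sum>k=1..N. g (real k / real N) / real N)" for N
  proof (cases "N = 0")
    case False
    have "(LINT r|lborel. \<phi> N r)
        = (\<Sum>k=1..N. (LINT r|lborel. indicat_real (?S N k) r * g (real k / real N)))"
      unfolding \<phi>_def by (intro Bochner_Integration.integral_sum) (auto simp: divide_right_mono)
    also have "\<dots> = (\<Sum>k=1..N. g (real k / real N) / real N)"
    proof (rule sum.cong)
      fix k
      have "measure lborel (?S N k) = 1 / real N"
        using False by (subst measure_lborel_Ioc) (auto simp: divide_right_mono field_simps)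
      then show "(LINT r|lborel. indicat_real (?S N k) r * g (real k / real N))
          = g (real k / real N) / real N" by simp
    qed simp
    finally show ?thesis .
  qed (simp add: \<phi>_def)
  have val: "\<phi> N r = g (of_int \<lceil>real N * r\<rceil> / real N)" if r: "0 < r" "r \<le> 1" and N: "0 < N" for N r
  proof -
    let ?k = "nat \<lceil>real N * r\<rceil>"
    have pos: "0 < real N * r" using r N by simp
    have le: "real N * r \<le> real N" using r N by simp
    have k: "real ?k = of_int \<lceil>real N * r\<rceil>" using pos by (simp add: of_nat_nat)
    have mem: "?k \<in> {1..N}" using pos le by (auto simp: Suc_le_eq ceiling_le_iff nat_le_iff)
    have iff: "r \<in> ?S N k \<longleftrightarrow> k = ?k" for k :: nat
    proof -
      have "r \<in> ?S N k \<longleftrightarrow> real k - 1 < real N * r \<and> real N * r \<le> real k"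
        using N by (auto simp: field_simps)
      also have "\<dots> \<longleftrightarrow> \<lceil>real N * r\<rceil> = int k" by (simp add: ceiling_eq_iff)
      also have "\<dots> \<longleftrightarrow> k = ?k" using pos by auto
      finally show ?thesis .
    qed
    have "\<phi> N r = (\<Sum>k=1..N. if k = ?k then g (real k / real N) else 0)"
      unfolding \<phi>_def by (intro sum.cong) (auto simp: indicator_def iff simp del: greaterThanAtMost_iff)
    also have "\<dots> = g (real ?k / real N)" using mem by simp
    finally show ?thesis unfolding k .
  qed
  have out: "\<phi> N r = 0" if "r \<le> 0 \<or> r > 1" for N r
    unfolding \<phi>_def
  proof (rule sum.neutral, rule ballI)
    fix k assume k: "k \<in> {1..N}"
    have "0 \<le> (real k - 1) / real N" "real k / real N \<le> 1" using k by auto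
    then have "r \<notin> ?S N k" using that by auto
    then show "indicat_real (?S N k) r * g (real k / real N) = 0" by (simp add: indicator_def)
  qed
  have "(\<lambda>N. LINT r|lborel. \<phi> N r) \<longlonglongrightarrow> (LINT r|lborel. indicat_real {0..1} r * g r)"
  proof (rule integral_dominated_convergence)
    show "integrable lborel (\<lambda>r::real. indicat_real {0..1} r * B)"
      by (intro integrable_mult_left integrable_real_indicator) auto
    show "AE r in lborel. (\<lambda>N. \<phi> N r) \<longlonglongrightarrow> indicat_real {0..1} r * g r"
    proof -
      have "AE r in lborel. r \<notin> insert 0 E"
        using E(1) by (intro AE_not_in countable_imp_null_set_lborel) (auto intro: countable_finite)
      then show ?thesis
      proof eventually_elim
        case (elim r)
        show ?case
        proof (cases "0 < r \<and> r \<le> 1")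
          case True
          have "(\<lambda>N. of_int \<lceil>real N * r\<rceil> / real N) \<longlonglongrightarrow> r"
          proof (rule tendsto_sandwich)
            show "eventually (\<lambda>N. r \<le> of_int \<lceil>real N * r\<rceil> / real N) sequentially"
              using eventually_gt_at_top[of 0]
              by eventually_elim (simp add: pos_le_divide_eq mult.commute)
            show "eventually (\<lambda>N. of_int \<lceil>real N * r\<rceil> / real N \<le> r + inverse (real N)) sequentially"
              using eventually_gt_at_top[of 0]
            proof eventually_elim
              case (elim N)
              have "of_int \<lceil>real N * r\<rceil> \<le> real N * r + 1" by linarith
              also have "\<dots> = (r + inverse (real N)) * real N" using elim by (simp add: field_simps)
              finally show ?case using elim by (simp add: pos_divide_le_eq)
            qed
            have "(\<lambda>N. r + inverse (real N)) \<longlonglongrightarrow> r + 0" by (intro tendsto_intros lim_inverse_n)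
            then show "(\<lambda>N. r + inverse (real N)) \<longlonglongrightarrow> r" by simp
          qed simp
          then have "(\<lambda>N. g (of_int \<lceil>real N * r\<rceil> / real N)) \<longlonglongrightarrow> g r"
            using E(2)[of r] elim by (intro isCont_tendsto_compose[of r g]) auto
          moreover have "eventually (\<lambda>N. g (of_int \<lceil>real N * r\<rceil> / real N) = \<phi> N r) sequentially"
            using eventually_gt_at_top[of 0] by eventually_elim (use val True in auto)
          ultimately show ?thesis using True Lim_transform_eventually by fastforce
        next
          case False
          then have "r \<le> 0 \<or> r > 1" by auto
          then show ?thesis using elim out by (auto simp: indicator_def)
        qed
      qed
    qed
    show "AE r in lborel. norm (\<phi> N r) \<le> indicat_real {0..1} r * B" for N
    proof (rule AE_I2)
      fix r
      show "norm (\<phi> N r) \<le> indicat_real {0..1} r * B"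
      proof (cases "0 < r \<and> r \<le> 1 \<and> 0 < N")
        case True
        then show ?thesis using val B by auto
      next
        case False
        then have "\<phi> N r = 0" using out by (cases "N = 0") (auto simp: \<phi>_def not_less not_le)
        moreover have "0 \<le> B" using B[of 0] by linarith
        ultimately show ?thesis by simp
      qed
    qed
    show "\<phi> N \<in> borel_measurable lborel" for N unfolding \<phi>_def[abs_def] by measurable
  qed measurable
  moreover have "(LINT r|lborel. indicat_real {0..1} r * g r) = integral {0..1} g"
  proof -
    have "set_integrable lborel {0..1} g"
      unfolding set_integrable_def
    proof (rule Bochner_Integration.integrable_bound)
      show "integrable lborel (\<lambda>x. indicator {0..1::real} x *\<^sub>R B)"
        by (intro integrable_scaleR_left integrable_real_indicator) auto
      show "AE x in lborel. norm (indicat_real {0..1} x *\<^sub>R g x) \<le> norm (indicat_real {0..1} x *\<^sub>R B)"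
      proof (rule AE_I2)
        fix x
        show "norm (indicat_real {0..1} x *\<^sub>R g x) \<le> norm (indicat_real {0..1} x *\<^sub>R B)"
          using B[of x] by (cases "x \<in> {0..1}") auto
      qed
    qed measurable
    from set_borel_integral_eq_integral(2)[OF this] show ?thesis
      by (simp add: set_lebesgue_integral_def)
  qed
  ultimately show ?thesis unfolding int by simp
qed

text \<open>Vanishing on \<open>(-\<infinity>,\<delta>]\<close> keeps negative powers of the variable bounded on the support.\<close>

definition pw_cont_pos :: "(real \<Rightarrow> real) \<Rightarrow> bool" where
  "pw_cont_pos f \<longleftrightarrow> pw_cont f \<and> (\<exists>\<delta>>0. \<forall>t\<le>\<delta>. f t = 0)"

definition sqrt_profile :: "real \<Rightarrow> (real \<Rightarrow> real) \<Rightarrow> real \<Rightarrow> real" where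
  "sqrt_profile \<kappa> f p = p powr \<kappa> * f (sqrt p)"

lemma pw_cont_pos_bounded:
  assumes "pw_cont_pos f" shows "\<exists>B. \<forall>t. \<bar>f t\<bar> \<le> B"
proof -
  obtain B where B: "\<And>t. 0 \<le> t \<Longrightarrow> \<bar>f t\<bar> \<le> B"
    using assms unfolding pw_cont_pos_def pw_cont_def by blast
  obtain \<delta> where \<delta>: "0 < \<delta>" "\<And>t. t \<le> \<delta> \<Longrightarrow> f t = 0"
    using assms unfolding pw_cont_pos_def by blast
  have "\<bar>f t\<bar> \<le> B" for t
  proof (cases "0 \<le> t")
    case False
    then have "f t = 0" using \<delta> by simp
    then show ?thesis using B[of 0] by simp
  qed (rule B)
  then show ?thesis by blast
qed

lemma pw_cont_pos_abs: "pw_cont_pos f \<Longrightarrow> pw_cont_pos (\<lambda>t. \<bar>f t\<bar>)"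
proof -
  assume f: "pw_cont_pos f"
  obtain E where E: "finite E" "\<And>t. t \<notin> E \<Longrightarrow> isCont f t"
    using f unfolding pw_cont_pos_def pw_cont_def by blast
  have "\<forall>t. t \<notin> E \<longrightarrow> isCont (\<lambda>t. \<bar>f t\<bar>) t" using E(2) by auto
  with E(1) f show ?thesis unfolding pw_cont_pos_def pw_cont_def abs_abs abs_eq_0 by blast
qed

lemma pw_cont_sqrt_profile:
  assumes f: "pw_cont_pos f" and \<kappa>: "\<kappa> \<le> 0"
  shows "pw_cont (sqrt_profile \<kappa> f)"
proof -
  obtain E where E: "finite E" "\<And>t. t \<notin> E \<Longrightarrow> isCont f t"
    using f unfolding pw_cont_pos_def pw_cont_def by blast
  obtain d where d: "d < 1" "\<And>t. d \<le> t \<Longrightarrow> f t = 0"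
    using f unfolding pw_cont_pos_def pw_cont_def by blast
  obtain \<delta> where \<delta>: "0 < \<delta>" "\<And>t. t \<le> \<delta> \<Longrightarrow> f t = 0"
    using f unfolding pw_cont_pos_def by blast
  obtain B where B: "\<And>t. \<bar>f t\<bar> \<le> B" using pw_cont_pos_bounded[OF f] by blast
  let ?H = "insert 0 ((\<lambda>e. e\<^sup>2) ` E)"
  have "isCont (sqrt_profile \<kappa> f) p" if p: "p \<notin> ?H" for p
  proof (cases "p < 0")
    case True
    have "eventually (\<lambda>x. x \<in> {..<0}) (nhds p)" using True by (intro eventually_nhds_in_open) auto
    then have "eventually (\<lambda>x. sqrt_profile \<kappa> f x = 0) (nhds p)"
    proof eventually_elim
      case (elim x)
      then have "sqrt x \<le> \<delta>" using \<delta>(1) by (smt (verit) lessThan_iff real_sqrt_lt_0_iff)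
      then show ?case using \<delta>(2) by (simp add: sqrt_profile_def)
    qed
    then have "isCont (sqrt_profile \<kappa> f) p = isCont (\<lambda>_. 0::real) p" by (rule isCont_cong)
    then show ?thesis by simp
  next
    case False
    then have "p > 0" using p by auto
    have "sqrt p \<notin> E"
    proof
      assume "sqrt p \<in> E"
      then have "(sqrt p)\<^sup>2 \<in> (\<lambda>e. e\<^sup>2) ` E" by (rule imageI)
      then show False using p \<open>p > 0\<close> by simp
    qed
    then have "isCont (\<lambda>p. f (sqrt p)) p"
      using E(2) by (intro isCont_o2[where g=f and f=sqrt]) (auto intro: isCont_real_sqrt)
    moreover have "isCont (\<lambda>p. p powr \<kappa>) p" using \<open>p > 0\<close> by (intro continuous_intros) auto
    ultimately show ?thesis unfolding sqrt_profile_def[abs_def] by (intro continuous_mult)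
  qed
  moreover have "(max d 0)\<^sup>2 < 1" using d(1) by (simp add: power_less_one_iff max_def)
  moreover have "sqrt_profile \<kappa> f t = 0" if "(max d 0)\<^sup>2 \<le> t" for t
  proof -
    have "max d 0 \<le> sqrt t" using that by (intro real_le_rsqrt) auto
    then show ?thesis using d(2) by (simp add: sqrt_profile_def)
  qed
  moreover have "\<bar>sqrt_profile \<kappa> f t\<bar> \<le> (\<delta>\<^sup>2) powr \<kappa> * B" for t
  proof (cases "\<delta>\<^sup>2 \<le> t")
    case True
    have "t powr \<kappa> \<le> (\<delta>\<^sup>2) powr \<kappa>" using True \<delta>(1) \<kappa> by (intro powr_mono2') auto
    then show ?thesis using B[of "sqrt t"] unfolding sqrt_profile_def abs_mult
      by (intro mult_mono) auto
  next
    case False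
    then have "sqrt t \<le> \<delta>" using \<delta>(1) by (intro real_le_lsqrt) auto
    then have "sqrt_profile \<kappa> f t = 0" using \<delta>(2) by (simp add: sqrt_profile_def)
    moreover have "0 \<le> B" using B[of 0] by linarith
    ultimately show ?thesis by simp
  qed
  moreover have "finite ?H" using E(1) by simp
  ultimately show ?thesis unfolding pw_cont_def by blast
qed

text \<open>At \<open>q = s\<^sup>2\<close> this is \<open>2 \<integral>\<^sub>s\<^sup>1 |f(t)| t\<^sup>-\<^sup>2 dt\<close>, written in the variable \<open>p = t\<^sup>2\<close>.\<close>

definition weighted_tail :: "(real \<Rightarrow> real) \<Rightarrow> real \<Rightarrow> real" where
  "weighted_tail f = tail_integral (sqrt_profile (-3/2) (\<lambda>t. \<bar>f t\<bar>))"

lemma pw_cont_weight: "pw_cont_pos f \<Longrightarrow> pw_cont (sqrt_profile (-3/2) (\<lambda>t. \<bar>f t\<bar>))"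
  by (intro pw_cont_sqrt_profile pw_cont_pos_abs) auto

lemma weighted_tail_nonneg: "pw_cont_pos f \<Longrightarrow> 0 \<le> weighted_tail f q"
  unfolding weighted_tail_def
  by (intro tail_integral_nonneg pw_cont_weight) (auto simp: sqrt_profile_def)

lemma weighted_tail_antimono: "pw_cont_pos f \<Longrightarrow> p \<le> q \<Longrightarrow> weighted_tail f q \<le> weighted_tail f p"
  unfolding weighted_tail_def
  by (intro tail_integral_antimono pw_cont_weight) (auto simp: sqrt_profile_def)

text \<open>A negative power of \<open>p\<close> is largest at the left end of the interval of integration, and so is
  the weighted tail.  At the first primitive the power \<open>p\<^bsup>e-m+3/2\<^esup>\<close> is pulled out, at the
  later ones the weighted tail; the remaining power is integrable at infinity because its exponent
  stays below \<open>-1\<close> by at least \<open>1/2 - e\<close>.\<close>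

lemma iter_tail_bound:
  assumes f: "pw_cont_pos f" and e: "0 < e" "e < 1/2"
    and i: "i + 2 \<le> m" and q: "0 < q"
  shows "\<bar>iter_tail (sqrt_profile (e - real m) f) (Suc i) q\<bar>
    \<le> (1 / (1/2 - e)) ^ i * (q powr (e - (real m - real (Suc i)) + 1/2) * weighted_tail f q)"
  using i q
proof (induction i arbitrary: q)
  case 0
  let ?F = "sqrt_profile (e - real m) f" and ?G = "sqrt_profile (-3/2) (\<lambda>t. \<bar>f t\<bar>)"
  have F: "pw_cont ?F" using 0 e by (intro pw_cont_sqrt_profile f) auto
  have G: "pw_cont ?G" by (rule pw_cont_weight[OF f])
  let ?c = "q powr (e - real m + 3/2)"
  have "\<bar>tail_integral ?F q\<bar> \<le> integral {q..1} (\<lambda>t. ?c * ?G t)"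
  proof (rule tail_integral_le[OF F])
    show "(\<lambda>t. ?c * ?G t) integrable_on {q..1}"
      by (intro pw_cont_integrable_on pw_cont_cmult G)
    fix t assume t: "q \<le> t" "t \<le> 1"
    have "t powr (e - real m) = t powr (e - real m + 3/2) * t powr (-3/2)"
      by (simp add: powr_add[symmetric])
    also have "\<dots> \<le> ?c * t powr (-3/2)"
      using t 0 e by (intro mult_right_mono powr_mono2') auto
    finally show "\<bar>?F t\<bar> \<le> ?c * ?G t"
      by (simp add: sqrt_profile_def abs_mult mult.assoc[symmetric] mult_right_mono)
  qed
  also have "\<dots> = ?c * weighted_tail f q" by (simp add: weighted_tail_def tail_integral_def)
  finally show ?case by (simp add: algebra_simps)
next
  case (Suc i)
  let ?F = "iter_tail (sqrt_profile (e - real m) f) (Suc i)"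
  have F: "pw_cont ?F" using Suc.prems e by (intro pw_cont_iter_tail pw_cont_sqrt_profile f) auto
  let ?K = "1 / (1/2 - e)" and ?Z = "weighted_tail f"
  define \<mu> where "\<mu> = real m - real (Suc i) - 3/2 - e"
  have \<mu>: "1/2 - e \<le> \<mu>" using Suc.prems by (simp add: \<mu>_def)
  have \<mu>0: "0 < \<mu>" using \<mu> e by simp
  have K0: "0 \<le> ?K" using e by simp
  have pw: "e - (real m - real (Suc i)) + 1/2 = - \<mu> - 1" by (simp add: \<mu>_def)
  show ?case
  proof (cases "q \<le> 1")
    case False
    have "tail_integral ?F q = 0" using False by (simp add: tail_integral_def)
    then show ?thesis using K0 weighted_tail_nonneg[OF f, of q] by simp
  next
    case True
    have hi: "((\<lambda>t. t powr (- \<mu> - 1)) has_integral (- (1 powr - \<mu>) / \<mu> - (- (q powr - \<mu>) / \<mu>))) {q..1}"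
    proof (rule fundamental_theorem_of_calculus[OF True])
      fix t assume t: "t \<in> {q..1}"
      have "((\<lambda>t. - (t powr - \<mu>) / \<mu>) has_real_derivative t powr (- \<mu> - 1)) (at t)"
        using t Suc.prems \<mu>0 by (auto intro!: derivative_eq_intros)
      then show "((\<lambda>t. - (t powr - \<mu>) / \<mu>) has_vector_derivative t powr (- \<mu> - 1)) (at t within {q..1})"
        by (simp add: has_real_derivative_iff_has_vector_derivative has_vector_derivative_at_within)
    qed
    let ?c = "?K ^ i * ?Z q"
    have c0: "0 \<le> ?c" using K0 weighted_tail_nonneg[OF f, of q] by simp
    have "\<bar>tail_integral ?F q\<bar> \<le> integral {q..1} (\<lambda>t. ?c * t powr (- \<mu> - 1))"
    proof (rule tail_integral_le[OF F])
      show "(\<lambda>t. ?c * t powr (- \<mu> - 1)) integrable_on {q..1}"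
        using has_integral_mult_right[OF hi, of ?c] by blast
      fix t assume t: "q \<le> t" "t \<le> 1"
      have "\<bar>?F t\<bar> \<le> ?K ^ i * (t powr (- \<mu> - 1) * ?Z t)"
        using Suc.IH[of t] Suc.prems t unfolding pw by simp
      also have "\<dots> \<le> ?K ^ i * (t powr (- \<mu> - 1) * ?Z q)"
        using K0 weighted_tail_antimono[OF f t(1)] by (intro mult_left_mono) auto
      finally show "\<bar>?F t\<bar> \<le> ?c * t powr (- \<mu> - 1)" by (simp add: mult_ac)
    qed
    also have "\<dots> = ?c * ((q powr - \<mu> - 1) / \<mu>)"
      using integral_unique[OF hi] by (simp add: diff_divide_distrib)
    also have "\<dots> \<le> ?c * (?K * q powr - \<mu>)"
    proof (intro mult_left_mono c0)
      have "(q powr - \<mu> - 1) / \<mu> \<le> q powr - \<mu> / \<mu>" using \<mu>0 by (simp add: divide_right_mono)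
      also have "\<dots> \<le> q powr - \<mu> / (1/2 - e)" using \<mu> e by (intro divide_left_mono) auto
      finally show "(q powr - \<mu> - 1) / \<mu> \<le> ?K * q powr - \<mu>" by simp
    qed
    also have "\<dots> = ?K ^ Suc i * (q powr - \<mu> * ?Z q)" by simp
    also have "- \<mu> = e - (real m - real (Suc (Suc i))) + 1/2" by (simp add: \<mu>_def)
    finally show ?thesis by simp
  qed
qed

text \<open>This is the substitution \<open>r = s / \<surd>p\<close>; the integrand vanishes for \<open>r \<le> s\<close>.\<close>

lemma weighted_tail_eq_average:
  assumes f: "pw_cont_pos f" and s: "0 < s" "s < 1"
  shows "integral {0..1} (\<lambda>r. \<bar>f (s / r)\<bar>) = s / 2 * weighted_tail f (s\<^sup>2)"
proof -
  let ?G = "sqrt_profile (-3/2) (\<lambda>t. \<bar>f t\<bar>)"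
  have G: "pw_cont ?G" by (rule pw_cont_weight[OF f])
  obtain E where E: "finite E" "\<And>t. t \<notin> E \<Longrightarrow> isCont ?G t" using G unfolding pw_cont_def by blast
  obtain d where d: "d < 1" "\<And>t. d \<le> t \<Longrightarrow> f t = 0"
    using f unfolding pw_cont_pos_def pw_cont_def by blast
  have f0: "f 0 = 0" using f unfolding pw_cont_pos_def by auto
  let ?\<Phi> = "\<lambda>r. s / 2 * weighted_tail f ((s / r)\<^sup>2)"
  have "((\<lambda>r. \<bar>f (s / r)\<bar>) has_integral (?\<Phi> 1 - ?\<Phi> s)) {s..1}"
  proof (rule fundamental_theorem_of_calculus_interior_strong)
    show "finite ((\<lambda>e. s / sqrt e) ` E)" using E(1) by simp
    show "s \<le> 1" using s by simp
    fix r assume r: "r \<in> {s<..<1} - (\<lambda>e. s / sqrt e) ` E"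
    then have r0: "0 < r" using s by auto
    have "(s / r)\<^sup>2 \<notin> E"
    proof
      assume "(s / r)\<^sup>2 \<in> E"
      then have "s / sqrt ((s / r)\<^sup>2) \<in> (\<lambda>e. s / sqrt e) ` E" by (rule imageI)
      then show False using r r0 s by simp
    qed
    then have "(weighted_tail f has_real_derivative - ?G ((s / r)\<^sup>2)) (at ((s / r)\<^sup>2))"
      unfolding weighted_tail_def using E(2) by (intro tail_integral_has_derivative G)
    moreover have "((\<lambda>r. (s / r)\<^sup>2) has_real_derivative - 2 * s\<^sup>2 / r ^ 3) (at r)"
      using r0 by (auto intro!: derivative_eq_intros simp: power2_eq_square power3_eq_cube field_simps)
    ultimately have "(?\<Phi> has_real_derivative s / 2 * (- ?G ((s / r)\<^sup>2) * (- 2 * s\<^sup>2 / r ^ 3))) (at r)"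
      by (intro DERIV_cmult DERIV_chain2)
    moreover have "s / 2 * (- ?G ((s / r)\<^sup>2) * (- 2 * s\<^sup>2 / r ^ 3)) = \<bar>f (s / r)\<bar>"
    proof -
      have sr: "0 < s / r" using s r0 by simp
      have "(s / r)\<^sup>2 = (s / r) powr 2" using sr by (simp add: powr_numeral)
      then have "((s / r)\<^sup>2) powr (-3/2) = (s / r) powr (2 * (-3/2))"
        by (simp only: powr_powr)
      also have "\<dots> = (s / r) powr - 3" by simp
      also have "\<dots> = (r / s) ^ 3"
        using sr by (simp add: powr_minus powr_numeral power_divide inverse_eq_divide)
      finally have pw: "((s / r)\<^sup>2) powr (-3/2) = (r / s) ^ 3" .
      have sq: "sqrt ((s / r)\<^sup>2) = s / r" using sr unfolding real_sqrt_abs by (rule abs_of_pos)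
      have "s / 2 * (- ((r / s) ^ 3 * F) * (- 2 * s\<^sup>2 / r ^ 3)) = F" for F
        using s(1) r0 by (simp add: power_divide field_simps eval_nat_numeral)
      then show ?thesis unfolding sqrt_profile_def pw sq .
    qed
    ultimately have "(?\<Phi> has_real_derivative \<bar>f (s / r)\<bar>) (at r)" by (simp only:)
    then show "(?\<Phi> has_vector_derivative \<bar>f (s / r)\<bar>) (at r)"
      unfolding has_real_derivative_iff_has_vector_derivative .
  next
    have "continuous_on UNIV (weighted_tail f)"
      unfolding weighted_tail_def by (rule loc_lipschitz_continuous_on[OF tail_integral_lipschitz[OF G]])
    moreover have "continuous_on {s..1} (\<lambda>r. (s / r)\<^sup>2)"
      by (intro continuous_on_power continuous_on_divide continuous_on_const continuous_on_id)
        (use s in auto)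
    ultimately have "continuous_on {s..1} (\<lambda>r. weighted_tail f ((s / r)\<^sup>2))"
      by (rule continuous_on_compose2) simp
    then show "continuous_on {s..1} ?\<Phi>" by (intro continuous_on_mult continuous_on_const)
  qed
  moreover have "?\<Phi> 1 - ?\<Phi> s = ?\<Phi> 1"
    using s by (simp add: weighted_tail_def tail_integral_def)
  ultimately have "((\<lambda>r. \<bar>f (s / r)\<bar>) has_integral ?\<Phi> 1) {s..1}" by (simp only:)
  moreover have "((\<lambda>r. \<bar>f (s / r)\<bar>) has_integral 0) {0..s}"
  proof (rule has_integral_is_0)
    fix r assume r: "r \<in> {0..s}"
    show "\<bar>f (s / r)\<bar> = 0"
    proof (cases "r = 0")
      case False
      then have "1 \<le> s / r" using r by simp
      then show ?thesis using d by simp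
    qed (simp add: f0)
  qed
  ultimately have "((\<lambda>r. \<bar>f (s / r)\<bar>) has_integral 0 + ?\<Phi> 1) {0..1}"
    using s by (intro has_integral_combine[of 0 s 1]) simp_all
  from integral_unique[OF this] show ?thesis by simp
qed

text \<open>The left-hand function is twice the average of the dilations \<open>|f(s/r)|\<close> over \<open>0 < r < 1\<close>.  Its
  Riemann sums are finite averages of functions with norm at most that of \<open>f\<close>, and the Fatou
  property passes the bound to the limit.\<close>

lemma ri_norm_weighted_tail_le:
  assumes N: "ri_function_norm N" and f: "pw_cont_pos f"
  shows "N (\<lambda>s. ennreal (s * weighted_tail f (s\<^sup>2))) \<le> 2 * N (\<lambda>s. ennreal \<bar>f s\<bar>)"
proof -
  have fp: "pw_cont f" using f by (simp add: pw_cont_pos_def)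
  have [measurable]: "f \<in> borel_measurable borel" by (rule pw_cont_measurable[OF fp])
  have [measurable]: "weighted_tail f \<in> borel_measurable borel"
    unfolding weighted_tail_def by (intro pw_cont_measurable pw_cont_tail_integral pw_cont_weight f)
  obtain E where E: "finite E" "\<And>t. t \<notin> E \<Longrightarrow> isCont f t" using fp unfolding pw_cont_def by blast
  obtain d where d: "d < 1" "\<And>t. d \<le> t \<Longrightarrow> f t = 0" using fp unfolding pw_cont_def by blast
  obtain B where B: "\<And>t. \<bar>f t\<bar> \<le> B" using pw_cont_pos_bounded[OF f] by blast
  let ?D = "\<lambda>k K s. ennreal \<bar>f (s / (real k / real K))\<bar>"
  let ?F = "\<lambda>K s. \<Sum>k=1..K. ennreal (2 / real K) * ?D k K s"
  show ?thesis
  proof (rule ri_norm_Fatou[OF N])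
    show "?F K \<in> borel_measurable unit_ivl" for K
      by (rule borel_measurable_unit_ivl) measurable
    show "(\<lambda>s. ennreal (s * weighted_tail f (s\<^sup>2))) \<in> borel_measurable unit_ivl"
      by (rule borel_measurable_unit_ivl) measurable
    fix s :: real assume s: "0 < s" "s < 1"
    have "(\<lambda>K. \<Sum>k=1..K. \<bar>f (s / (real k / real K))\<bar> / real K)
        \<longlonglongrightarrow> integral {0..1} (\<lambda>r. \<bar>f (s / r)\<bar>)"
    proof (rule Riemann_sum_tendsto)
      show "finite (insert 0 ((\<lambda>e. s / e) ` E))" using E(1) by simp
      show "\<bar>\<bar>f (s / t)\<bar>\<bar> \<le> B" for t using B by simp
      fix r assume r: "r \<notin> insert 0 ((\<lambda>e. s / e) ` E)"
      then have "r \<noteq> 0" by simp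
      have "s / r \<notin> E"
      proof
        assume "s / r \<in> E"
        then have "s / (s / r) \<in> (\<lambda>e. s / e) ` E" by (rule imageI)
        then show False using r s by simp
      qed
      then have "isCont (\<lambda>r. f (s / r)) r"
        using E(2) \<open>r \<noteq> 0\<close> by (intro isCont_o2[where g=f and f="\<lambda>r. s / r"]) (auto intro!: continuous_intros)
      then show "isCont (\<lambda>r. \<bar>f (s / r)\<bar>) r" by (intro continuous_intros)
    qed
    then have "(\<lambda>K. 2 * (\<Sum>k=1..K. \<bar>f (s / (real k / real K))\<bar> / real K))
        \<longlonglongrightarrow> 2 * (s / 2 * weighted_tail f (s\<^sup>2))"
      unfolding weighted_tail_eq_average[OF f s] by (intro tendsto_mult tendsto_const)
    then have "(\<lambda>K. ennreal (2 * (\<Sum>k=1..K. \<bar>f (s / (real k / real K))\<bar> / real K)))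
        \<longlonglongrightarrow> ennreal (s * weighted_tail f (s\<^sup>2))"
      by (intro tendsto_ennrealI) simp
    moreover have "ennreal (2 * (\<Sum>k=1..K. \<bar>f (s / (real k / real K))\<bar> / real K)) = ?F K s" for K
    proof -
      have "2 * (\<Sum>k=1..K. \<bar>f (s / (real k / real K))\<bar> / real K)
          = (\<Sum>k=1..K. 2 / real K * \<bar>f (s / (real k / real K))\<bar>)"
        by (simp add: sum_distrib_left)
      also have "ennreal \<dots> = (\<Sum>k=1..K. ennreal (2 / real K * \<bar>f (s / (real k / real K))\<bar>))"
        by (rule sum_ennreal[symmetric]) simp
      also have "\<dots> = ?F K s" by (intro sum.cong refl ennreal_mult) auto
      finally show ?thesis .
    qed
    ultimately show "(\<lambda>K. ?F K s) \<longlonglongrightarrow> ennreal (s * weighted_tail f (s\<^sup>2))" by simp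
  next
    fix K :: nat
    have "N (?F K) \<le> (\<Sum>k=1..K. N (\<lambda>s. ennreal (2 / real K) * ?D k K s))"
      by (intro ri_norm_sum[OF N] borel_measurable_unit_ivl) (measurable)
    also have "\<dots> \<le> (\<Sum>k=1..K. ennreal (2 / real K) * N (\<lambda>s. ennreal \<bar>f s\<bar>))"
    proof (rule sum_mono)
      fix k assume k: "k \<in> {1..K}"
      have "N (\<lambda>s. ennreal (2 / real K) * ?D k K s) = ennreal (2 / real K) * N (?D k K)"
        by (intro ri_norm_scale[OF N] borel_measurable_unit_ivl) auto
      also have "\<dots> \<le> ennreal (2 / real K) * N (\<lambda>s. ennreal \<bar>f s\<bar>)"
        using k d by (intro mult_left_mono ri_norm_dilation_le[OF N]) auto
      finally show "N (\<lambda>s. ennreal (2 / real K) * ?D k K s)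
          \<le> ennreal (2 / real K) * N (\<lambda>s. ennreal \<bar>f s\<bar>)" .
    qed
    also have "\<dots> \<le> 2 * N (\<lambda>s. ennreal \<bar>f s\<bar>)"
    proof (cases "K = 0")
      case False
      have "(of_nat K :: ennreal) * ennreal (2 / real K) = ennreal (real K * (2 / real K))"
        by (subst ennreal_mult) (auto simp: ennreal_of_nat_eq_real_of_nat)
      also have "\<dots> = 2" using False by simp
      finally show ?thesis by (simp add: mult.assoc[symmetric])
    qed simp
    finally show "N (?F K) \<le> 2 * N (\<lambda>s. ennreal \<bar>f s\<bar>)" .
  qed
qed

section \<open>Step profiles\<close>

abbreviation step :: "real \<Rightarrow> real \<Rightarrow> real \<Rightarrow> real" where
  "step c a \<equiv> (\<lambda>t. c * indicator {a / 2<..<a} t)"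

lemma pw_cont_pos_step:
  assumes a: "0 < a" "a < 1" shows "pw_cont_pos (step c a)"
proof -
  have "isCont (step c a) t" if "t \<notin> {a / 2, a}" for t
  proof -
    consider "t < a / 2" | "a / 2 < t" "t < a" | "a < t" using \<open>t \<notin> {a / 2, a}\<close> by force
    then show ?thesis
    proof cases
      case 1
      have "eventually (\<lambda>x. x \<in> {..<a / 2}) (nhds t)" using 1 by (intro eventually_nhds_in_open) auto
      then have "eventually (\<lambda>x. step c a x = 0) (nhds t)" by eventually_elim auto
      then have "isCont (step c a) t = isCont (\<lambda>_. 0::real) t" by (rule isCont_cong)
      then show ?thesis by simp
    next
      case 2
      have "eventually (\<lambda>x. x \<in> {a / 2<..<a}) (nhds t)" using 2 by (intro eventually_nhds_in_open) auto
      then have "eventually (\<lambda>x. step c a x = c) (nhds t)" by eventually_elim auto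
      then have "isCont (step c a) t = isCont (\<lambda>_. c) t" by (rule isCont_cong)
      then show ?thesis by simp
    next
      case 3
      have "eventually (\<lambda>x. x \<in> {a<..}) (nhds t)" using 3 by (intro eventually_nhds_in_open) auto
      then have "eventually (\<lambda>x. step c a x = 0) (nhds t)" by eventually_elim auto
      then have "isCont (step c a) t = isCont (\<lambda>_. 0::real) t" by (rule isCont_cong)
      then show ?thesis by simp
    qed
  qed
  moreover have "\<forall>t\<ge>a. step c a t = 0" "\<forall>t\<le>a / 2. step c a t = 0" by auto
  moreover have "\<forall>L. \<exists>B. \<forall>t\<ge>L. \<bar>step c a t\<bar> \<le> B"
    by (auto intro!: exI[of _ "\<bar>c\<bar>"] simp: indicator_def)
  moreover have "finite {a / 2, a}" "0 < a / 2" using a by auto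
  ultimately show ?thesis unfolding pw_cont_pos_def pw_cont_def using a(2) by blast
qed

text \<open>On the support of the step the weight is at least its value at the right end \<open>a\<^sup>2\<close>, because
  \<open>\<kappa> \<le> 0\<close>.\<close>

lemma iter_tail_step_lower:
  assumes a: "0 < a" "a < 1" and c: "0 < c" and \<kappa>: "\<kappa> \<le> 0" and q: "a\<^sup>2 / 4 \<le> q" "q \<le> a\<^sup>2"
  shows "c * (a\<^sup>2) powr \<kappa> * (a\<^sup>2 - q) ^ Suc i / fact (Suc i)
    \<le> iter_tail (sqrt_profile \<kappa> (step c a)) (Suc i) q"
  using q
proof (induction i arbitrary: q)
  case 0
  let ?F = "sqrt_profile \<kappa> (step c a)" and ?A = "a\<^sup>2"
  have F: "pw_cont ?F" by (intro pw_cont_sqrt_profile pw_cont_pos_step a \<kappa>)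
  have F0: "0 \<le> ?F t" for t using c by (simp add: sqrt_profile_def)
  have low: "c * ?A powr \<kappa> \<le> ?F t" if t: "t \<in> {q<..<?A}" for t
  proof -
    have t0: "0 < t" using t 0 a by (smt (verit) divide_nonneg_nonneg greaterThanLessThan_iff zero_le_power2)
    have "a / 2 < sqrt t" using t 0 a
      by (intro real_less_rsqrt) (auto simp: power_divide)
    moreover have "sqrt t < a" using t a by (intro real_less_lsqrt) auto
    moreover have "?A powr \<kappa> \<le> t powr \<kappa>" using t t0 \<kappa> by (intro powr_mono2') auto
    ultimately show ?thesis using c by (simp add: sqrt_profile_def mult.commute)
  qed
  have "c * ?A powr \<kappa> * (?A - q) = integral {q..?A} (\<lambda>_. c * ?A powr \<kappa>)"
    using 0 by simp
  also have "\<dots> = integral {q<..<?A} (\<lambda>_. c * ?A powr \<kappa>)" by (rule integral_open_interval_real)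
  also have "\<dots> \<le> integral {q<..<?A} ?F"
    using low pw_cont_integrable_on[OF F, of q ?A]
    by (intro integral_le) (auto simp: integrable_on_open_interval_real)
  also have "\<dots> = integral {q..?A} ?F" by (rule integral_open_interval_real[symmetric])
  also have "\<dots> = tail_integral ?F q - tail_integral ?F ?A"
    using tail_integral_diff[OF F 0(2)] by simp
  also have "\<dots> \<le> tail_integral ?F q" using tail_integral_nonneg[OF F F0] by simp
  finally show ?case by simp
next
  case (Suc i)
  let ?A = "a\<^sup>2" and ?H = "iter_tail (sqrt_profile \<kappa> (step c a)) (Suc i)"
  have H: "pw_cont ?H" by (intro pw_cont_iter_tail pw_cont_sqrt_profile pw_cont_pos_step a \<kappa>)
  have H0: "0 \<le> ?H t" for t
    using c by (intro iter_tail_nonneg pw_cont_sqrt_profile pw_cont_pos_step a \<kappa>)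
      (auto simp: sqrt_profile_def)
  let ?k = "c * ?A powr \<kappa>"
  have hi: "((\<lambda>t. ?k * (?A - t) ^ Suc i / fact (Suc i)) has_integral
      (- (?k * (?A - ?A) ^ Suc (Suc i) / fact (Suc (Suc i)))
        - - (?k * (?A - q) ^ Suc (Suc i) / fact (Suc (Suc i))))) {q..?A}"
  proof (rule fundamental_theorem_of_calculus[OF Suc.prems(2)])
    fix t
    have "((\<lambda>t. - (?k * (?A - t) ^ Suc (Suc i) / fact (Suc (Suc i)))) has_real_derivative
        - (?k * (real (Suc (Suc i)) * (?A - t) ^ Suc i * (0 - 1)) / fact (Suc (Suc i)))) (at t)"
      by (intro DERIV_minus DERIV_cdivide DERIV_cmult)
        (rule DERIV_power[THEN DERIV_cong], auto intro!: derivative_eq_intros)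
    moreover have "- (?k * (real (Suc (Suc i)) * (?A - t) ^ Suc i * (0 - 1)) / fact (Suc (Suc i)))
        = ?k * (?A - t) ^ Suc i / fact (Suc i)"
      unfolding fact_Suc[of "Suc i"] by (simp add: field_simps del: of_nat_Suc fact_Suc power_Suc)
    ultimately show "((\<lambda>t. - (?k * (?A - t) ^ Suc (Suc i) / fact (Suc (Suc i))))
        has_vector_derivative ?k * (?A - t) ^ Suc i / fact (Suc i)) (at t within {q..?A})"
      by (simp only: has_real_derivative_iff_has_vector_derivative has_vector_derivative_at_within)
  qed
  have "?k * (?A - q) ^ Suc (Suc i) / fact (Suc (Suc i))
      = integral {q..?A} (\<lambda>t. ?k * (?A - t) ^ Suc i / fact (Suc i))"
    using integral_unique[OF hi] by simp
  also have "\<dots> \<le> integral {q..?A} ?H"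
    using hi Suc.prems by (intro integral_le Suc.IH pw_cont_integrable_on[OF H]) (auto simp del: iter_tail.simps fact_Suc power_Suc)
  also have "\<dots> = tail_integral ?H q - tail_integral ?H ?A"
    using tail_integral_diff[OF H Suc.prems(2)] by simp
  also have "\<dots> \<le> tail_integral ?H q" using tail_integral_nonneg[OF H H0] by simp
  finally show ?case by simp
qed

section \<open>Homogeneous polynomials\<close>

definition homogeneous_about :: "'a::real_normed_vector \<Rightarrow> real \<Rightarrow> ('a \<Rightarrow> real) \<Rightarrow> bool" where
  "homogeneous_about x\<^sub>0 d p \<longleftrightarrow> (\<forall>c>0. \<forall>z. p (x\<^sub>0 + c *\<^sub>R z) = c powr d * p (x\<^sub>0 + z))"

lemma homogeneous_about_add:
  "homogeneous_about x\<^sub>0 d p \<Longrightarrow> homogeneous_about x\<^sub>0 d q \<Longrightarrow>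
    homogeneous_about x\<^sub>0 d (\<lambda>x. p x + q x)"
  by (simp add: homogeneous_about_def distrib_left)

lemma homogeneous_about_mult:
  "homogeneous_about x\<^sub>0 d p \<Longrightarrow> homogeneous_about x\<^sub>0 k q \<Longrightarrow>
    homogeneous_about x\<^sub>0 (d + k) (\<lambda>x. p x * q x)"
  by (simp add: homogeneous_about_def powr_add mult_ac)

lemma homogeneous_about_pderiv_dir:
  assumes p: "real_polynomial_function p" and hom: "homogeneous_about x\<^sub>0 d p"
  shows "homogeneous_about x\<^sub>0 (d - 1) (pderiv_dir v p)"
  unfolding homogeneous_about_def
proof (intro allI impI)
  fix c :: real and z assume c: "0 < c"
  let ?D = "\<lambda>x. frechet_derivative p (at x)"
  have "((\<lambda>z. x\<^sub>0 + c *\<^sub>R z) has_derivative (\<lambda>h. c *\<^sub>R h)) (at z)"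
    by (auto intro!: derivative_eq_intros)
  from has_derivative_compose[OF this polynomial_has_derivative[OF p]]
  have 1: "((\<lambda>z. p (x\<^sub>0 + c *\<^sub>R z)) has_derivative (\<lambda>h. ?D (x\<^sub>0 + c *\<^sub>R z) (c *\<^sub>R h))) (at z)" .
  have "((\<lambda>z. x\<^sub>0 + z) has_derivative (\<lambda>h. h)) (at z)"
    by (auto intro!: derivative_eq_intros)
  from has_derivative_compose[OF this polynomial_has_derivative[OF p]]
  have "((\<lambda>z. p (x\<^sub>0 + z)) has_derivative (\<lambda>h. ?D (x\<^sub>0 + z) h)) (at z)" .
  then have 2: "((\<lambda>z. c powr d * p (x\<^sub>0 + z)) has_derivative (\<lambda>h. c powr d * ?D (x\<^sub>0 + z) h)) (at z)"
    by (rule has_derivative_mult_right)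
  have "(\<lambda>z. p (x\<^sub>0 + c *\<^sub>R z)) = (\<lambda>z. c powr d * p (x\<^sub>0 + z))"
    using hom c unfolding homogeneous_about_def by blast
  with 1 have "((\<lambda>z. c powr d * p (x\<^sub>0 + z)) has_derivative (\<lambda>h. ?D (x\<^sub>0 + c *\<^sub>R z) (c *\<^sub>R h))) (at z)"
    by (simp only:)
  from has_derivative_unique[OF this 2]
  have "?D (x\<^sub>0 + c *\<^sub>R z) (c *\<^sub>R v) = c powr d * ?D (x\<^sub>0 + z) v" by (rule fun_cong)
  moreover have "?D (x\<^sub>0 + c *\<^sub>R z) (c *\<^sub>R v) = c * ?D (x\<^sub>0 + c *\<^sub>R z) v"
    using linear_cmul[OF has_derivative_linear[OF polynomial_has_derivative[OF p]]] by simp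
  ultimately have "c * ?D (x\<^sub>0 + c *\<^sub>R z) v = c powr d * ?D (x\<^sub>0 + z) v" by simp
  moreover have "c powr d = c * c powr (d - 1)" using c by (simp add: powr_diff)
  ultimately show "?D (x\<^sub>0 + c *\<^sub>R z) v = c powr (d - 1) * ?D (x\<^sub>0 + z) v" using c by simp
qed

text \<open>A continuous homogeneous function is controlled by its maximum on the unit sphere.\<close>

lemma homogeneous_about_bound:
  fixes p :: "'a::euclidean_space \<Rightarrow> real"
  assumes p: "continuous_on UNIV p" and hom: "homogeneous_about x\<^sub>0 d p"
  shows "\<exists>C\<ge>0. \<forall>x. x \<noteq> x\<^sub>0 \<longrightarrow> \<bar>p x\<bar> \<le> C * norm (x - x\<^sub>0) powr d"
proof -
  have "bounded (p ` sphere x\<^sub>0 1)"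
    by (intro compact_imp_bounded compact_continuous_image)
      (auto intro: continuous_on_subset[OF p])
  then obtain C where C: "\<forall>y\<in>p ` sphere x\<^sub>0 1. norm y \<le> C" unfolding bounded_iff by blast
  have "\<bar>p x\<bar> \<le> max C 0 * norm (x - x\<^sub>0) powr d" if x: "x \<noteq> x\<^sub>0" for x
  proof -
    let ?r = "norm (x - x\<^sub>0)" and ?z = "(x - x\<^sub>0) /\<^sub>R norm (x - x\<^sub>0)"
    have r: "0 < ?r" using x by simp
    have "p (x\<^sub>0 + ?r *\<^sub>R ?z) = ?r powr d * p (x\<^sub>0 + ?z)"
      using hom r unfolding homogeneous_about_def by blast
    moreover have "?r *\<^sub>R ?z = x - x\<^sub>0" using r by simp
    ultimately have eq: "p x = ?r powr d * p (x\<^sub>0 + ?z)" by simp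
    have "x\<^sub>0 + ?z \<in> sphere x\<^sub>0 1" using r by (simp add: dist_norm)
    then have "norm (p (x\<^sub>0 + ?z)) \<le> C" by (intro C[rule_format] imageI)
    then have "\<bar>p (x\<^sub>0 + ?z)\<bar> \<le> max C 0" by simp
    then have "\<bar>p (x\<^sub>0 + ?z)\<bar> * ?r powr d \<le> max C 0 * ?r powr d"
      by (intro mult_right_mono) auto
    then show ?thesis unfolding eq abs_mult by (simp add: mult.commute)
  qed
  then show ?thesis by (intro exI[of _ "max C 0"]) auto
qed

section \<open>Radial functions\<close>

definition radial_poly :: "real^'n \<Rightarrow> real \<Rightarrow> real^'n \<Rightarrow> real" where
  "radial_poly x\<^sub>0 R x = ((x - x\<^sub>0) \<bullet> (x - x\<^sub>0) / R\<^sup>2) ^ CARD('n)"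

text \<open>For \<open>x\<close> in the ball of radius \<open>R\<close> about \<open>x\<^sub>0\<close> this is the fraction of the ball that lies closer to
  the centre than \<open>x\<close>.\<close>

definition vol_coord :: "real^'n \<Rightarrow> real \<Rightarrow> real^'n \<Rightarrow> real" where
  "vol_coord x\<^sub>0 R x = (norm (x - x\<^sub>0) / R) ^ CARD('n)"

lemma radial_poly_eq: "radial_poly x\<^sub>0 R x = (vol_coord x\<^sub>0 R x)\<^sup>2"
proof -
  have "(x - x\<^sub>0) \<bullet> (x - x\<^sub>0) / R\<^sup>2 = (norm (x - x\<^sub>0) / R)\<^sup>2"
    by (simp only: power2_norm_eq_inner power_divide)
  then show ?thesis
    unfolding radial_poly_def vol_coord_def by (simp only: power_mult[symmetric] mult.commute)
qed

lemma polynomial_radial_poly: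
  fixes x\<^sub>0 :: "real^'n"
  shows "real_polynomial_function (radial_poly x\<^sub>0 R)"
proof -
  have comp: "real_polynomial_function (\<lambda>x::real^'n. (x $ i - x\<^sub>0 $ i) ^ 2)" for i
    by (rule real_polynomial_function_power, rule real_polynomial_function_diff)
      (rule real_polynomial_function.intros(1), rule bounded_linear_vec_nth,
        rule real_polynomial_function.intros(2))
  have "real_polynomial_function (\<lambda>x::real^'n. \<Sum>i\<in>UNIV. (x $ i - x\<^sub>0 $ i) ^ 2)"
    by (rule real_polynomial_function_sum) (simp, rule comp)
  then have "real_polynomial_function
      (\<lambda>x::real^'n. ((\<Sum>i\<in>UNIV. (x $ i - x\<^sub>0 $ i) ^ 2) / R\<^sup>2) ^ CARD('n))"
    by (rule real_polynomial_function_power[OF real_polynomial_function_divide])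
  moreover have "(\<Sum>i\<in>UNIV. (x $ i - x\<^sub>0 $ i) ^ 2) = (x - x\<^sub>0) \<bullet> (x - x\<^sub>0)" for x :: "real^'n"
    by (simp add: inner_vec_def power2_eq_square)
  ultimately show ?thesis unfolding radial_poly_def[abs_def] by simp
qed

lemma homogeneous_radial_poly:
  "homogeneous_about x\<^sub>0 (2 * real CARD('n)) (radial_poly (x\<^sub>0::real^'n) R)"
  unfolding homogeneous_about_def
proof (intro allI impI)
  fix c :: real and z :: "real^'n" assume c: "0 < c"
  have "c powr (2 * real CARD('n)) = c powr real (2 * CARD('n))" by simp
  also have "\<dots> = (c\<^sup>2) ^ CARD('n)" using c by (simp only: powr_realpow power_mult)
  finally have pw: "c powr (2 * real CARD('n)) = (c\<^sup>2) ^ CARD('n)" .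
  have "(c *\<^sub>R z) \<bullet> (c *\<^sub>R z) / R\<^sup>2 = c\<^sup>2 * (z \<bullet> z / R\<^sup>2)"
    by (simp add: power2_eq_square)
  then show "radial_poly x\<^sub>0 R (x\<^sub>0 + c *\<^sub>R z) = c powr (2 * real CARD('n)) * radial_poly x\<^sub>0 R (x\<^sub>0 + z)"
    unfolding pw radial_poly_def power_mult_distrib[symmetric] by (simp only: add_diff_cancel_left')
qed

lemma homogeneous_fold_chain_coeff:
  fixes A :: "nat \<Rightarrow> real^'n \<Rightarrow> real"
  assumes "poly_coeffs k A"
    and "\<And>j. homogeneous_about x\<^sub>0 (2 * real CARD('n) * real j - l) (A j)"
  shows "homogeneous_about x\<^sub>0 (2 * real CARD('n) * real j - (l + real (length js)))
    (fold (chain_coeff (radial_poly x\<^sub>0 R)) js A j)"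
  using assms
proof (induction js arbitrary: A l k)
  case (Cons i js)
  let ?Q = "radial_poly x\<^sub>0 R" and ?n = "real CARD('n)"
  have P: "real_polynomial_function (A j)" for j using Cons.prems(1) by (simp add: poly_coeffs_def)
  have "homogeneous_about x\<^sub>0 (2 * ?n * real j - (l + 1)) (chain_coeff ?Q i A j)" for j
  proof (cases j)
    case 0
    have "homogeneous_about x\<^sub>0 (2 * ?n * real 0 - l - 1) (pderiv_dir (axis i 1) (A 0))"
      by (intro homogeneous_about_pderiv_dir P Cons.prems)
    then show ?thesis using 0 by (simp add: chain_coeff_def diff_diff_eq)
  next
    case (Suc k)
    have "homogeneous_about x\<^sub>0 (2 * ?n * real (Suc k) - l - 1) (pderiv_dir (axis i 1) (A (Suc k)))"
      by (intro homogeneous_about_pderiv_dir P Cons.prems)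
    moreover have "homogeneous_about x\<^sub>0 ((2 * ?n * real k - l) + (2 * ?n - 1))
        (\<lambda>x. A k x * pderiv_dir (axis i 1) ?Q x)"
      by (intro homogeneous_about_mult homogeneous_about_pderiv_dir Cons.prems
          polynomial_radial_poly homogeneous_radial_poly)
    moreover have "(2 * ?n * real k - l) + (2 * ?n - 1) = 2 * ?n * real (Suc k) - l - 1"
      by (simp add: algebra_simps)
    ultimately have "homogeneous_about x\<^sub>0 (2 * ?n * real (Suc k) - l - 1)
        (\<lambda>x. pderiv_dir (axis i 1) (A (Suc k)) x + A k x * pderiv_dir (axis i 1) ?Q x)"
      by (intro homogeneous_about_add) simp_all
    then show ?thesis using Suc by (simp add: chain_coeff_def diff_diff_eq)
  qed
  from Cons.IH[OF poly_coeffs_chain_coeff[OF polynomial_radial_poly Cons.prems(1)] this]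
  show ?case by (simp add: add_ac)
qed simp

text \<open>Each term in a derivative of \<open>h m \<circ> Q\<close> contains a derivative of \<open>h m\<close>.\<close>

lemma fold_chain_coeff_0:
  assumes "js \<noteq> []" shows "fold (chain_coeff Q) js unit_coeffs 0 = (\<lambda>x. 0)"
proof -
  have const: "fold (chain_coeff Q) ks A 0 = (\<lambda>x. 0)" if "A 0 = (\<lambda>x. 0)" for ks A
    using that by (induction ks arbitrary: A) (simp_all add: chain_coeff_def)
  obtain i ks where js: "js = i # ks" using assms by (cases js) auto
  have "unit_coeffs 0 = (\<lambda>x::real^'a. 1)" by (simp add: unit_coeffs_def fun_eq_iff)
  then have "chain_coeff Q i unit_coeffs 0 = (\<lambda>x. 0)" by (simp add: chain_coeff_def)
  then show ?thesis unfolding js by (simp add: const)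
qed

lemma chain_coeff_bound:
  fixes x\<^sub>0 :: "real^'n"
  shows "\<exists>C\<ge>0. \<forall>j\<le>m. \<forall>x. x \<noteq> x\<^sub>0 \<longrightarrow>
    \<bar>fold (chain_coeff (radial_poly x\<^sub>0 R)) js unit_coeffs j x\<bar>
      \<le> C * norm (x - x\<^sub>0) powr (2 * real CARD('n) * real j - real (length js))"
proof -
  let ?A = "fold (chain_coeff (radial_poly x\<^sub>0 R)) js unit_coeffs"
  have hom: "homogeneous_about x\<^sub>0 (2 * real CARD('n) * real j - (0 + real (length js))) (?A j)" for j
  proof (rule homogeneous_fold_chain_coeff[OF poly_coeffs_unit])
    show "homogeneous_about x\<^sub>0 (2 * real CARD('n) * real j - 0) (unit_coeffs j)" for j
      by (auto simp: homogeneous_about_def unit_coeffs_def)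
  qed
  have "poly_coeffs (0 + length js) ?A"
    by (rule poly_coeffs_fold[OF polynomial_radial_poly poly_coeffs_unit])
  then have "continuous_on UNIV (?A j)" for j
    by (simp add: poly_coeffs_def continuous_on_polymonial_function real_polynomial_function_eq)
  from homogeneous_about_bound[OF this hom]
  have "\<forall>j. \<exists>C\<ge>0. \<forall>x. x \<noteq> x\<^sub>0 \<longrightarrow>
      \<bar>?A j x\<bar> \<le> C * norm (x - x\<^sub>0) powr (2 * real CARD('n) * real j - real (length js))"
    by simp
  from choice[OF this] obtain C where C: "\<And>j. 0 \<le> C j" "\<And>j x. x \<noteq> x\<^sub>0 \<Longrightarrow>
      \<bar>?A j x\<bar> \<le> C j * norm (x - x\<^sub>0) powr (2 * real CARD('n) * real j - real (length js))" by blast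
  have "\<bar>?A j x\<bar> \<le> (\<Sum>j\<le>m. C j) * norm (x - x\<^sub>0) powr (2 * real CARD('n) * real j - real (length js))"
    if "j \<le> m" "x \<noteq> x\<^sub>0" for j x
  proof -
    have "C j \<le> (\<Sum>j\<le>m. C j)" using that C(1) by (intro member_le_sum) auto
    then show ?thesis using C(2)[OF that(2), of j] by (meson mult_right_mono order_trans powr_ge_zero)
  qed
  moreover have "0 \<le> (\<Sum>j\<le>m. C j)" using C(1) by (intro sum_nonneg)
  ultimately show ?thesis by blast
qed

text \<open>As functions of \<open>B\<close> both sides are finite measures, so they are compared on half lines, where
  the left-hand side is a difference of volumes of balls.\<close>

lemma emeasure_vol_coord:
  fixes x\<^sub>0 :: "real^'n"
  assumes R: "0 < R" and B: "B \<in> sets borel" "B \<subseteq> {0<..<1}"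
  shows "emeasure lborel {x. vol_coord x\<^sub>0 R x \<in> B} = emeasure lborel (ball x\<^sub>0 R) * emeasure lborel B"
proof -
  let ?n = "CARD('n)" and ?s = "vol_coord x\<^sub>0 R" and ?V = "ball x\<^sub>0 R"
  define v where "v = measure lborel ?V"
  have v: "emeasure lborel ?V = ennreal v"
    unfolding v_def by (intro emeasure_eq_ennreal_measure) (use emeasure_bounded_finite[of "ball x\<^sub>0 R"] in simp)
  have s_meas [measurable]: "?s \<in> borel_measurable borel"
    unfolding vol_coord_def[abs_def] by measurable
  let ?M = "distr (density lborel (indicator ?V)) borel ?s"
  let ?N = "density lborel (\<lambda>t::real. ennreal v * indicator {0<..<1} t)"
  have M: "emeasure ?M C = emeasure lborel (?V \<inter> ?s -` C)" if "C \<in> sets borel" for C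
  proof -
    have "?s -` C \<in> sets borel" using measurable_sets_borel[OF s_meas that] .
    then show ?thesis
      using that by (simp add: emeasure_distr emeasure_restricted)
  qed
  have N: "emeasure ?N C = ennreal v * emeasure lborel ({0<..<1} \<inter> C)" if "C \<in> sets borel" for C
  proof -
    have "emeasure ?N C = (\<integral>\<^sup>+t. ennreal v * (indicator {0<..<1} t * indicator C t) \<partial>lborel)"
      using that by (subst emeasure_density) (auto simp: mult.assoc)
    also have "\<dots> = ennreal v * (\<integral>\<^sup>+t. indicator {0<..<1} t * indicator C t \<partial>lborel)"
      using that by (intro nn_integral_cmult) auto
    also have "(\<lambda>t. indicator {0<..<1} t * indicator C t) = (indicator ({0<..<1} \<inter> C) :: real \<Rightarrow> ennreal)"
      by (auto simp: indicator_def fun_eq_iff)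
    finally show ?thesis using that by (simp add: nn_integral_indicator)
  qed
  have "?M = ?N"
  proof (rule measure_eqI_lessThan)
    fix a :: real
    have Ma: "emeasure ?M {a<..} = emeasure lborel (?V \<inter> {x. a < ?s x})"
      by (subst M) (auto intro!: arg_cong[where f="emeasure lborel"])
    have "emeasure ?M {a<..} \<le> emeasure lborel ?V" unfolding Ma by (intro emeasure_mono) auto
    then show "emeasure ?M {a<..} < \<infinity>" using v by (simp add: le_less_trans)
    have s0: "0 \<le> ?s x" for x using R by (simp add: vol_coord_def)
    have s1: "?s x < 1 \<longleftrightarrow> x \<in> ?V" for x
    proof -
      have "?s x < 1 \<longleftrightarrow> norm (x - x\<^sub>0) / R < 1"
        unfolding vol_coord_def using R by (subst power_less_one_iff) auto
      then show ?thesis using R by (simp add: dist_norm norm_minus_commute)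
    qed
    consider "a < 0" | "0 \<le> a" "a < 1" | "1 \<le> a" by linarith
    then show "emeasure ?M {a<..} = emeasure ?N {a<..}"
    proof cases
      case 1
      have "a < ?s x" for x using s0[of x] 1 by linarith
      then have "?V \<inter> {x. a < ?s x} = ?V" by blast
      moreover have "{0<..<1} \<inter> {a<..} = {0<..<1::real}" using 1 by auto
      ultimately show ?thesis unfolding Ma by (subst N) (simp_all add: v)
    next
      case 3
      have "\<not> a < ?s x" if "x \<in> ?V" for x using that 3 unfolding s1[symmetric] by linarith
      then have "?V \<inter> {x. a < ?s x} = {}" by blast
      moreover have "{0<..<1} \<inter> {a<..} = ({} :: real set)" using 3 by auto
      ultimately show ?thesis unfolding Ma by (subst N) simp_all
    next
      case 2
      let ?r = "R * root ?n a"
      have r: "0 \<le> ?r" using R 2 by simp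
      have le: "?s x \<le> a \<longleftrightarrow> x \<in> cball x\<^sub>0 ?r" for x
      proof -
        have "?s x \<le> a \<longleftrightarrow> (norm (x - x\<^sub>0) / R) ^ ?n \<le> (root ?n a) ^ ?n"
          using 2 by (simp add: vol_coord_def)
        also have "\<dots> \<longleftrightarrow> norm (x - x\<^sub>0) / R \<le> root ?n a"
          using R 2 by (intro power_mono_iff) auto
        finally show ?thesis
          using R by (simp add: dist_norm norm_minus_commute pos_divide_le_eq mult.commute)
      qed
      have "a < ?s x \<longleftrightarrow> x \<notin> cball x\<^sub>0 ?r" for x unfolding le[symmetric] by (rule not_le[symmetric])
      then have eq: "?V \<inter> {x. a < ?s x} = ?V - cball x\<^sub>0 ?r" by blast
      have sub: "cball x\<^sub>0 ?r \<subseteq> ?V"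
      proof
        fix x assume "x \<in> cball x\<^sub>0 ?r"
        then show "x \<in> ?V" using 2 unfolding le[symmetric] s1[symmetric] by linarith
      qed
      have c: "measure lborel (cball x\<^sub>0 ?r) = a * v"
      proof -
        have "measure lborel (cball x\<^sub>0 ?r) = unit_ball_vol (real ?n) * ?r ^ ?n"
          using content_cball[OF r, of x\<^sub>0] by simp
        moreover have "v = unit_ball_vol (real ?n) * R ^ ?n"
          unfolding v_def using content_ball[of R x\<^sub>0] R by simp
        ultimately show ?thesis using 2 by (simp add: power_mult_distrib)
      qed
      have ec: "emeasure lborel (cball x\<^sub>0 ?r) = ennreal (a * v)"
        unfolding c[symmetric]
        by (intro emeasure_eq_ennreal_measure) (use emeasure_bounded_finite[of "cball x\<^sub>0 ?r"] in simp)
      have v0: "0 \<le> v" by (simp add: v_def)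
      have "emeasure lborel (?V - cball x\<^sub>0 ?r) = emeasure lborel ?V - emeasure lborel (cball x\<^sub>0 ?r)"
        using sub ec by (intro emeasure_Diff) auto
      also have "\<dots> = ennreal (v - a * v)" unfolding v ec using v0 2 by (simp add: ennreal_minus)
      finally have "emeasure ?M {a<..} = ennreal (v - a * v)" unfolding Ma eq .
      moreover have "{0<..<1} \<inter> {a<..} = {a<..<1::real}" using 2 by auto
      then have "emeasure ?N {a<..} = ennreal v * ennreal (1 - a)" using 2 by (subst N) simp_all
      ultimately show ?thesis using v0 2 by (simp add: ennreal_mult[symmetric] algebra_simps)
    qed
  qed simp_all
  then have "emeasure ?M B = emeasure ?N B" by simp
  moreover have "emeasure ?M B = emeasure lborel {x. ?s x \<in> B}"
  proof -
    have "?V \<inter> ?s -` B = {x. ?s x \<in> B}"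
    proof -
      have "x \<in> ?V" if "?s x \<in> B" for x
      proof -
        have "?s x < 1" using that B(2) by auto
        then have "norm (x - x\<^sub>0) / R < 1"
          unfolding vol_coord_def using R by (subst (asm) power_less_one_iff) auto
        then show ?thesis using R by (simp add: dist_norm norm_minus_commute)
      qed
      then show ?thesis by auto
    qed
    then show ?thesis using M[OF B(1)] by simp
  qed
  moreover have "{0<..<1} \<inter> B = B" using B(2) by blast
  ultimately show ?thesis using N[OF B(1)] v by simp
qed

section \<open>Lifting a profile to a radial function\<close>

text \<open>The weight in the profile balances the polynomial factor \<open>|x - x\<^sub>0|\<^bsup>2nm-m\<^esup>\<close> that accompanies the
  highest derivative of the profile, so that the \<open>m\<close>-th gradient contains \<open>f\<close> itself, evaluated
  at the volume coordinate, without a weight.\<close>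

definition radial_lift :: "real^'n \<Rightarrow> real \<Rightarrow> nat \<Rightarrow> (real \<Rightarrow> real) \<Rightarrow> real^'n \<Rightarrow> real" where
  "radial_lift x\<^sub>0 R m f x =
     iter_tail (sqrt_profile (real m / (2 * real CARD('n)) - real m) f) m (radial_poly x\<^sub>0 R x)"

lemma exponent_bounds:
  assumes "1 \<le> m" "m < CARD('n::finite)"
  shows "0 < real m / (2 * real CARD('n))" "real m / (2 * real CARD('n)) < 1/2"
    "real m / (2 * real CARD('n)) - real m \<le> 0"
proof -
  have n: "0 < real CARD('n)" by simp
  show "0 < real m / (2 * real CARD('n))" using assms n by simp
  show *: "real m / (2 * real CARD('n)) < 1/2" using assms n by (simp add: pos_divide_less_eq)
  have "1 \<le> real m" using assms by simp
  then show "real m / (2 * real CARD('n)) - real m \<le> 0" using * by linarith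
qed

lemma primitive_chain_profile:
  fixes x\<^sub>0 :: "real^'n"
  assumes f: "pw_cont_pos f" and \<kappa>: "\<kappa> \<le> 0" and R: "0 < R"
  shows "\<exists>E. primitive_chain (iter_tail (sqrt_profile \<kappa> f)) E (radial_poly x\<^sub>0 R)"
proof -
  let ?F = "sqrt_profile \<kappa> f" and ?Q = "radial_poly x\<^sub>0 R"
  have F: "pw_cont ?F" by (rule pw_cont_sqrt_profile[OF f \<kappa>])
  obtain E where E: "finite E" "\<And>t. t \<notin> E \<Longrightarrow> isCont ?F t" using F unfolding pw_cont_def by blast
  have "primitive_chain (iter_tail ?F) E ?Q"
  proof
    show "(iter_tail ?F (Suc j) has_real_derivative - iter_tail ?F j t) (at t)" if j: "1 \<le> j" for j t
    proof -
      obtain k where k: "j = Suc k" using j by (cases j) auto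
      have "isCont (iter_tail ?F j) t"
        unfolding k iter_tail.simps by (rule tail_integral_isCont[OF pw_cont_iter_tail[OF F]])
      then show ?thesis
        unfolding iter_tail.simps by (rule tail_integral_has_derivative[OF pw_cont_iter_tail[OF F]])
    qed
    show "(iter_tail ?F 1 has_real_derivative - iter_tail ?F 0 t) (at t)" if "t \<notin> E" for t
      using tail_integral_has_derivative[OF F E(2)[OF that]] by simp
    show "loc_lipschitz (iter_tail ?F 1)" using tail_integral_lipschitz[OF F] by simp
    show "iter_tail ?F 0 \<in> borel_measurable borel" using pw_cont_measurable[OF F] by simp
    show "\<exists>B. \<forall>t. \<bar>t\<bar> \<le> s \<longrightarrow> \<bar>iter_tail ?F 0 t\<bar> \<le> B" for s
    proof -
      obtain B where B: "\<And>t. - s \<le> t \<Longrightarrow> \<bar>?F t\<bar> \<le> B" using F unfolding pw_cont_def by blast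
      have "\<bar>iter_tail ?F 0 t\<bar> \<le> B" if "\<bar>t\<bar> \<le> s" for t using B[of t] that by simp
      then show ?thesis by blast
    qed
    show "real_polynomial_function ?Q" by (rule polynomial_radial_poly)
    \<comment> \<open>each level set of the polynomial lies on a single sphere\<close>
    have "negligible {x. ?Q x = y}" for y
    proof (cases "{x. ?Q x = y} = {}")
      case False
      then obtain z where z: "?Q z = y" by blast
      have "{x. ?Q x = y} \<subseteq> sphere x\<^sub>0 (norm (z - x\<^sub>0))"
      proof
        fix x assume "x \<in> {x. ?Q x = y}"
        then have "?Q x = ?Q z" using z by simp
        then have "vol_coord x\<^sub>0 R x = vol_coord x\<^sub>0 R z"
          unfolding radial_poly_eq using R
          by (subst (asm) power_eq_iff_eq_base) (auto simp: vol_coord_def)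
        then have "norm (x - x\<^sub>0) / R = norm (z - x\<^sub>0) / R"
          unfolding vol_coord_def using R by (subst (asm) power_eq_iff_eq_base) auto
        then show "x \<in> sphere x\<^sub>0 (norm (z - x\<^sub>0))"
          using R by (simp add: dist_norm norm_minus_commute)
      qed
      then show ?thesis by (rule negligible_subset[OF negligible_sphere])
    qed simp
    then have "negligible (\<Union>y\<in>E. {x. ?Q x = y})" using E(1) by (intro negligible_Union) auto
    then have "AE x in lebesgue. x \<notin> (\<Union>y\<in>E. {x. ?Q x = y})"
      unfolding negligible_iff_null_sets by (rule AE_not_in)
    then show "AE x in lebesgue. ?Q x \<notin> E" by eventually_elim blast
  qed
  then show ?thesis by blast
qed

text \<open>The term \<open>j = m\<close> is \<open>f\<close> itself up to the weight; the others are primitives, which are bounded by the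
  weighted tail.  The factor \<open>1 / (1/2 - e)\<close> is at least 1, so its \<open>m\<close>-th power serves all terms.\<close>

lemma iter_tail_profile_bound:
  assumes f: "pw_cont_pos f" and e: "0 < e" "e < 1/2" and j: "1 \<le> j" "j \<le> m" and s: "0 < s"
  shows "\<bar>iter_tail (sqrt_profile (e - real m) f) (m - j) (s\<^sup>2)\<bar>
    \<le> (1 / (1/2 - e)) ^ m * ((s\<^sup>2) powr (e - real j) * (\<bar>f s\<bar> + s * weighted_tail f (s\<^sup>2)))"
proof -
  let ?K = "1 / (1/2 - e)" and ?Z = "weighted_tail f (s\<^sup>2)"
  have K1: "1 \<le> ?K" using e by simp
  have Z0: "0 \<le> ?Z" by (rule weighted_tail_nonneg[OF f])
  show ?thesis
  proof (cases "j = m")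
    case True
    have "\<bar>iter_tail (sqrt_profile (e - real m) f) (m - j) (s\<^sup>2)\<bar> = (s\<^sup>2) powr (e - real j) * \<bar>f s\<bar>"
      using s True by (simp add: sqrt_profile_def abs_mult)
    also have "\<dots> \<le> (s\<^sup>2) powr (e - real j) * (\<bar>f s\<bar> + s * ?Z)"
      using Z0 s by (intro mult_left_mono) auto
    also have "\<dots> \<le> ?K ^ m * ((s\<^sup>2) powr (e - real j) * (\<bar>f s\<bar> + s * ?Z))"
    proof -
      have "0 \<le> (s\<^sup>2) powr (e - real j) * (\<bar>f s\<bar> + s * ?Z)" using Z0 s by simp
      from mult_right_mono[OF one_le_power[OF K1, of m] this] show ?thesis by simp
    qed
    finally show ?thesis .
  next
    case False
    define i where "i = m - j - 1"
    have i: "m - j = Suc i" "i + 2 \<le> m" using False j by (auto simp: i_def)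
    have "s\<^sup>2 powr (1/2) = s" using s by (simp add: powr_half_sqrt)
    moreover have "e - (real m - real (Suc i)) + 1/2 = (e - real j) + 1/2"
      using i(1) j by linarith
    ultimately have eq: "(s\<^sup>2) powr (e - (real m - real (Suc i)) + 1/2) = (s\<^sup>2) powr (e - real j) * s"
      by (simp only: powr_add)
    have "\<bar>iter_tail (sqrt_profile (e - real m) f) (m - j) (s\<^sup>2)\<bar>
        \<le> ?K ^ i * ((s\<^sup>2) powr (e - real j) * s * ?Z)"
      unfolding i(1) using iter_tail_bound[OF f e i(2), of "s\<^sup>2"] s unfolding eq by simp
    also have "\<dots> \<le> ?K ^ m * ((s\<^sup>2) powr (e - real j) * (\<bar>f s\<bar> + s * ?Z))"
    proof (rule mult_mono)
      show "?K ^ i \<le> ?K ^ m" using K1 i(2) by (intro power_increasing) auto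
      have "(s\<^sup>2) powr (e - real j) * (s * ?Z) \<le> (s\<^sup>2) powr (e - real j) * (\<bar>f s\<bar> + s * ?Z)"
        by (intro mult_left_mono) auto
      then show "(s\<^sup>2) powr (e - real j) * s * ?Z \<le> (s\<^sup>2) powr (e - real j) * (\<bar>f s\<bar> + s * ?Z)"
        by (simp only: mult.assoc)
      show "0 \<le> ?K ^ m" using e by (intro zero_le_power) simp
      show "0 \<le> (s\<^sup>2) powr (e - real j) * s * ?Z" using Z0 s by simp
    qed
    finally show ?thesis .
  qed
qed

text \<open>The coefficient of the \<open>j\<close>-th term is homogeneous of degree \<open>2nj - m\<close>, which cancels the
  power of the volume coordinate in the bound for the profile.\<close>

lemma chain_comb_profile_bound:
  fixes x\<^sub>0 :: "real^'n"
  assumes m: "1 \<le> m" "m < CARD('n)" and R: "0 < R" and js: "length js = m"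
  shows "\<exists>C\<ge>0. \<forall>f x. pw_cont_pos f \<longrightarrow> x \<noteq> x\<^sub>0 \<longrightarrow>
    \<bar>chain_comb (iter_tail (sqrt_profile (real m / (2 * real CARD('n)) - real m) f)) (radial_poly x\<^sub>0 R) m
        (fold (chain_coeff (radial_poly x\<^sub>0 R)) js unit_coeffs) x\<bar>
    \<le> C * (\<bar>f (vol_coord x\<^sub>0 R x)\<bar> + vol_coord x\<^sub>0 R x * weighted_tail f ((vol_coord x\<^sub>0 R x)\<^sup>2))"
proof -
  let ?n = "real CARD('n)" and ?Q = "radial_poly x\<^sub>0 R"
  let ?A = "fold (chain_coeff ?Q) js unit_coeffs"
  define e where "e = real m / (2 * ?n)"
  have e: "0 < e" "e < 1/2" using exponent_bounds[OF m] by (auto simp: e_def)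
  obtain C where C: "0 \<le> C" "\<And>j x. j \<le> m \<Longrightarrow> x \<noteq> x\<^sub>0 \<Longrightarrow>
      \<bar>?A j x\<bar> \<le> C * norm (x - x\<^sub>0) powr (2 * ?n * real j - real m)"
    using chain_coeff_bound[of m x\<^sub>0 R js] js by blast
  let ?K = "(1 / (1/2 - e)) ^ m"
  define D where "D = (\<Sum>j\<le>m. C * ?K * R powr (2 * ?n * real j - real m))"
  have A0: "?A 0 = (\<lambda>x. 0)" using js m by (intro fold_chain_coeff_0) auto
  have "\<bar>chain_comb (iter_tail (sqrt_profile (e - real m) f)) ?Q m ?A x\<bar>
      \<le> D * (\<bar>f (vol_coord x\<^sub>0 R x)\<bar> + vol_coord x\<^sub>0 R x * weighted_tail f ((vol_coord x\<^sub>0 R x)\<^sup>2))"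
    if f: "pw_cont_pos f" and x: "x \<noteq> x\<^sub>0" for f x
  proof -
    let ?r = "norm (x - x\<^sub>0)" and ?s = "vol_coord x\<^sub>0 R x"
    let ?W = "\<bar>f ?s\<bar> + ?s * weighted_tail f (?s\<^sup>2)" and ?h = "iter_tail (sqrt_profile (e - real m) f)"
    have r: "0 < ?r" using x by simp
    have s: "0 < ?s" using r R by (simp add: vol_coord_def)
    have W0: "0 \<le> ?W" using s weighted_tail_nonneg[OF f] by simp
    have K0: "0 \<le> ?K" using e by simp
    have "\<bar>(-1) ^ j * ?h (m - j) (?Q x) * ?A j x\<bar>
        \<le> C * ?K * R powr (2 * ?n * real j - real m) * ?W" if j: "j \<le> m" for j
    proof (cases "j = 0")
      case True
      then show ?thesis using C(1) K0 W0 A0 by simp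
    next
      case False
      have "\<bar>?h (m - j) (?Q x)\<bar> \<le> ?K * ((?s\<^sup>2) powr (e - real j) * ?W)"
        unfolding radial_poly_eq using False j by (intro iter_tail_profile_bound f e s) auto
      then have "\<bar>?h (m - j) (?Q x)\<bar> * \<bar>?A j x\<bar>
          \<le> (?K * ((?s\<^sup>2) powr (e - real j) * ?W)) * (C * ?r powr (2 * ?n * real j - real m))"
        using C(2)[OF j x] K0 W0 by (intro mult_mono) auto
      also have "\<dots> = C * ?K * ((?s\<^sup>2) powr (e - real j) * ?r powr (2 * ?n * real j - real m)) * ?W"
        by (simp add: mult_ac)
      also have "(?s\<^sup>2) powr (e - real j) * ?r powr (2 * ?n * real j - real m)
          = R powr (2 * ?n * real j - real m)"
      proof -
        have q: "0 < ?r / R" using r R by simp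
        have "?s\<^sup>2 = (?r / R) ^ (2 * CARD('n))"
          unfolding vol_coord_def by (simp only: power_mult[symmetric] mult.commute)
        also have "\<dots> = (?r / R) powr real (2 * CARD('n))" using q by (simp only: powr_realpow)
        finally have "(?s\<^sup>2) powr (e - real j) = (?r / R) powr (2 * ?n * (e - real j))"
          by (simp add: powr_powr)
        also have "2 * ?n * (e - real j) = - (2 * ?n * real j - real m)"
          by (simp add: e_def field_simps)
        also have "(?r / R) powr - (2 * ?n * real j - real m)
            = R powr (2 * ?n * real j - real m) / ?r powr (2 * ?n * real j - real m)"
        proof -
          have "(?r / R) powr - k = R powr k / ?r powr k" for k
            using r R by (simp add: powr_minus_divide powr_divide)
          then show ?thesis .
        qed
        finally show ?thesis using r by simp
      qed
      finally show ?thesis by (simp add: abs_mult power_abs)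
    qed
    then have "\<bar>chain_comb ?h ?Q m ?A x\<bar> \<le> (\<Sum>j\<le>m. C * ?K * R powr (2 * ?n * real j - real m) * ?W)"
      unfolding chain_comb_def by (intro order_trans[OF sum_abs] sum_mono) auto
    then show ?thesis by (simp add: D_def sum_distrib_right)
  qed
  moreover have "0 \<le> D" unfolding D_def using C(1) e by (intro sum_nonneg) auto
  ultimately show ?thesis unfolding e_def by blast
qed

lemma finite_multi_indices: "finite {\<alpha> :: 'n::finite \<Rightarrow> nat. (\<Sum>i\<in>UNIV. \<alpha> i) = m}"
proof (rule finite_subset)
  show "{\<alpha> :: 'n \<Rightarrow> nat. (\<Sum>i\<in>UNIV. \<alpha> i) = m} \<subseteq> PiE UNIV (\<lambda>_. {..m})"
  proof
    fix \<alpha> :: "'n \<Rightarrow> nat" assume \<alpha>: "\<alpha> \<in> {\<alpha>. (\<Sum>i\<in>UNIV. \<alpha> i) = m}"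
    have "\<alpha> i \<le> (\<Sum>i\<in>UNIV. \<alpha> i)" for i by (intro member_le_sum) auto
    then show "\<alpha> \<in> PiE UNIV (\<lambda>_. {..m})" using \<alpha> by (auto simp: PiE_def)
  qed
qed (auto intro: finite_PiE)

lemma has_weak_deriv_radial_lift:
  fixes x\<^sub>0 :: "real^'n"
  assumes m: "1 \<le> m" "m < CARD('n)" and R: "0 < R" and f: "pw_cont_pos f" and U: "open U"
    and js: "\<And>i. count_list js i = \<alpha> i" and le: "length js \<le> m"
  shows "has_weak_deriv U \<alpha> (radial_lift x\<^sub>0 R m f)
    (chain_comb (iter_tail (sqrt_profile (real m / (2 * real CARD('n)) - real m) f)) (radial_poly x\<^sub>0 R) m
      (fold (chain_coeff (radial_poly x\<^sub>0 R)) js unit_coeffs))"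
proof -
  obtain E where "primitive_chain (iter_tail (sqrt_profile (real m / (2 * real CARD('n)) - real m) f))
      E (radial_poly x\<^sub>0 R)"
    using primitive_chain_profile[OF f exponent_bounds(3)[OF m] R] by blast
  from primitive_chain.has_weak_deriv_chain_comb[OF this U js le]
  show ?thesis unfolding radial_lift_def[abs_def] .
qed

lemma weakly_diff_radial_lift:
  fixes x\<^sub>0 :: "real^'n"
  assumes m: "1 \<le> m" "m < CARD('n)" and R: "0 < R" and f: "pw_cont_pos f" and U: "open U"
  shows "weakly_diff m U (radial_lift x\<^sub>0 R m f)"
  unfolding weakly_diff_def
proof (intro allI impI)
  fix \<alpha> :: "'n \<Rightarrow> nat" assume \<alpha>: "(\<Sum>i\<in>UNIV. \<alpha> i) \<le> m"
  obtain js where js: "\<And>i. count_list js i = \<alpha> i" using ex_list_count_list[of \<alpha>] by blast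
  have "length js \<le> m" using sum_count_list_eq_length[OF js] \<alpha> by simp
  from has_weak_deriv_radial_lift[OF m R f U js this]
  show "\<exists>v. has_weak_deriv U \<alpha> (radial_lift x\<^sub>0 R m f) v" by blast
qed

lemma Ck_on_radial_lift:
  fixes x\<^sub>0 :: "real^'n"
  assumes m: "1 \<le> m" "m < CARD('n)" and R: "0 < R" and f: "pw_cont_pos f"
  shows "Ck_on (m - 1) UNIV (radial_lift x\<^sub>0 R m f)"
proof -
  obtain E where "primitive_chain (iter_tail (sqrt_profile (real m / (2 * real CARD('n)) - real m) f))
      E (radial_poly x\<^sub>0 R)"
    using primitive_chain_profile[OF f exponent_bounds(3)[OF m] R] by blast
  from primitive_chain.Ck_on_chain[OF this, of "m - 1" m "\<lambda>_. 1"] m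
  show ?thesis unfolding radial_lift_def[abs_def] by (simp add: real_polynomial_function.intros(2))
qed

lemma vol_coord_nonneg: "0 < R \<Longrightarrow> 0 \<le> vol_coord x\<^sub>0 R x"
  by (simp add: vol_coord_def)

lemma vol_coord_less_iff:
  fixes x\<^sub>0 :: "real^'n"
  assumes R: "0 < R" and a: "0 < a"
  shows "vol_coord x\<^sub>0 R x < a \<longleftrightarrow> x \<in> ball x\<^sub>0 (a powr (1 / real CARD('n)) * R)"
proof -
  let ?b = "a powr (1 / real CARD('n))"
  have "?b ^ CARD('n) = a" using a by (simp add: powr_realpow[symmetric] powr_powr)
  then have "vol_coord x\<^sub>0 R x < a \<longleftrightarrow> (norm (x - x\<^sub>0) / R) ^ CARD('n) < ?b ^ CARD('n)"
    by (simp add: vol_coord_def)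
  also have "\<dots> \<longleftrightarrow> norm (x - x\<^sub>0) / R < ?b"
    unfolding not_le[symmetric] using R by (subst power_mono_iff) auto
  finally show ?thesis
    using R by (simp add: dist_norm norm_minus_commute pos_divide_less_eq)
qed

section \<open>Sobolev norms of radial lifts\<close>

text \<open>Almost everywhere the gradient is bounded by a function of the volume coordinate.  The volume
  coordinate maps Lebesgue measure on the ball to \<open>|B(x\<^sub>0,R)| \<le> 1\<close> times Lebesgue measure on
  \<open>(0,1)\<close>, so by rearrangement invariance the norm over the domain is at most the norm of the
  bounding function on \<open>(0,1)\<close>.\<close>

lemma sobolev_norm_radial_lift_le:
  fixes x\<^sub>0 :: "real^'n" and \<Omega> :: "(real^'n) set"
  assumes m: "1 \<le> m" "m < CARD('n)" and R: "0 < R" and \<Omega>: "open \<Omega>" "emeasure lebesgue \<Omega> = 1"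
    and sub: "ball x\<^sub>0 R \<subseteq> \<Omega>"
  shows "\<exists>C>0. \<forall>X f. ri_function_norm X \<longrightarrow> pw_cont_pos f \<longrightarrow>
    sobolev_norm m \<Omega> X (radial_lift x\<^sub>0 R m f) \<le> ennreal C * fun_norm X f"
proof -
  let ?I = "{\<alpha> :: 'n \<Rightarrow> nat. (\<Sum>i\<in>UNIV. \<alpha> i) = m}"
  let ?s = "vol_coord x\<^sub>0 R"
  let ?W = "\<lambda>f t. \<bar>f t\<bar> + t * weighted_tail f (t\<^sup>2)"
  let ?v = "\<lambda>js f. chain_comb (iter_tail (sqrt_profile (real m / (2 * real CARD('n)) - real m) f))
      (radial_poly x\<^sub>0 R) m (fold (chain_coeff (radial_poly x\<^sub>0 R)) js unit_coeffs)"
  have "\<forall>\<alpha>::'n \<Rightarrow> nat. \<exists>js. \<forall>i. count_list js i = \<alpha> i" using ex_list_count_list by blast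
  from choice[OF this] obtain js where js: "\<And>(\<alpha>::'n \<Rightarrow> nat) i. count_list (js \<alpha>) i = \<alpha> i" by blast
  have len: "length (js \<alpha>) = m" if "\<alpha> \<in> ?I" for \<alpha>
    using sum_count_list_eq_length[OF js, of \<alpha>] that by simp
  have "\<forall>\<alpha>. \<exists>C\<ge>0. \<alpha> \<in> ?I \<longrightarrow> (\<forall>f x. pw_cont_pos f \<longrightarrow> x \<noteq> x\<^sub>0 \<longrightarrow> \<bar>?v (js \<alpha>) f x\<bar> \<le> C * ?W f (?s x))"
  proof
    fix \<alpha>
    show "\<exists>C\<ge>0. \<alpha> \<in> ?I \<longrightarrow> (\<forall>f x. pw_cont_pos f \<longrightarrow> x \<noteq> x\<^sub>0 \<longrightarrow> \<bar>?v (js \<alpha>) f x\<bar> \<le> C * ?W f (?s x))"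
    proof (cases "\<alpha> \<in> ?I")
      case True
      then show ?thesis using chain_comb_profile_bound[OF m R len[OF True], of x\<^sub>0] by blast
    qed (intro exI[of _ 0], simp)
  qed
  from choice[OF this] obtain C where C: "\<And>\<alpha>. 0 \<le> C \<alpha>" "\<And>\<alpha> f x. \<alpha> \<in> ?I \<Longrightarrow> pw_cont_pos f \<Longrightarrow>
      x \<noteq> x\<^sub>0 \<Longrightarrow> \<bar>?v (js \<alpha>) f x\<bar> \<le> C \<alpha> * ?W f (?s x)" by blast
  define D where "D = (\<Sum>\<alpha>\<in>?I. C \<alpha>)"
  have D0: "0 \<le> D" unfolding D_def using C(1) by (intro sum_nonneg)
  have \<Omega>s: "\<Omega> \<in> sets lebesgue" using \<Omega>(1) by (simp add: borel_open)
  have "sobolev_norm m \<Omega> X (radial_lift x\<^sub>0 R m f) \<le> ennreal (3 * D + 1) * fun_norm X f"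
    if X: "ri_function_norm X" and f: "pw_cont_pos f" for X f
  proof -
    let ?u = "radial_lift x\<^sub>0 R m f"
    have fp: "pw_cont f" using f by (simp add: pw_cont_pos_def)
    have f_meas [measurable]: "f \<in> borel_measurable borel" by (rule pw_cont_measurable[OF fp])
    have Z_meas [measurable]: "weighted_tail f \<in> borel_measurable borel"
      unfolding weighted_tail_def by (intro pw_cont_measurable pw_cont_tail_integral pw_cont_weight f)
    have s_meas [measurable]: "?s \<in> borel_measurable borel"
      unfolding vol_coord_def[abs_def] by measurable
    have s0: "0 \<le> ?s x" for x by (rule vol_coord_nonneg[OF R])
    have W0: "0 \<le> ?W f t" if "0 \<le> t" for t using that weighted_tail_nonneg[OF f] by simp
    let ?g = "\<lambda>t. ennreal (D * ?W f t)"
    have g_meas: "?g \<in> borel_measurable unit_ivl"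
      by (rule borel_measurable_unit_ivl) measurable
    have gs_meas: "(\<lambda>x. ?g (?s x)) \<in> borel_measurable (lebesgue_on \<Omega>)"
      by (intro measurable_restrict_space1 measurable_completion) measurable
    have wd: "AE x in lebesgue. x \<in> \<Omega> \<longrightarrow> weak_deriv \<Omega> \<alpha> ?u x = ?v (js \<alpha>) f x" if \<alpha>: "\<alpha> \<in> ?I" for \<alpha>
    proof (rule weak_deriv_unique[OF \<Omega>(1)])
      show "has_weak_deriv \<Omega> \<alpha> ?u (?v (js \<alpha>) f)"
        by (rule has_weak_deriv_radial_lift[OF m R f \<Omega>(1) js]) (simp add: len[OF \<alpha>])
      then show "has_weak_deriv \<Omega> \<alpha> ?u (weak_deriv \<Omega> \<alpha> ?u)"
        unfolding weak_deriv_def by (rule someI[where P="has_weak_deriv \<Omega> \<alpha> ?u"])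
      show "\<exists>is. \<forall>i. count_list is i = \<alpha> i" by (rule ex_list_count_list)
    qed
    have "AE x in lebesgue. \<forall>\<alpha>\<in>?I. x \<in> \<Omega> \<longrightarrow> weak_deriv \<Omega> \<alpha> ?u x = ?v (js \<alpha>) f x"
      using finite_multi_indices wd by (intro AE_finite_allI)
    moreover have "AE x in lebesgue. x \<notin> {x\<^sub>0}"
      using negligible_sing[of x\<^sub>0] unfolding negligible_iff_null_sets by (rule AE_not_in)
    ultimately have "AE x in lebesgue. x \<in> \<Omega> \<longrightarrow> \<bar>grad_norm m \<Omega> ?u x\<bar> \<le> D * ?W f (?s x)"
    proof eventually_elim
      case (elim x)
      show ?case
      proof
        assume x: "x \<in> \<Omega>"
        have "\<bar>grad_norm m \<Omega> ?u x\<bar> = L2_set (\<lambda>\<alpha>. weak_deriv \<Omega> \<alpha> ?u x) ?I"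
          unfolding grad_norm_def by (intro abs_of_nonneg L2_set_nonneg)
        also have "\<dots> \<le> (\<Sum>\<alpha>\<in>?I. \<bar>weak_deriv \<Omega> \<alpha> ?u x\<bar>)" by (rule L2_set_le_sum_abs)
        also have "\<dots> \<le> (\<Sum>\<alpha>\<in>?I. C \<alpha> * ?W f (?s x))"
        proof (rule sum_mono)
          fix \<alpha> assume \<alpha>: "\<alpha> \<in> ?I"
          have "weak_deriv \<Omega> \<alpha> ?u x = ?v (js \<alpha>) f x" using elim(1) \<alpha> x by blast
          then show "\<bar>weak_deriv \<Omega> \<alpha> ?u x\<bar> \<le> C \<alpha> * ?W f (?s x)"
            using C(2)[OF \<alpha> f, of x] elim(2) by simp
        qed
        also have "\<dots> = D * ?W f (?s x)" by (simp only: D_def sum_distrib_right)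
        finally show "\<bar>grad_norm m \<Omega> ?u x\<bar> \<le> D * ?W f (?s x)" .
      qed
    qed
    then have "AE x in lebesgue_on \<Omega>. ennreal \<bar>grad_norm m \<Omega> ?u x\<bar> \<le> ?g (?s x)"
      using \<Omega>s by (subst AE_restrict_space_iff) (auto elim!: eventually_mono intro: ennreal_leI)
    then have "sobolev_norm m \<Omega> X ?u \<le> X (rearr (lebesgue_on \<Omega>) (\<lambda>x. ?g (?s x)))"
      unfolding sobolev_norm_def ri_norm_def
      by (intro ri_norm_mono[OF X] borel_measurable_unit_ivl borel_measurable_rearr
          rearr_mono_AE gs_meas)
    also have "\<dots> \<le> X ?g"
    proof (rule ri_norm_rearr_le_of_dist_le[OF X g_meas])
      fix l :: real assume l: "0 < l"
      let ?B = "{t \<in> {0<..<1}. ennreal l < ?g t}"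
      have B: "?B \<in> sets borel" by measurable
      have inB: "?s x \<in> ?B" if "ennreal l < ?g (?s x)" for x
      proof -
        obtain d where d: "d < 1" "\<And>t. d \<le> t \<Longrightarrow> f t = 0" using fp unfolding pw_cont_def by blast
        have "?s x \<noteq> 0"
        proof
          assume z: "?s x = 0"
          have "f 0 = 0" using f unfolding pw_cont_pos_def by auto
          then show False using that l by (simp add: z)
        qed
        moreover have "?s x < 1"
        proof (rule ccontr)
          assume "\<not> ?s x < 1"
          then have "1 \<le> ?s x" by simp
          then have "f (?s x) = 0" "1 \<le> (?s x)\<^sup>2" using d by (auto simp: one_le_power)
          moreover have "weighted_tail f q = 0" if "1 \<le> q" for q
            using that by (cases "q = 1") (auto simp: weighted_tail_def tail_integral_def)
          ultimately show False using that by simp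
        qed
        ultimately show ?thesis using that s0[of x] by simp
      qed
      have "emeasure (lebesgue_on \<Omega>) {x \<in> space (lebesgue_on \<Omega>). ennreal l < ?g (?s x)}
          = emeasure lebesgue {x \<in> \<Omega>. ennreal l < ?g (?s x)}"
        using \<Omega>s by (subst emeasure_restrict_space) (auto simp: space_restrict_space)
      also have "\<dots> \<le> emeasure lebesgue {x. ?s x \<in> ?B}"
      proof (rule emeasure_mono)
        show "{x \<in> \<Omega>. ennreal l < ?g (?s x)} \<subseteq> {x. ?s x \<in> ?B}" using inB by blast
        have "?s -` ?B \<in> sets borel" using measurable_sets_borel[OF s_meas B] .
        then have "{x. ?s x \<in> ?B} \<in> sets lborel" by (simp add: vimage_def)
        then show "{x. ?s x \<in> ?B} \<in> sets lebesgue" by (rule sets_completionI_sets)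
      qed
      also have "\<dots> = emeasure lborel {x. ?s x \<in> ?B}"
      proof -
        have "?s -` ?B \<in> sets borel" using measurable_sets_borel[OF s_meas B] .
        then have "{x. ?s x \<in> ?B} \<in> sets lborel" by (simp add: vimage_def)
        then show ?thesis by (subst emeasure_completion) (auto simp del: sets_lborel mem_Collect_eq)
      qed
      also have "\<dots> = emeasure lborel (ball x\<^sub>0 R) * emeasure lborel ?B"
        by (rule emeasure_vol_coord[OF R B]) auto
      also have "\<dots> \<le> 1 * emeasure lborel ?B"
      proof (rule mult_right_mono)
        have "emeasure lebesgue (ball x\<^sub>0 R) \<le> emeasure lebesgue \<Omega>" by (rule emeasure_mono[OF sub \<Omega>s])
        then show "emeasure lborel (ball x\<^sub>0 R) \<le> 1" using \<Omega>(2) by simp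
      qed simp
      also have "\<dots> = emeasure unit_ivl {t \<in> space unit_ivl. ennreal l < ?g t}"
        using B by (simp only: mult_1 space_unit_ivl) (subst emeasure_unit_ivl, auto)
      finally show "emeasure (lebesgue_on \<Omega>) {x \<in> space (lebesgue_on \<Omega>). ennreal l < ?g (?s x)}
          \<le> emeasure unit_ivl {t \<in> space unit_ivl. ennreal l < ?g t}" .
    qed
    also have "X ?g = X (\<lambda>t. ennreal D * (ennreal \<bar>f t\<bar> + ennreal (t * weighted_tail f (t\<^sup>2))))"
    proof (rule ri_norm_cong[OF X g_meas])
      show "(\<lambda>t. ennreal D * (ennreal \<bar>f t\<bar> + ennreal (t * weighted_tail f (t\<^sup>2))))
          \<in> borel_measurable unit_ivl"
        by (rule borel_measurable_unit_ivl) measurable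
      fix t :: real assume t: "0 < t" "t < 1"
      have Zt: "0 \<le> t * weighted_tail f (t\<^sup>2)" using t weighted_tail_nonneg[OF f] by simp
      have "ennreal (D * ?W f t) = ennreal D * ennreal (?W f t)" using D0 W0 t by (intro ennreal_mult) auto
      also have "ennreal (?W f t) = ennreal \<bar>f t\<bar> + ennreal (t * weighted_tail f (t\<^sup>2))"
        using Zt by (intro ennreal_plus) auto
      finally show "ennreal (D * ?W f t)
          = ennreal D * (ennreal \<bar>f t\<bar> + ennreal (t * weighted_tail f (t\<^sup>2)))" .
    qed
    also have "\<dots> = ennreal D * X (\<lambda>t. ennreal \<bar>f t\<bar> + ennreal (t * weighted_tail f (t\<^sup>2)))"
      using D0 by (intro ri_norm_scale[OF X] borel_measurable_unit_ivl) measurable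
    also have "\<dots> \<le> ennreal D * (X (\<lambda>t. ennreal \<bar>f t\<bar>) + 2 * X (\<lambda>t. ennreal \<bar>f t\<bar>))"
    proof (rule mult_left_mono)
      have "X (\<lambda>t. ennreal \<bar>f t\<bar> + ennreal (t * weighted_tail f (t\<^sup>2)))
          \<le> X (\<lambda>t. ennreal \<bar>f t\<bar>) + X (\<lambda>t. ennreal (t * weighted_tail f (t\<^sup>2)))"
        by (intro ri_norm_triangle[OF X] borel_measurable_unit_ivl) measurable
      also have "\<dots> \<le> X (\<lambda>t. ennreal \<bar>f t\<bar>) + 2 * X (\<lambda>t. ennreal \<bar>f t\<bar>)"
        by (intro add_left_mono ri_norm_weighted_tail_le[OF X f])
      finally show "X (\<lambda>t. ennreal \<bar>f t\<bar> + ennreal (t * weighted_tail f (t\<^sup>2)))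
          \<le> X (\<lambda>t. ennreal \<bar>f t\<bar>) + 2 * X (\<lambda>t. ennreal \<bar>f t\<bar>)" .
    qed simp
    also have "\<dots> = ennreal (3 * D) * fun_norm X f"
    proof -
      have "X (\<lambda>t. ennreal \<bar>f t\<bar>) + 2 * X (\<lambda>t. ennreal \<bar>f t\<bar>) = 3 * X (\<lambda>t. ennreal \<bar>f t\<bar>)"
        using distrib_right[of 1 2 "X (\<lambda>t. ennreal \<bar>f t\<bar>)"] by simp
      moreover have "ennreal (3 * D) = ennreal D * 3"
        using D0 by (subst mult.commute, subst ennreal_mult) auto
      ultimately show ?thesis by (simp add: fun_norm_def mult.assoc)
    qed
    also have "\<dots> \<le> ennreal (3 * D + 1) * fun_norm X f"
      by (intro mult_right_mono ennreal_leI) auto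
    finally show ?thesis .
  qed
  \<comment> \<open>\<open>f\<close> contributes \<open>D\<close> and the weighted tail \<open>2 * D\<close>; adding 1 makes the constant positive\<close>
  moreover have "0 < 3 * D + 1" using D0 by simp
  ultimately show ?thesis by blast
qed

section \<open>Linear combinations\<close>

lemma pw_cont_pos_zero: "pw_cont_pos (\<lambda>t. 0)"
  unfolding pw_cont_pos_def pw_cont_def
  by (intro conjI exI[of _ "{}"] exI[of _ 0] exI[of _ 1]) auto

lemma pw_cont_pos_add: "pw_cont_pos f \<Longrightarrow> pw_cont_pos g \<Longrightarrow> pw_cont_pos (\<lambda>t. f t + g t)"
proof -
  assume f: "pw_cont_pos f" and g: "pw_cont_pos g"
  obtain c where c: "0 < c" "\<And>t. t \<le> c \<Longrightarrow> f t = 0" using f unfolding pw_cont_pos_def by blast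
  obtain d where d: "0 < d" "\<And>t. t \<le> d \<Longrightarrow> g t = 0" using g unfolding pw_cont_pos_def by blast
  have "0 < min c d" "\<forall>t\<le>min c d. f t + g t = 0" using c d by auto
  then show ?thesis using f g pw_cont_add unfolding pw_cont_pos_def by blast
qed

lemma pw_cont_pos_cmult: "pw_cont_pos f \<Longrightarrow> pw_cont_pos (\<lambda>t. c * f t)"
proof -
  assume f: "pw_cont_pos f"
  obtain d where d: "0 < d" "\<And>t. t \<le> d \<Longrightarrow> f t = 0" using f unfolding pw_cont_pos_def by blast
  have "\<forall>t\<le>d. c * f t = 0" using d by auto
  then show ?thesis using f d(1) pw_cont_cmult unfolding pw_cont_pos_def by blast
qed

lemma pw_cont_pos_sum:
  "finite J \<Longrightarrow> (\<And>j. j \<in> J \<Longrightarrow> pw_cont_pos (f j)) \<Longrightarrow> pw_cont_pos (\<lambda>t. \<Sum>j\<in>J. \<alpha> j * f j t)"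
proof (induction J rule: finite_induct)
  case (insert i J)
  have "pw_cont_pos (\<lambda>t. \<alpha> i * f i t + (\<Sum>j\<in>J. \<alpha> j * f j t))"
    using insert by (intro pw_cont_pos_add[OF pw_cont_pos_cmult]) auto
  then show ?case using insert(1,2) by simp
qed (simp add: pw_cont_pos_zero)

lemma radial_lift_sum:
  fixes x\<^sub>0 :: "real^'n"
  assumes m: "1 \<le> m" "m < CARD('n)" and J: "finite J" and f: "\<And>j. j \<in> J \<Longrightarrow> pw_cont_pos (f j)"
  shows "radial_lift x\<^sub>0 R m (\<lambda>t. \<Sum>j\<in>J. \<alpha> j * f j t) x = (\<Sum>j\<in>J. \<alpha> j * radial_lift x\<^sub>0 R m (f j) x)"
  using J f
proof (induction J rule: finite_induct)
  case empty
  have "iter_tail (\<lambda>p. 0) j = (\<lambda>t. 0)" for j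
    using iter_tail_cmult[of 0 "\<lambda>_. 0" j] by simp
  then show ?case by (simp add: radial_lift_def sqrt_profile_def[abs_def])
next
  case (insert i J)
  let ?S = "sqrt_profile (real m / (2 * real CARD('n)) - real m)"
  let ?g = "\<lambda>t. \<Sum>j\<in>J. \<alpha> j * f j t"
  have i: "pw_cont_pos (f i)" and g: "pw_cont_pos ?g" using insert by (auto intro: pw_cont_pos_sum)
  have "?S (\<lambda>t. \<Sum>j\<in>insert i J. \<alpha> j * f j t) = (\<lambda>p. \<alpha> i * ?S (f i) p + ?S ?g p)"
    using insert(1,2) by (simp add: sqrt_profile_def fun_eq_iff algebra_simps)
  moreover have "iter_tail (\<lambda>p. \<alpha> i * ?S (f i) p + ?S ?g p) m
      = (\<lambda>p. \<alpha> i * iter_tail (?S (f i)) m p + iter_tail (?S ?g) m p)"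
    using iter_tail_add[OF pw_cont_cmult[OF pw_cont_sqrt_profile[OF i exponent_bounds(3)[OF m]]]
        pw_cont_sqrt_profile[OF g exponent_bounds(3)[OF m]]]
    by (simp add: iter_tail_cmult)
  ultimately have "radial_lift x\<^sub>0 R m (\<lambda>t. \<Sum>j\<in>insert i J. \<alpha> j * f j t) x
      = \<alpha> i * radial_lift x\<^sub>0 R m (f i) x + radial_lift x\<^sub>0 R m ?g x"
    unfolding radial_lift_def by simp
  then show ?case using insert by simp
qed

section \<open>Fundamental functions\<close>

lemma emeasure_unit_ivl_indicator:
  fixes a b :: real
  assumes "0 \<le> a" "a \<le> b" "b \<le> 1" "0 < l"
  shows "emeasure unit_ivl {x \<in> space unit_ivl. ennreal l < indicator {a<..<b} x}
    = (if l < 1 then ennreal (b - a) else 0)"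
proof (cases "l < 1")
  case True
  then have "ennreal l < 1" using assms(4) by (simp add: ennreal_less_one_iff)
  then have "{x \<in> space unit_ivl. ennreal l < indicator {a<..<b} x} = {a<..<b}"
    using assms by (auto simp: indicator_def)
  moreover have "emeasure unit_ivl {a<..<b} = ennreal (b - a)"
    using assms by (subst emeasure_unit_ivl) auto
  ultimately show ?thesis using True by (simp only: if_True)
next
  case False
  then have "1 \<le> ennreal l" by (simp add: ennreal_ge_1)
  then have "{x \<in> space unit_ivl. ennreal l < indicator {a<..<b} x} = {}"
    by (auto simp: indicator_def split: if_splits)
  then show ?thesis using False by (simp only: emeasure_empty if_False)
qed

lemma indicator_unit_ivl_measurable [simp]:
  "(indicator {a<..<b::real} :: real \<Rightarrow> ennreal) \<in> borel_measurable unit_ivl"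
  by (rule borel_measurable_unit_ivl) simp

context
  fixes N :: "(real \<Rightarrow> ennreal) \<Rightarrow> ennreal"
  assumes N: "ri_function_norm N"
begin

lemma ri_norm_indicator:
  fixes a b :: real
  assumes "0 \<le> a" "a \<le> b" "b \<le> 1"
  shows "N (indicator {a<..<b}) = fundamental N (b - a)"
  unfolding fundamental_def
proof (rule antisym)
  have eq: "emeasure unit_ivl {x \<in> space unit_ivl. ennreal l < indicator {a<..<b} x}
      = emeasure unit_ivl {x \<in> space unit_ivl. ennreal l < indicator {0<..<b - a} x}"
    if "0 < l" for l
    using assms that emeasure_unit_ivl_indicator[of a b l] emeasure_unit_ivl_indicator[of 0 "b - a" l]
    by simp
  show "N (indicator {a<..<b}) \<le> N (indicator {0<..<b - a})"
    by (rule ri_norm_le_of_dist_le[OF N], simp, simp, rule eq_refl, rule eq)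
  show "N (indicator {0<..<b - a}) \<le> N (indicator {a<..<b})"
    by (rule ri_norm_le_of_dist_le[OF N], simp, simp, rule eq_refl, rule eq[symmetric])
qed

lemma fundamental_mono: "(s::real) \<le> t \<Longrightarrow> fundamental N s \<le> fundamental N t"
  unfolding fundamental_def
  by (intro ri_norm_mono[OF N] indicator_unit_ivl_measurable indicator_leI) simp

lemma fundamental_finite: "fundamental N t < \<infinity>"
proof -
  have "fundamental N t \<le> N (\<lambda>t. ennreal 1)"
    unfolding fundamental_def
    by (intro ri_norm_mono[OF N] indicator_unit_ivl_measurable) (simp_all add: indicator_def)
  then show ?thesis using ri_norm_const_finite[OF N, of 1] by (rule le_less_trans)
qed

lemma fundamental_pos:
  assumes t: "0 < t" "t \<le> 1" shows "0 < fundamental N t"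
proof -
  have "fundamental N t \<noteq> 0"
  proof
    assume "fundamental N t = 0"
    then have "AE x in unit_ivl. indicator {0<..<t} x = (0::ennreal)"
      unfolding fundamental_def by (simp add: ri_norm_eq_0_iff[OF N])
    then have "AE x in unit_ivl. \<not> x \<in> {0<..<t}"
      by eventually_elim (simp only: indicator_eq_0_iff, simp)
    then have "emeasure unit_ivl {x \<in> space unit_ivl. x \<in> {0<..<t}} = 0"
      by (rule emeasure_eq_0_AE)
    moreover have "{x \<in> space unit_ivl. x \<in> {0<..<t}} = {0<..<t}" using t by auto
    moreover have "emeasure unit_ivl {0<..<t} = ennreal t" using t by (subst emeasure_unit_ivl) auto
    ultimately show False using t by simp
  qed
  then show ?thesis by (simp add: zero_less_iff_neq_zero)
qed

text \<open>The intervals \<open>(0,t)\<close> and \<open>(t,2t)\<close> have equimeasurable indicators.\<close>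

lemma fundamental_double:
  assumes t: "0 < t" "2 * t \<le> 1" shows "fundamental N (2 * t) \<le> 2 * fundamental N t"
proof -
  have "fundamental N (2 * t) \<le> N (\<lambda>s. indicator {0<..<t} s + indicator {t<..<2 * t} s)"
    unfolding fundamental_def
  proof (rule ri_norm_mono_AE[OF N])
    have "AE s in lebesgue. s \<notin> {t}"
      using negligible_sing[of t] unfolding negligible_iff_null_sets by (rule AE_not_in)
    then have "AE s in unit_ivl. s \<notin> {t}" by (subst AE_restrict_space_iff) auto
    then show "AE s in unit_ivl. indicator {0<..<2 * t} s
        \<le> (indicator {0<..<t} s + indicator {t<..<2 * t} s :: ennreal)"
    proof eventually_elim
      case (elim s)
      then have "s \<noteq> t" by simp
      then have "s \<in> {0<..<t} \<or> s \<in> {t<..<2 * t}" if "s \<in> {0<..<2 * t}"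
        using that by (cases "s < t") auto
      then show ?case by (cases "s \<in> {0<..<2 * t}") (auto simp del: greaterThanLessThan_iff)
    qed
    show "(\<lambda>s. indicator {0<..<t} s + indicator {t<..<2 * t} s :: ennreal) \<in> borel_measurable unit_ivl"
      by (intro borel_measurable_add indicator_unit_ivl_measurable)
  qed simp
  also have "\<dots> \<le> N (indicator {0<..<t}) + N (indicator {t<..<2 * t})"
    by (rule ri_norm_triangle[OF N]) simp_all
  also have "\<dots> = fundamental N t + fundamental N t"
  proof -
    have "N (indicator {0<..<t}) = fundamental N t" by (simp add: fundamental_def)
    moreover have "N (indicator {t<..<2 * t}) = fundamental N (2 * t - t)"
      using t by (intro ri_norm_indicator) linarith+
    ultimately show ?thesis by simp
  qed
  finally show ?thesis by (simp only: mult_2)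
qed

lemma fundamental_double_iter:
  assumes t: "0 < t" "2 ^ k * t \<le> 1" shows "fundamental N (2 ^ k * t) \<le> 2 ^ k * fundamental N t"
  using t(2)
proof (induction k)
  case (Suc k)
  have le: "2 * (2 ^ k * t) \<le> 1" using Suc.prems by (simp add: mult.assoc)
  moreover have "0 < 2 ^ k * t" using t by simp
  ultimately have "fundamental N (2 * (2 ^ k * t)) \<le> 2 * fundamental N (2 ^ k * t)"
    by (intro fundamental_double)
  also have "\<dots> \<le> 2 * (2 ^ k * fundamental N t)"
  proof (rule mult_left_mono)
    show "fundamental N (2 ^ k * t) \<le> 2 ^ k * fundamental N t"
      by (rule Suc.IH) (use le \<open>0 < 2 ^ k * t\<close> in linarith)
  qed simp
  finally show ?case by (simp add: mult.assoc)
qed simp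

end

lemma rearr_unit_ivl_indicator:
  fixes \<tau> :: real
  assumes \<tau>: "\<tau> \<le> 1" and s: "0 < s" "s < \<tau>"
  shows "1 \<le> rearr unit_ivl (indicator {0<..<\<tau>}) s"
  unfolding rearr_def
proof (rule INF_greatest)
  fix l assume l: "l \<in> {l. 0 < l \<and> emeasure unit_ivl {x \<in> space unit_ivl. ennreal l < indicator {0<..<\<tau>} x}
      \<le> ennreal s}"
  have "\<not> l < 1"
  proof
    assume "l < 1"
    then have "ennreal \<tau> \<le> ennreal s"
      using l emeasure_unit_ivl_indicator[of 0 \<tau> l] \<tau> s by simp
    then show False using s by (simp add: ennreal_le_iff)
  qed
  then show "1 \<le> ennreal l" by (simp add: ennreal_ge_1)
qed

text \<open>The embedding is tested on indicators of \<open>(0,t)\<close>, whose maximal function is 1 at \<open>t\<close>.\<close>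

lemma fundamental_le_of_embeds_marcinkiewicz:
  assumes Y: "ri_function_norm Y" and emb: "ri_embeds unit_ivl Y (marcinkiewicz Z)"
  shows "\<exists>C>0. \<forall>t\<in>{0<..<1}. fundamental Z t \<le> ennreal C * fundamental Y t"
proof -
  obtain C where C: "0 < C" "\<And>f. f \<in> ri_space Y unit_ivl \<Longrightarrow>
      ri_norm (marcinkiewicz Z) unit_ivl f \<le> ennreal C * ri_norm Y unit_ivl f"
    using emb unfolding ri_embeds_def embeds_def by blast
  have "fundamental Z t \<le> ennreal C * fundamental Y t" if t: "t \<in> {0<..<1}" for t
  proof -
    let ?f = "indicat_real {0<..<t}" and ?i = "indicator {0<..<t} :: real \<Rightarrow> ennreal"
    have abs: "(\<lambda>x. ennreal \<bar>?f x\<bar>) = ?i" by (auto simp: indicator_def fun_eq_iff)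
    have Yf: "ri_norm Y unit_ivl ?f = fundamental Y t"
      unfolding ri_norm_def abs fundamental_def by (rule ri_norm_rearr[OF Y]) simp
    have "?f \<in> ri_space Y unit_ivl"
      unfolding ri_space_def using Yf fundamental_finite[OF Y] t
      by (auto intro!: borel_measurable_indicator sets_restrict_space_iff[THEN iffD2])
    then have le: "ri_norm (marcinkiewicz Z) unit_ivl ?f \<le> ennreal C * fundamental Y t"
      using C(2) Yf by metis
    have rr: "rearr unit_ivl (rearr unit_ivl ?i) = rearr unit_ivl ?i"
      by (rule ext, rule rearr_rearr) (simp_all add: emeasure_unit_ivl)
    have "ennreal t = (\<integral>\<^sup>+s\<in>{0<..<t}. 1 \<partial>lborel)" using t by simp
    also have "\<dots> \<le> (\<integral>\<^sup>+s\<in>{0<..<t}. rearr unit_ivl ?i s \<partial>lborel)"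
      using t rearr_unit_ivl_indicator[of t] by (intro nn_integral_mono) (auto simp: indicator_def)
    finally have "ennreal t / ennreal t \<le> max_rearr unit_ivl (rearr unit_ivl ?i) t"
      unfolding max_rearr_def rr by (rule divide_right_mono_ennreal)
    then have "1 \<le> max_rearr unit_ivl (rearr unit_ivl ?i) t"
      using t by (simp add: ennreal_divide_self)
    then have "1 * fundamental Z t \<le> max_rearr unit_ivl (rearr unit_ivl ?i) t * fundamental Z t"
      by (rule mult_right_mono) simp
    also have "\<dots> \<le> marcinkiewicz Z (rearr unit_ivl ?i)"
      unfolding marcinkiewicz_def using t by (intro SUP_upper) auto
    also have "\<dots> = ri_norm (marcinkiewicz Z) unit_ivl ?f" unfolding ri_norm_def abs ..
    also note le
    finally show ?thesis by simp
  qed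
  then show ?thesis using C(1) by blast
qed

section \<open>Values of the lifted steps\<close>

text \<open>The profile of a lifted step decreases, so its value at \<open>q = a\<^sup>2 / 2\<close>, where a lower bound is
  available, bounds it from below on the ball \<open>vol_coord \<le> a / 2\<close>.\<close>

lemma radial_lift_step_pos_iff:
  fixes x\<^sub>0 :: "real^'n"
  assumes m: "1 \<le> m" "m < CARD('n)" and R: "0 < R" and a: "0 < a" "a < 1" and c: "0 < c"
  shows "radial_lift x\<^sub>0 R m (step c a) x \<noteq> 0 \<longleftrightarrow> vol_coord x\<^sub>0 R x < a"
    and "vol_coord x\<^sub>0 R x \<le> a / 2 \<Longrightarrow>
      c * a powr (real m / real CARD('n)) / (2 ^ m * fact m) \<le> radial_lift x\<^sub>0 R m (step c a) x"
proof -
  define \<kappa> where "\<kappa> = real m / (2 * real CARD('n)) - real m"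
  let ?s = "vol_coord x\<^sub>0 R x" and ?F = "sqrt_profile \<kappa> (step c a)"
  have \<kappa>: "\<kappa> \<le> 0" unfolding \<kappa>_def by (rule exponent_bounds(3)[OF m])
  obtain k where k: "m = Suc k" using m(1) by (cases m) auto
  have F: "pw_cont ?F" by (intro pw_cont_sqrt_profile pw_cont_pos_step a \<kappa>)
  have F0: "0 \<le> ?F t" for t using c by (simp add: sqrt_profile_def)
  have u: "radial_lift x\<^sub>0 R m (step c a) x = iter_tail ?F m (?s\<^sup>2)"
    by (simp add: radial_lift_def radial_poly_eq \<kappa>_def)
  have s0: "0 \<le> ?s" by (rule vol_coord_nonneg[OF R])
  have anti: "iter_tail ?F m q \<le> iter_tail ?F m p" if "p \<le> q" for p q
    unfolding k iter_tail.simps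
    by (intro tail_integral_antimono pw_cont_iter_tail F iter_tail_nonneg F0 that)
  have low: "c * (a\<^sup>2) powr \<kappa> * (a\<^sup>2 - q) ^ m / fact m \<le> iter_tail ?F m q"
    if "a\<^sup>2 / 4 \<le> q" "q \<le> a\<^sup>2" for q
    unfolding k by (rule iter_tail_step_lower[OF a c \<kappa> that])
  show "radial_lift x\<^sub>0 R m (step c a) x \<noteq> 0 \<longleftrightarrow> ?s < a"
  proof
    assume "?s < a"
    then have lt: "?s\<^sup>2 < a\<^sup>2" using s0 by (intro power_strict_mono) auto
    let ?q = "max (?s\<^sup>2) (a\<^sup>2 / 4)"
    have q: "a\<^sup>2 / 4 \<le> ?q" "?q < a\<^sup>2" using lt a by (auto simp: max_def)
    have "0 < c * (a\<^sup>2) powr \<kappa> * (a\<^sup>2 - ?q) ^ m / fact m"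
      using c a q(2) by (intro divide_pos_pos mult_pos_pos zero_less_power) auto
    also have "\<dots> \<le> iter_tail ?F m ?q" using q by (intro low) auto
    also have "\<dots> \<le> iter_tail ?F m (?s\<^sup>2)" by (rule anti) simp
    finally show "radial_lift x\<^sub>0 R m (step c a) x \<noteq> 0" unfolding u by simp
  next
    assume nz: "radial_lift x\<^sub>0 R m (step c a) x \<noteq> 0"
    show "?s < a"
    proof (rule ccontr)
      assume "\<not> ?s < a"
      then have "a\<^sup>2 \<le> ?s\<^sup>2" using a by (intro power_mono) auto
      moreover have "?F t = 0" if t: "a\<^sup>2 \<le> t" for t
      proof -
        have "a \<le> sqrt t" using t by (rule real_le_rsqrt)
        then show ?thesis by (simp add: sqrt_profile_def)
      qed
      ultimately have "iter_tail ?F m (?s\<^sup>2) = 0" by (intro iter_tail_eq_0)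
      then show False using nz u by simp
    qed
  qed
  assume le: "?s \<le> a / 2"
  have "?s\<^sup>2 \<le> (a / 2)\<^sup>2" using le s0 by (intro power_mono) auto
  also have "\<dots> \<le> a\<^sup>2 / 2" by (simp add: power_divide)
  finally have sq: "?s\<^sup>2 \<le> a\<^sup>2 / 2" .
  have A: "0 < a\<^sup>2" using a by simp
  have "(a\<^sup>2) powr \<kappa> * (a\<^sup>2) ^ m = (a\<^sup>2) powr (\<kappa> + real m)"
    using A by (simp add: powr_add powr_realpow)
  also have "\<dots> = (a powr 2) powr (real m / (2 * real CARD('n)))"
    using a by (simp add: \<kappa>_def)
  also have "\<dots> = a powr (real m / real CARD('n))" by (simp only: powr_powr) simp
  finally have pw: "(a\<^sup>2) powr \<kappa> * (a\<^sup>2) ^ m = a powr (real m / real CARD('n))" .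
  have "c * a powr (real m / real CARD('n)) / (2 ^ m * fact m)
      = c * (a\<^sup>2) powr \<kappa> * (a\<^sup>2 - a\<^sup>2 / 2) ^ m / fact m"
    unfolding pw[symmetric] by (simp add: power_divide)
  also have "\<dots> \<le> iter_tail ?F m (a\<^sup>2 / 2)" using A by (intro low) auto
  also have "\<dots> \<le> iter_tail ?F m (?s\<^sup>2)" by (rule anti[OF sq])
  finally show "c * a powr (real m / real CARD('n)) / (2 ^ m * fact m)
      \<le> radial_lift x\<^sub>0 R m (step c a) x" unfolding u .
qed

lemma ri_norm_finite_if_bounded:
  assumes Y: "ri_function_norm Y" and K: "\<And>x. \<bar>f x\<bar> \<le> K"
  shows "ri_norm Y M f < \<infinity>"
proof -
  have "ri_norm Y M f \<le> Y (\<lambda>t. ennreal (max K 1))"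
    unfolding ri_norm_def
  proof (intro ri_norm_mono[OF Y] borel_measurable_unit_ivl borel_measurable_rearr)
    fix t :: real
    have "{x \<in> space M. ennreal (max K 1) < ennreal \<bar>f x\<bar>} = {}"
    proof -
      have "\<not> ennreal (max K 1) < ennreal \<bar>f x\<bar>" for x
        using K[of x] by (simp add: not_less ennreal_leI)
      then show ?thesis by blast
    qed
    then have "emeasure M {x \<in> space M. ennreal (max K 1) < ennreal \<bar>f x\<bar>} = 0"
      by (simp only: emeasure_empty)
    then have "max K 1 \<in> {l. 0 < l \<and> emeasure M {x \<in> space M. ennreal l < ennreal \<bar>f x\<bar>} \<le> ennreal t}"
      by (simp only: mem_Collect_eq) simp
    then show "rearr M (\<lambda>x. ennreal \<bar>f x\<bar>) t \<le> ennreal (max K 1)"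
      unfolding rearr_def by (rule INF_lower)
  qed simp
  then show ?thesis using ri_norm_const_finite[OF Y, of "max K 1"] by (rule le_less_trans)
qed

lemma radial_lift_bounded:
  fixes x\<^sub>0 :: "real^'n"
  assumes m: "1 \<le> m" "m < CARD('n)" and f: "pw_cont_pos f"
  shows "\<exists>K. \<forall>x. \<bar>radial_lift x\<^sub>0 R m f x\<bar> \<le> K"
proof -
  have "pw_cont (iter_tail (sqrt_profile (real m / (2 * real CARD('n)) - real m) f) m)"
    by (intro pw_cont_iter_tail pw_cont_sqrt_profile f exponent_bounds(3)[OF m])
  then obtain K where K: "\<And>t. 0 \<le> t \<Longrightarrow>
      \<bar>iter_tail (sqrt_profile (real m / (2 * real CARD('n)) - real m) f) m t\<bar> \<le> K"
    unfolding pw_cont_def by blast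
  have "\<bar>radial_lift x\<^sub>0 R m f x\<bar> \<le> K" for x
    unfolding radial_lift_def by (rule K) (simp add: radial_poly_eq)
  then show ?thesis by blast
qed

lemma ri_norm_ge_fundamental:
  assumes Y: "ri_function_norm Y" and b: "0 \<le> b" and f: "f \<in> borel_measurable M"
    and S: "S \<subseteq> space M" "ennreal \<tau> \<le> emeasure M S" and ge: "\<And>x. x \<in> S \<Longrightarrow> b \<le> f x"
  shows "ennreal b * fundamental Y \<tau> \<le> ri_norm Y M f"
proof -
  have "ennreal b * fundamental Y \<tau> = Y (\<lambda>t. ennreal b * indicator {0<..<\<tau>} t)"
    unfolding fundamental_def using b by (intro ri_norm_scale[OF Y, symmetric]) simp_all
  also have "\<dots> \<le> ri_norm Y M f"
    unfolding ri_norm_def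
  proof (intro ri_norm_mono[OF Y] borel_measurable_unit_ivl borel_measurable_rearr)
    show "(\<lambda>t. ennreal b * indicator {0<..<\<tau>} t) \<in> borel_measurable borel" by measurable
    fix t :: real assume t: "0 < t" "t < 1"
    show "ennreal b * indicator {0<..<\<tau>} t \<le> rearr M (\<lambda>x. ennreal \<bar>f x\<bar>) t"
    proof (cases "t < \<tau>")
      case True
      have "ennreal b \<le> rearr M (\<lambda>x. ennreal \<bar>f x\<bar>) t"
        unfolding rearr_def
      proof (rule INF_greatest)
        fix l assume l: "l \<in> {l. 0 < l \<and> emeasure M {x \<in> space M. ennreal l < ennreal \<bar>f x\<bar>} \<le> ennreal t}"
        show "ennreal b \<le> ennreal l"
        proof (rule ccontr)
          assume "\<not> ennreal b \<le> ennreal l"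
          then have lt: "l < b" using b by (meson ennreal_leI not_le)
          have "S \<subseteq> {x \<in> space M. ennreal l < ennreal \<bar>f x\<bar>}"
          proof
            fix x assume x: "x \<in> S"
            have "l < \<bar>f x\<bar>" using ge[OF x] lt by linarith
            then have "ennreal l < ennreal \<bar>f x\<bar>" using l by (intro ennreal_lessI) auto
            then show "x \<in> {x \<in> space M. ennreal l < ennreal \<bar>f x\<bar>}" using x S(1) by blast
          qed
          moreover have "{x \<in> space M. ennreal l < ennreal \<bar>f x\<bar>} \<in> sets M"
            using f by measurable
          ultimately have "emeasure M S \<le> emeasure M {x \<in> space M. ennreal l < ennreal \<bar>f x\<bar>}"
            by (rule emeasure_mono)
          also have "\<dots> \<le> ennreal t" using l by simp
          finally have "ennreal \<tau> \<le> ennreal t" using S(2) by (rule order_trans[rotated])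
          then show False using True t by (simp add: ennreal_le_iff)
        qed
      qed
      then show ?thesis by (simp add: indicator_def)
    qed simp
  qed
  finally show ?thesis .
qed

section \<open>The norm of the lifted steps from below\<close>

lemma fun_norm_step:
  assumes X: "ri_function_norm X" and a: "0 < a" "a < 1" and c: "0 \<le> c"
  shows "fun_norm X (step c a) = ennreal c * fundamental X (a / 2)"
proof -
  have "(\<lambda>t. ennreal \<bar>step c a t\<bar>) = (\<lambda>t. ennreal c * indicator {a / 2<..<a} t)"
    using c by (auto simp: indicator_def fun_eq_iff)
  then have "fun_norm X (step c a) = ennreal c * X (indicator {a / 2<..<a})"
    unfolding fun_norm_def using c by (simp only:) (rule ri_norm_scale[OF X], simp_all)
  also have "X (indicator {a / 2<..<a}) = fundamental X (a - a / 2)"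
    using a by (intro ri_norm_indicator[OF X]) auto
  finally show ?thesis by simp
qed

lemma fundamental_eq_ennreal:
  assumes X: "ri_function_norm X" and t: "0 < t" "t \<le> 1"
  shows "fundamental X t = ennreal (enn2real (fundamental X t))" "0 < enn2real (fundamental X t)"
  using fundamental_finite[OF X, of t] fundamental_pos[OF X t]
  by (simp_all add: enn2real_positive_iff)

lemma radial_lift_measurable:
  fixes x\<^sub>0 :: "real^'n"
  assumes m: "1 \<le> m" "m < CARD('n)" and f: "pw_cont_pos f"
  shows "radial_lift x\<^sub>0 R m f \<in> borel_measurable borel"
proof -
  have "iter_tail (sqrt_profile (real m / (2 * real CARD('n)) - real m) f) m \<in> borel_measurable borel"
    by (intro pw_cont_measurable pw_cont_iter_tail pw_cont_sqrt_profile f exponent_bounds(3)[OF m])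
  moreover have "radial_poly x\<^sub>0 R \<in> borel_measurable borel"
    using Ck_on_polynomial[OF polynomial_radial_poly, of 0 x\<^sub>0 R]
    by (intro borel_measurable_continuous_onI) simp
  ultimately show ?thesis unfolding radial_lift_def[abs_def] by (rule measurable_compose[rotated])
qed

text \<open>Let \<open>v = |B(x\<^sub>0,R)|\<close> and \<open>\<tau> = v a / 2\<close>.  On a set of measure \<open>\<tau>\<close> the lifted step is at least a
  multiple of \<open>a\<^bsup>m/n\<^esup> / \<phi>\<^sub>X(a/2)\<close>.  The norm in \<open>Y\<close> of the indicator of such a set is at
  least a multiple of \<open>\<phi>\<^sub>Z(\<tau>)\<close> by the embedding, hence of \<open>\<tau>\<^bsup>-m/n\<^esup> \<phi>\<^sub>X(\<tau>)\<close>, since \<open>X\<close> is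
  sublimiting.  Doubling compares \<open>\<phi>\<^sub>X(\<tau>)\<close> with \<open>\<phi>\<^sub>X(a/2)\<close>, and all powers of \<open>a\<close> cancel.\<close>

lemma ri_norm_lifted_step_ge:
  fixes x\<^sub>0 :: "real^'n" and \<Omega> :: "(real^'n) set"
  assumes m: "1 \<le> m" "m < CARD('n)" and R: "0 < R" and \<Omega>: "open \<Omega>" "emeasure lebesgue \<Omega> = 1"
    and sub: "ball x\<^sub>0 R \<subseteq> \<Omega>"
    and X: "ri_function_norm X" and Y: "ri_function_norm Y"
    and subl: "sublimiting CARD('n) m X Z" and emb: "ri_embeds unit_ivl Y (marcinkiewicz Z)"
  shows "\<exists>C>0. \<forall>a\<in>{0<..<1}. ennreal C \<le>
    ri_norm Y (lebesgue_on \<Omega>) (radial_lift x\<^sub>0 R m (step (1 / enn2real (fundamental X (a / 2))) a))"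
proof -
  let ?\<theta> = "real m / real CARD('n)"
  define v where "v = measure lborel (ball x\<^sub>0 R)"
  have v: "emeasure lborel (ball x\<^sub>0 R) = ennreal v"
    unfolding v_def by (intro emeasure_eq_ennreal_measure)
      (use emeasure_bounded_finite[of "ball x\<^sub>0 R"] in simp)
  have \<Omega>s: "\<Omega> \<in> sets lebesgue" using \<Omega>(1) by (simp add: borel_open)
  have v0: "0 < v" unfolding v_def using R by (simp add: content_ball_pos)
  have "emeasure lebesgue (ball x\<^sub>0 R) \<le> emeasure lebesgue \<Omega>" by (rule emeasure_mono[OF sub \<Omega>s])
  then have v1: "v \<le> 1" using v \<Omega>(2) by simp
  obtain A where A: "0 < A" "\<And>t. 0 < t \<Longrightarrow> t < 1 \<Longrightarrow>
      ennreal (t powr - ?\<theta>) * fundamental X t \<le> ennreal A * fundamental Z t"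
    using subl unfolding sublimiting_def equivalent_on_def by (auto simp: greaterThanLessThan_def)
  obtain B where B: "0 < B" "\<And>t. 0 < t \<Longrightarrow> t < 1 \<Longrightarrow> fundamental Z t \<le> ennreal B * fundamental Y t"
    using fundamental_le_of_embeds_marcinkiewicz[OF Y emb] by (auto simp: greaterThanLessThan_def)
  obtain k :: nat where k: "(1/2) ^ k < v" using real_arch_pow_inv[of v "1/2"] v0 by auto
  define D where "D = 2 ^ k * (A * B)"
  have D0: "0 < D" using A(1) B(1) by (simp add: D_def)
  \<comment> \<open>\<open>(2 / v) powr \<theta>\<close> is \<open>(a / \<tau>) powr \<theta>\<close>, and \<open>1 / (2 ^ m * fact m)\<close> comes from the lifted step\<close>
  define C where "C = (2 / v) powr ?\<theta> / (2 ^ m * fact m) / D"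
  have C0: "0 < C" using v0 D0 by (simp add: C_def)
  have "ennreal C \<le> ri_norm Y (lebesgue_on \<Omega>)
      (radial_lift x\<^sub>0 R m (step (1 / enn2real (fundamental X (a / 2))) a))" if a: "0 < a" "a < 1" for a
  proof -
    define p where "p = enn2real (fundamental X (a / 2))"
    have p: "fundamental X (a / 2) = ennreal p" "0 < p"
      using fundamental_eq_ennreal[OF X, of "a / 2"] a by (auto simp: p_def)
    define \<tau> where "\<tau> = v * (a / 2)"
    have \<tau>: "0 < \<tau>" "\<tau> < 1"
    proof -
      show "0 < \<tau>" using v0 a by (simp add: \<tau>_def)
      have "\<tau> \<le> 1 * (a / 2)" unfolding \<tau>_def using v1 a by (intro mult_right_mono) auto
      then show "\<tau> < 1" using a by simp
    qed
    let ?c = "1 / p"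
    let ?u = "radial_lift x\<^sub>0 R m (step ?c a)"
    let ?b = "?c * a powr ?\<theta> / (2 ^ m * fact m)"
    have b0: "0 \<le> ?b" using p by simp
    \<comment> \<open>the set where the volume coordinate is below \<open>a / 2\<close>, without the centre\<close>
    let ?S = "{x. vol_coord x\<^sub>0 R x \<in> {0<..<a / 2}}"
    have Sball: "?S \<subseteq> ball x\<^sub>0 R"
    proof
      fix x assume "x \<in> ?S"
      then have "vol_coord x\<^sub>0 R x < 1" using a by simp
      then show "x \<in> ball x\<^sub>0 R" using vol_coord_less_iff[OF R, of 1 x\<^sub>0 x] by simp
    qed
    have lower: "ennreal ?b * fundamental Y \<tau> \<le> ri_norm Y (lebesgue_on \<Omega>) ?u"
    proof (rule ri_norm_ge_fundamental[OF Y b0])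
      show "?u \<in> borel_measurable (lebesgue_on \<Omega>)"
        using radial_lift_measurable[OF m pw_cont_pos_step[OF a, of ?c], of x\<^sub>0 R]
        by (intro measurable_restrict_space1 measurable_completion) (simp only: measurable_lborel1 measurable_lborel2)
      show S: "?S \<subseteq> space (lebesgue_on \<Omega>)" using Sball sub by (auto simp: space_restrict_space)
      have "vol_coord x\<^sub>0 R -` {0<..<a / 2} \<in> sets borel"
        unfolding vol_coord_def[abs_def] by (intro measurable_sets_borel[where M=borel]) measurable
      then have Sb: "?S \<in> sets borel" by (simp add: vimage_def)
      have "emeasure (lebesgue_on \<Omega>) ?S = emeasure lebesgue ?S"
        using \<Omega>s S by (intro emeasure_restrict_space) (auto simp: space_restrict_space)
      also have "\<dots> = emeasure lborel ?S" using Sb by (subst emeasure_completion) (auto simp del: mem_Collect_eq)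
      also have "\<dots> = emeasure lborel (ball x\<^sub>0 R) * emeasure lborel {0<..<a / 2}"
        using a by (intro emeasure_vol_coord[OF R]) auto
      also have "\<dots> = ennreal \<tau>" 
      proof -
        have "emeasure lborel {0<..<a / 2} = ennreal (a / 2)" using a by simp
        moreover have "ennreal v * ennreal (a / 2) = ennreal (v * (a / 2))"
          using a v0 by (intro ennreal_mult[symmetric]) auto
        ultimately show ?thesis unfolding v \<tau>_def by (simp only:)
      qed
      finally show "ennreal \<tau> \<le> emeasure (lebesgue_on \<Omega>) ?S" by simp
      show "?b \<le> ?u x" if "x \<in> ?S" for x
        using that p by (intro radial_lift_step_pos_iff(2)[OF m R a]) auto
    qed
    have "fundamental X (a / 2) \<le> ennreal (2 ^ k) * fundamental X \<tau>"
    proof -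
      have "a / 2 = 2 ^ k * ((1/2) ^ k * (a / 2))" by (simp add: power_one_over)
      then have "fundamental X (a / 2) = fundamental X (2 ^ k * ((1/2) ^ k * (a / 2)))" by (rule arg_cong)
      also have "\<dots> \<le> 2 ^ k * fundamental X ((1/2) ^ k * (a / 2))"
        using a by (intro fundamental_double_iter[OF X]) (auto simp: power_one_over)
      also have "\<dots> \<le> 2 ^ k * fundamental X \<tau>"
      proof (intro mult_left_mono fundamental_mono[OF X])
        show "(1/2) ^ k * (a / 2) \<le> \<tau>" unfolding \<tau>_def using k a by (intro mult_right_mono) auto
      qed simp
      also have "(2 ^ k :: ennreal) = ennreal (2 ^ k)" by (simp add: ennreal_power[symmetric])
      finally show ?thesis .
    qed
    then have "ennreal (\<tau> powr - ?\<theta>) * ennreal p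
        \<le> ennreal (\<tau> powr - ?\<theta>) * (ennreal (2 ^ k) * fundamental X \<tau>)"
      unfolding p(1) by (rule mult_left_mono) simp
    also have "\<dots> = ennreal (2 ^ k) * (ennreal (\<tau> powr - ?\<theta>) * fundamental X \<tau>)"
      by (simp only: mult.left_commute)
    also have "\<dots> \<le> ennreal (2 ^ k) * (ennreal A * fundamental Z \<tau>)"
      by (intro mult_left_mono A(2) \<tau>) simp
    also have "\<dots> \<le> ennreal (2 ^ k) * (ennreal A * (ennreal B * fundamental Y \<tau>))"
      by (intro mult_left_mono B(2) \<tau>) simp_all
    also have "\<dots> = ennreal D * fundamental Y \<tau>"
      using A(1) B(1) by (simp add: D_def ennreal_mult mult.assoc)
    finally have main: "ennreal (\<tau> powr - ?\<theta> * p) \<le> ennreal D * fundamental Y \<tau>"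
      using p(2) by (simp add: ennreal_mult)
    have "\<tau> powr - ?\<theta> * a powr ?\<theta> = (2 / v) powr ?\<theta>"
    proof -
      have "\<tau> powr - ?\<theta> * a powr ?\<theta> = (a / \<tau>) powr ?\<theta>"
        using a \<tau> by (simp add: powr_divide powr_minus_divide)
      also have "a / \<tau> = 2 / v" using a v0 by (simp add: \<tau>_def field_simps)
      finally show ?thesis .
    qed
    then have "C = ?b * (\<tau> powr - ?\<theta> * p) / D"
      using p(2) by (simp add: C_def mult_ac)
    then have "ennreal C = ennreal (?b / D) * ennreal (\<tau> powr - ?\<theta> * p)"
      using b0 D0 p(2) by (subst ennreal_mult[symmetric]) auto
    also have "\<dots> \<le> ennreal (?b / D) * (ennreal D * fundamental Y \<tau>)"
      using main by (rule mult_left_mono) simp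
    also have "\<dots> = ennreal ?b * fundamental Y \<tau>"
    proof -
      have "ennreal (?b / D) * ennreal D = ennreal ?b"
      proof -
        have "0 \<le> ?b / D" using b0 D0 by (rule divide_nonneg_pos)
        then have "ennreal (?b / D) * ennreal D = ennreal (?b / D * D)"
          using D0 by (intro ennreal_mult[symmetric]) auto
        also have "?b / D * D = ?b" using D0 by simp
        finally show ?thesis .
      qed
      then show ?thesis by (simp only: mult.assoc[symmetric])
    qed
    also note lower
    finally show ?thesis unfolding p_def .
  qed
  then show ?thesis using C0 by (intro exI[of _ C]) auto
qed

lemma closure_support_lifted_step:
  fixes x\<^sub>0 :: "real^'n" and \<Omega> :: "(real^'n) set"
  assumes m: "1 \<le> m" "m < CARD('n)" and R: "0 < R" and sub: "ball x\<^sub>0 R \<subseteq> \<Omega>"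
    and a: "0 < a" "a < 1" and c: "0 < c"
  shows "closure {x \<in> \<Omega>. radial_lift x\<^sub>0 R m (step c a) x \<noteq> 0}
    = cball x\<^sub>0 (a powr (1 / real CARD('n)) * R)"
proof -
  let ?r = "a powr (1 / real CARD('n)) * R"
  have "?r \<le> 1 * R" using a R by (intro mult_right_mono powr_le1) auto
  then have "ball x\<^sub>0 ?r \<subseteq> ball x\<^sub>0 R" by (intro subset_ball) simp
  then have "ball x\<^sub>0 ?r \<subseteq> \<Omega>" using sub by (rule order_trans)
  then have "{x \<in> \<Omega>. radial_lift x\<^sub>0 R m (step c a) x \<noteq> 0} = ball x\<^sub>0 ?r"
    unfolding radial_lift_step_pos_iff(1)[OF m R a c] vol_coord_less_iff[OF R a(1)] by blast
  then show ?thesis using a R by (simp add: closure_ball)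
qed

theorem theorem3p7:
  fixes \<Omega> :: "(real^'n) set" and x\<^sub>0 :: "real^'n" and R :: real and m :: nat
    and X YX Y :: "(real \<Rightarrow> ennreal) \<Rightarrow> ennreal"
  assumes "2 \<le> CARD('n)" and "1 \<le> m" and "m < CARD('n)"
    and "open \<Omega>" and "connected \<Omega>" and "bounded \<Omega>" and "emeasure lebesgue \<Omega> = 1"
    and "ri_function_norm X"
    and "optimal_target m \<Omega> X YX"
    and "sublimiting CARD('n) m X YX"
    and "ri_function_norm Y"
    and "ri_embeds unit_ivl YX Y"
    and "ri_embeds unit_ivl Y (marcinkiewicz YX)"
    and "0 < R" and "ball x\<^sub>0 R \<subseteq> \<Omega>"
  shows "\<exists>C\<^sub>1 C\<^sub>2 :: real. 0 < C\<^sub>1 \<and> 0 < C\<^sub>2 \<and>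
    (\<exists>(f :: real \<Rightarrow> real \<Rightarrow> real) (u :: real \<Rightarrow> real^'n \<Rightarrow> real).
      (\<forall>a\<in>{0<..<1}.
         f a \<in> step_functions (a / 2) a \<and>
         u a \<in> sobolev_space m \<Omega> X \<and>
         Ck_on (m - 1) (\<Omega> - {x\<^sub>0}) (u a) \<and>
         sobolev_norm m \<Omega> X (u a) \<le> ennreal C\<^sub>1 * fun_norm X (f a) \<and>
         ennreal C\<^sub>1 * fun_norm X (f a) = ennreal C\<^sub>1 \<and>
         ennreal C\<^sub>2 \<le> ri_norm Y (lebesgue_on \<Omega>) (u a) \<and>
         ri_norm Y (lebesgue_on \<Omega>) (u a) < \<infinity> \<and>
         closure {x \<in> \<Omega>. u a x \<noteq> 0} = cball x\<^sub>0 (a powr (1 / real CARD('n)) * R)) \<and>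
      (\<forall>(M::nat) (\<alpha> :: nat \<Rightarrow> real) (a :: nat \<Rightarrow> real).
         (\<forall>j\<in>{1..M}. a j \<in> {0<..<1}) \<longrightarrow>
         sobolev_norm m \<Omega> X (\<lambda>x. \<Sum>j=1..M. \<alpha> j * u (a j) x)
           \<le> ennreal C\<^sub>1 * fun_norm X (\<lambda>t. \<Sum>j=1..M. \<alpha> j * f (a j) t)))"
proof -
  note m = \<open>1 \<le> m\<close> \<open>m < CARD('n)\<close> and R = \<open>0 < R\<close> and \<Omega> = \<open>open \<Omega>\<close> \<open>emeasure lebesgue \<Omega> = 1\<close>
    and sub = \<open>ball x\<^sub>0 R \<subseteq> \<Omega>\<close> and X = \<open>ri_function_norm X\<close> and Y = \<open>ri_function_norm Y\<close>
  define c where "c a = 1 / enn2real (fundamental X (a / 2))" for a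
  define f where "f a = step (c a) a" for a
  define u where "u a = radial_lift x\<^sub>0 R m (f a)" for a
  obtain C\<^sub>1 where C1: "0 < C\<^sub>1" "\<And>g. pw_cont_pos g \<Longrightarrow>
      sobolev_norm m \<Omega> X (radial_lift x\<^sub>0 R m g) \<le> ennreal C\<^sub>1 * fun_norm X g"
    using sobolev_norm_radial_lift_le[OF m R \<Omega> sub] X by blast
  obtain C\<^sub>2 where C2: "0 < C\<^sub>2" "\<And>a. a \<in> {0<..<1} \<Longrightarrow> ennreal C\<^sub>2 \<le> ri_norm Y (lebesgue_on \<Omega>) (u a)"
    using ri_norm_lifted_step_ge[OF m R \<Omega> sub X Y \<open>sublimiting CARD('n) m X YX\<close>
        \<open>ri_embeds unit_ivl Y (marcinkiewicz YX)\<close>]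
    unfolding u_def f_def c_def by blast
  have cpos: "0 < c a" if "0 < a" "a < 1" for a
    using fundamental_eq_ennreal(2)[OF X, of "a / 2"] that by (simp add: c_def)
  have fpc: "pw_cont_pos (f a)" if "0 < a" "a < 1" for a
    unfolding f_def by (rule pw_cont_pos_step[OF that])
  have norm1: "fun_norm X (f a) = 1" if a: "0 < a" "a < 1" for a
  proof -
    note p = fundamental_eq_ennreal[OF X, of "a / 2"]
    have "fun_norm X (f a) = ennreal (c a) * ennreal (enn2real (fundamental X (a / 2)))"
      unfolding f_def using fun_norm_step[OF X a, of "c a"] cpos[OF a] p(1) a by simp
    also have "\<dots> = ennreal (c a * enn2real (fundamental X (a / 2)))"
      using cpos[OF a] by (subst ennreal_mult) auto
    also have "\<dots> = 1" using p(2) a by (simp add: c_def)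
    finally show ?thesis .
  qed
  have single: "f a \<in> step_functions (a / 2) a \<and> u a \<in> sobolev_space m \<Omega> X \<and>
      Ck_on (m - 1) (\<Omega> - {x\<^sub>0}) (u a) \<and>
      sobolev_norm m \<Omega> X (u a) \<le> ennreal C\<^sub>1 * fun_norm X (f a) \<and>
      ennreal C\<^sub>1 * fun_norm X (f a) = ennreal C\<^sub>1 \<and>
      ennreal C\<^sub>2 \<le> ri_norm Y (lebesgue_on \<Omega>) (u a) \<and>
      ri_norm Y (lebesgue_on \<Omega>) (u a) < \<infinity> \<and>
      closure {x \<in> \<Omega>. u a x \<noteq> 0} = cball x\<^sub>0 (a powr (1 / real CARD('n)) * R)"
    if aI: "a \<in> {0<..<1}" for a
  proof (intro conjI)
    have a: "0 < a" "a < 1" using aI by auto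
    show "f a \<in> step_functions (a / 2) a"
      unfolding step_functions_def f_def using cpos[OF a] by blast
    show le: "sobolev_norm m \<Omega> X (u a) \<le> ennreal C\<^sub>1 * fun_norm X (f a)"
      unfolding u_def by (rule C1(2)[OF fpc[OF a]])
    show eq: "ennreal C\<^sub>1 * fun_norm X (f a) = ennreal C\<^sub>1" using norm1[OF a] by simp
    have out: "u a x = 0" if "x \<notin> \<Omega>" for x
    proof -
      have "x \<notin> ball x\<^sub>0 R" using that sub by blast
      then have "\<not> vol_coord x\<^sub>0 R x < 1" using vol_coord_less_iff[OF R, of 1 x\<^sub>0 x] by simp
      then show ?thesis
        using radial_lift_step_pos_iff(1)[OF m R a cpos[OF a], of x\<^sub>0 x] a unfolding u_def f_def by fastforce
    qed
    have ext: "(\<lambda>x. if x \<in> \<Omega> then u a x else 0) = u a" using out by (auto simp: fun_eq_iff)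
    have "sobolev_norm m \<Omega> X (u a) < \<infinity>"
      using le unfolding eq by (rule le_less_trans) simp
    then show "u a \<in> sobolev_space m \<Omega> X"
      unfolding sobolev_space_def
      using weakly_diff_radial_lift[OF m R fpc[OF a] \<Omega>(1)]
        weakly_diff_radial_lift[OF m R fpc[OF a] open_UNIV]
      by (simp add: ext) (simp add: u_def)
    show "Ck_on (m - 1) (\<Omega> - {x\<^sub>0}) (u a)"
      unfolding u_def by (rule Ck_on_subset[OF Ck_on_radial_lift[OF m R fpc[OF a]] subset_UNIV])
    show "ennreal C\<^sub>2 \<le> ri_norm Y (lebesgue_on \<Omega>) (u a)" by (rule C2(2)[OF aI])
    obtain K where "\<And>x. \<bar>u a x\<bar> \<le> K"
      using radial_lift_bounded[OF m fpc[OF a]] unfolding u_def by blast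
    then show "ri_norm Y (lebesgue_on \<Omega>) (u a) < \<infinity>" by (rule ri_norm_finite_if_bounded[OF Y])
    show "closure {x \<in> \<Omega>. u a x \<noteq> 0} = cball x\<^sub>0 (a powr (1 / real CARD('n)) * R)"
      unfolding u_def f_def by (rule closure_support_lifted_step[OF m R sub a cpos[OF a]])
  qed
  have combination: "sobolev_norm m \<Omega> X (\<lambda>x. \<Sum>j=1..M. \<alpha> j * u (a j) x)
      \<le> ennreal C\<^sub>1 * fun_norm X (\<lambda>t. \<Sum>j=1..M. \<alpha> j * f (a j) t)"
    if aI: "\<forall>j\<in>{1..M}. a j \<in> {0<..<1}" for M :: nat and \<alpha> a :: "nat \<Rightarrow> real"
  proof -
    have pc: "pw_cont_pos (f (a j))" if "j \<in> {1..M}" for j using aI that fpc by simp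
    have "(\<lambda>x. \<Sum>j=1..M. \<alpha> j * u (a j) x) = radial_lift x\<^sub>0 R m (\<lambda>t. \<Sum>j=1..M. \<alpha> j * f (a j) t)"
      unfolding u_def using pc by (intro ext radial_lift_sum[OF m, symmetric]) auto
    moreover have "pw_cont_pos (\<lambda>t. \<Sum>j=1..M. \<alpha> j * f (a j) t)"
      using pc by (intro pw_cont_pos_sum) auto
    ultimately show ?thesis using C1(2) by simp
  qed
  show ?thesis
    using C1(1) C2(1) single combination by blast
qed

end
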